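(* Let $\mathbf w=(\omega_k)_{k\ge 0}$ be a weight sequence (of any type I, II or III), let $\mathcal{T}_n$ be the associated simply generated tree with $n$ vertices, let $v_n$ be a uniformly chosen vertex of $\mathcal{T}_n$, and let $\mathcal{T}^{*}$ be the corresponding pointed limit tree. As $n\to\infty$ along those $n$ for which $\mathcal{T}_n$ is defined, \[ \partial(\mathcal{T}_n,v_n)\xrightarrow{d}\partial(\mathcal{T}^{*}),\qquad \mathbf{E}\bigl[\partial(\mathcal{T}_n,v_n)^p\bigr]\to\mathbf{E}\bigl[\partial(\mathcal{T}^{*})^p\bigr]\quad\text{for every } p\ge 1. \]
   Context: **Simply generated trees.** A weight sequence is a sequence $\mathbf w=(\omega_k)_{k\ge0}$ of non-negative reals with $\omega_0>0$ and $\omega_k>0$ for at least one $k\ge2$. For $n\ge 1$, $\mathcal{T}_n$ is the random rooted plane tree with $n$ vertices such that $\mathbf P(\mathcal{T}_n=T)$ is proportional to $\prod_{v\in T}\omega_{d_T^+(v)}$ for each $n$-vertex rooted plane tree $T$, where $d_T^+(v)$ is the outdegree (number of children) of $v$. Only those $n$ are considered for which some $n$-vertex tree has positive weight ("$\mathcal{T}_n$ is defined"). The vertex $v_n$ is uniform among the vertices of $\mathcal{T}_n$, conditionally on $\mathcal{T}_n$. **Types and offspring law $\xi$.** Let $\Phi(z)=\sum_{k\ge0}\omega_kz^k$ with radius of convergence $R\in[0,\infty]$. Type I: there is a (finite) $\tau\in(0,R]$ with $\Phi(\tau)<\infty$ and $\tau\Phi'(\tau)/\Phi(\tau)=1$;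 then $\mathbf P(\xi=k)=\omega_k\tau^k/\Phi(\tau)$. Type II: $R>0$, $\Phi(R)<\infty$ and $R\Phi'(R)/\Phi(R)<1$; then $\mathbf P(\xi=k)=\omega_kR^k/\Phi(R)$. Type III: $R=0$; then $\xi=0$ almost surely. Put $p_k=\mathbf P(\xi=k)$ and $m=\mathbf E[\xi]\le1$. Let $\mathcal{T}$ be the Bienaymé–Galton–Watson tree with offspring law $\xi$. Let $\hat\xi$ have law $\mathbf P(\hat\xi=k)=kp_k$ for $k\in\{0,1,2,\dots\}$ and $\mathbf P(\hat\xi=\infty)=1-m$. **The pointed limit tree $\mathcal{T}^*$.** Types I and II: start with a marked vertex $u_0$, which is the root of a copy of $\mathcal{T}$. Successively for $j\ge1$, create the parent $u_j$ of $u_{j-1}$: $u_j$ has a number of children given by an independent copy $\hat\xi_j$ of $\hat\xi$. If $\hat\xi_j<\infty$, a uniformly selected child of $u_j$ is identified with $u_{j-1}$, the remaining children become roots of independent copies of $\mathcal{T}$, and the construction continues. If $\hat\xi_j=\infty$ (possible only if $m<1$), $u_j$ has (countably) infinitely many children, one of which is identified with $u_{j-1}$, all others become roots of independent copies of $\mathcal{T}$, and the construction stops. Thus in type I there are infinitely many ancestors $u_1,u_2,\dots$. Type III: $\mathcal{T}^*$ is a vertex with infinitely many children, all of them leaves, exactly one of which is the marked vertex. **Distance to the border.** A leaf is a vertex with no children. For a vertex $v$ of a tree $T$, $\partial(T,v)=\min\{d(v,u):u\text{ a leaf of }T\}$, where $d$ is graph distance. $\partial(\mathcal{T}^* )$ denotes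 the distance from the marked vertex of $\mathcal{T}^*$ to the nearest leaf of $\mathcal{T}^*$ ($\infty$ if there is no leaf). *)

theory Defs
  imports "HOL-Probability.Probability"
begin

section \<open>Distance to the border\<close>

text \<open>
  A rooted tree is given by its vertex set \<open>V\<close> and its relation \<open>C\<close> of pairs (parent, child).
\<close>

definition graph_dist :: "('v \<times> 'v) set \<Rightarrow> 'v \<Rightarrow> 'v \<Rightarrow> enat" where
  "graph_dist C u v = Inf {enat n | n. (u, v) \<in> (C \<union> C\<inverse>) ^^ n}"

definition leaves :: "'v set \<Rightarrow> ('v \<times> 'v) set \<Rightarrow> 'v set" where
  "leaves V C = {u \<in> V. C `` {u} = {}}"

text \<open>The value is \<open>\<infinity>\<close> if there is no leaf.\<close>

definition border_dist :: "'v set \<Rightarrow> ('v \<times> 'v) set \<Rightarrow> 'v \<Rightarrow> enat" where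
  "border_dist V C v = (INF u\<in>leaves V C. graph_dist C v u)"

section \<open>Simply generated trees\<close>

text \<open>
  Plane trees in Ulam--Harris (Neveu) encoding: the root is \<open>[]\<close>, and the children of \<open>u\<close>
  are, from left to right, \<open>u @ [0], u @ [1], \<dots>\<close>
\<close>

definition plane_tree :: "nat list set \<Rightarrow> bool" where
  "plane_tree T \<longleftrightarrow> finite T \<and> [] \<in> T \<and>
     (\<forall>u i. u @ [i] \<in> T \<longrightarrow> u \<in> T \<and> (\<forall>j<i. u @ [j] \<in> T))"

definition child_rel :: "nat list set \<Rightarrow> (nat list \<times> nat list) set" where
  "child_rel T = {(u, v). u \<in> T \<and> v \<in> T \<and> (\<exists>i. v = u @ [i])}"

definition outdeg :: "nat list set \<Rightarrow> nat list \<Rightarrow> nat" where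
  "outdeg T v = card (child_rel T `` {v})"

definition plane_trees :: "nat \<Rightarrow> nat list set set" where
  "plane_trees n = {T. plane_tree T \<and> card T = n}"

definition weight_sequence :: "(nat \<Rightarrow> real) \<Rightarrow> bool" where
  "weight_sequence w \<longleftrightarrow> (\<forall>k. 0 \<le> w k) \<and> 0 < w 0 \<and> (\<exists>k\<ge>2. 0 < w k)"

definition tree_weight :: "(nat \<Rightarrow> real) \<Rightarrow> nat list set \<Rightarrow> real" where
  "tree_weight w T = (\<Prod>v\<in>T. w (outdeg T v))"

definition sgt_defined :: "(nat \<Rightarrow> real) \<Rightarrow> nat \<Rightarrow> bool" where
  "sgt_defined w n \<longleftrightarrow> (\<exists>T\<in>plane_trees n. 0 < tree_weight w T)"

text \<open>Meaningful only if \<open>sgt_defined w n\<close>.\<close>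

definition sgt_pmf :: "(nat \<Rightarrow> real) \<Rightarrow> nat \<Rightarrow> nat list set pmf" where
  "sgt_pmf w n = embed_pmf (\<lambda>T. if T \<in> plane_trees n
     then tree_weight w T / (\<Sum>T'\<in>plane_trees n. tree_weight w T') else 0)"

text \<open>The joint law of the tree and a uniformly chosen vertex of it.\<close>

definition pointed_sgt_pmf :: "(nat \<Rightarrow> real) \<Rightarrow> nat \<Rightarrow> (nat list set \<times> nat list) pmf" where
  "pointed_sgt_pmf w n =
     bind_pmf (sgt_pmf w n) (\<lambda>T. map_pmf (\<lambda>v. (T, v)) (pmf_of_set T))"

definition tree_border_dist :: "nat list set \<times> nat list \<Rightarrow> enat" where
  "tree_border_dist = (\<lambda>(T, v). border_dist T (child_rel T) v)"

section \<open>The offspring law\<close>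

definition gen_fun :: "(nat \<Rightarrow> real) \<Rightarrow> real \<Rightarrow> real" where
  "gen_fun w t = (\<Sum>k. w k * t ^ k)"

definition gen_fun_deriv :: "(nat \<Rightarrow> real) \<Rightarrow> real \<Rightarrow> real" where
  "gen_fun_deriv w t = (\<Sum>k. diffs w k * t ^ k)"

text \<open>
  At the radius of convergence the derivative is the (left) derivative given by the series,
  infinite if the series diverges; hence the summability conditions below. A divergent
  derivative with a convergent generating function makes the quotient infinite, so that
  neither condition holds there.
\<close>

definition type_I_at :: "(nat \<Rightarrow> real) \<Rightarrow> real \<Rightarrow> bool" where
  "type_I_at w t \<longleftrightarrow> 0 < t \<and> ereal t \<le> conv_radius w \<and>
     summable (\<lambda>k. w k * t ^ k) \<and> summable (\<lambda>k. diffs w k * t ^ k) \<and>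
     t * gen_fun_deriv w t / gen_fun w t = 1"

text \<open>
  An infinite radius of convergence is impossible here, since then the generating function
  at the radius would be infinite.
\<close>

definition type_II_at :: "(nat \<Rightarrow> real) \<Rightarrow> real \<Rightarrow> bool" where
  "type_II_at w r \<longleftrightarrow> 0 < r \<and> conv_radius w = ereal r \<and>
     summable (\<lambda>k. w k * r ^ k) \<and> summable (\<lambda>k. diffs w k * r ^ k) \<and>
     r * gen_fun_deriv w r / gen_fun w r < 1"

definition tilted_pmf :: "(nat \<Rightarrow> real) \<Rightarrow> real \<Rightarrow> nat pmf" where
  "tilted_pmf w t = embed_pmf (\<lambda>k. w k * t ^ k / gen_fun w t)"

text \<open>
  For a weight sequence the three types are exhaustive and mutually exclusive, and the
  parameters chosen in types I and II are unique. The last case is type III,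
  \<open>conv_radius w = 0\<close>.
\<close>

definition offspring_pmf :: "(nat \<Rightarrow> real) \<Rightarrow> nat pmf" where
  "offspring_pmf w =
     (if \<exists>t. type_I_at w t then tilted_pmf w (SOME t. type_I_at w t)
      else if \<exists>r. type_II_at w r then tilted_pmf w (SOME r. type_II_at w r)
      else return_pmf 0)"

section \<open>The pointed limit tree\<close>

definition size_biased_pmf :: "nat pmf \<Rightarrow> enat pmf" where
  "size_biased_pmf \<xi> = embed_pmf (\<lambda>h. case h of enat k \<Rightarrow> real k * pmf \<xi> k
     | \<infinity> \<Rightarrow> 1 - measure_pmf.expectation \<xi> real)"

text \<open>
  The number of children of an ancestor \<open>u\<^sub>j\<close> (\<open>j \<ge> 1\<close>) together with the position among them
  of \<open>u\<^sub>j\<^sub>-\<^sub>1\<close>. If there are infinitely many children, the position is immaterial and set to 0.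
\<close>

definition spine_pmf :: "nat pmf \<Rightarrow> (enat \<times> nat) pmf" where
  "spine_pmf \<xi> = bind_pmf (size_biased_pmf \<xi>)
     (\<lambda>h. map_pmf (\<lambda>i. (h, i)) (case h of enat k \<Rightarrow> pmf_of_set {..<k} | \<infinity> \<Rightarrow> return_pmf 0))"

text \<open>
  The Bienayme--Galton--Watson tree, as a function of i.i.d. offspring numbers attached to
  all Ulam--Harris words.
\<close>

definition bgw_space :: "nat pmf \<Rightarrow> (nat list \<Rightarrow> nat) measure" where
  "bgw_space \<xi> = PiM UNIV (\<lambda>_. measure_pmf \<xi>)"

definition bgw_tree :: "(nat list \<Rightarrow> nat) \<Rightarrow> nat list set" where
  "bgw_tree x = {v. \<forall>l<length v. v ! l < x (take l v)}"

text \<open>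
  An outcome \<open>(x, s, y)\<close> consists of the offspring numbers \<open>x\<close> of the copy of the BGW tree rooted
  at \<open>u\<^sub>0\<close>, the spine data \<open>s j\<close> of the ancestors \<open>u\<^sub>j\<close> (\<open>j \<ge> 1\<close>), and the offspring numbers
  \<open>y (j, i)\<close> of the copy of the BGW tree attached at child number \<open>i\<close> of \<open>u\<^sub>j\<close>.
  All coordinates are independent; some of them are not used.

  Vertices: \<open>(0, v)\<close> is the vertex \<open>v\<close> of the tree rooted at the marked vertex \<open>u\<^sub>0 = (0, [])\<close>;
  \<open>(j, [])\<close> is \<open>u\<^sub>j\<close>; and \<open>(j, i # v)\<close> is the vertex \<open>v\<close> of the tree attached at child number \<open>i\<close>
  of \<open>u\<^sub>j\<close>. In type III the offspring law is concentrated at 0 and the size-biased law at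
  \<open>\<infinity>\<close>, so the construction yields a vertex with infinitely many children, all of them leaves,
  one of which is marked.
\<close>

type_synonym limit_outcome =
  "(nat list \<Rightarrow> nat) \<times> (nat \<Rightarrow> enat \<times> nat) \<times> (nat \<times> nat \<Rightarrow> nat list \<Rightarrow> nat)"

definition limit_space :: "nat pmf \<Rightarrow> limit_outcome measure" where
  "limit_space \<xi> = bgw_space \<xi> \<Otimes>\<^sub>M PiM UNIV (\<lambda>_. measure_pmf (spine_pmf \<xi>))
     \<Otimes>\<^sub>M PiM UNIV (\<lambda>_. bgw_space \<xi>)"

text \<open>The construction stops at the first ancestor with infinitely many children.\<close>

definition ancestor_exists :: "(nat \<Rightarrow> enat \<times> nat) \<Rightarrow> nat \<Rightarrow> bool" where
  "ancestor_exists s j \<longleftrightarrow> (\<forall>i\<in>{1..<j}. fst (s i) \<noteq> \<infinity>)"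

definition limit_vertices :: "limit_outcome \<Rightarrow> (nat \<times> nat list) set" where
  "limit_vertices = (\<lambda>(x, s, y).
     {(0, v) | v. v \<in> bgw_tree x} \<union>
     {(j, []) | j. 1 \<le> j \<and> ancestor_exists s j} \<union>
     {(j, i # v) | j i v. 1 \<le> j \<and> ancestor_exists s j \<and>
        enat i < fst (s j) \<and> i \<noteq> snd (s j) \<and> v \<in> bgw_tree (y (j, i))})"

definition limit_child_rel :: "limit_outcome \<Rightarrow> ((nat \<times> nat list) \<times> (nat \<times> nat list)) set" where
  "limit_child_rel \<omega> = {(a, b). a \<in> limit_vertices \<omega> \<and> b \<in> limit_vertices \<omega> \<and>
     ((\<exists>j v i. a = (j, v) \<and> b = (j, v @ [i])) \<or> (\<exists>j. a = (Suc j, []) \<and> b = (j, [])))}"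

definition limit_border_dist :: "limit_outcome \<Rightarrow> enat" where
  "limit_border_dist \<omega> = border_dist (limit_vertices \<omega>) (limit_child_rel \<omega>) (0, [])"

section \<open>Distances as real numbers\<close>

definition real_of_enat :: "enat \<Rightarrow> real" where
  "real_of_enat d = real_of_ereal (ereal_of_enat d)"

definition enat_powr :: "enat \<Rightarrow> real \<Rightarrow> ennreal" where
  "enat_powr d p = (case d of enat k \<Rightarrow> ennreal (real k powr p) | \<infinity> \<Rightarrow> \<infinity>)"

end

theory Submission
  imports Defs
begin

text \<open>
  Let \<open>\<Phi>\<close> and \<open>T\<close> be the generating functions of the weights and of the weighted trees, so that
  \<open>T = x \<Phi>(T)\<close>, and let \<open>C = \<Sum>\<^sub>n [x\<^sup>n] \<Phi>\<^sup>n x\<^sup>n = 1 / (1 - x \<Phi>'(T))\<close>, the generating function of the trees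
  with a marked hole. Decomposing along the path from the root to the marked vertex, the trees with a
  marked vertex at distance at least \<open>R\<close> from the leaves have, up to a negligible term, a generating
  function \<open>B C\<close>, where \<open>B\<close> counts the fringe subtrees at the \<open>(R - 2)\<close>-nd ancestor; all marked
  trees are counted by \<open>T C\<close>.

  The coefficients of \<open>C\<close> and \<open>T C\<close> are sums over words, which satisfy a ratio limit theorem: a fixed
  letter \<open>b\<close> has asymptotic frequency \<open>P(\<xi> = b)\<close>. In types I and II this follows from Jensen's inequality
  for the number of letters \<open>b\<close> and from the growth rate \<open>\<Phi>(t) / t\<close> of the coefficients of \<open>C\<close>, in type
  III from an exchange of letters. Thus the coefficients of \<open>B C\<close> can be compared term by term with
  the limit, and it remains to see that no mass escapes. A subtree with bounded degree at the root is
  large with small probability because Galton--Watson trees are finite. A vertex with \<open>k\<close> children, none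
  of them a leaf, is compared with one that has exactly one leaf among its children, for which there
  are \<open>k\<close> choices. The same coefficientwise comparison gives \<open>P(\<partial> \<ge> R) \<le> (1 - \<epsilon>)\<^sup>R\<close> uniformly in \<open>n\<close>,
  hence convergence of all moments.
\<close>

text \<open>The obstacle is condensation: in types II and III a single vertex may have a degree of
  the order of the tree size, so the fringe subtree of an unrestricted ancestor need not be tight,
  and \<open>A 0\<close> cannot be treated term by term. An ancestor \<open>j\<close> with
  \<open>1 \<le> j \<le> R - 2\<close>, however, contributes a factor \<open>A i\<close> with
  \<open>i \<ge> 1\<close>: its other children are not leaves, and this is what makes large degrees
  unlikely. All higher ancestors are absorbed into \<open>C\<close>, so that their sizes are never
  examined. Hence the cut at height \<open>R - 2\<close>. A second obstacle is periodicity: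
  coefficients of \<open>C\<close> may vanish along whole residue classes. Limits are therefore
  taken along the filter \<open>flt c\<close> of lengths with positive total weight, and a size
  \<open>l\<close> is split off only if \<open>T $ l > 0\<close>. The rate
  \<open>\<Phi>(t) / t\<close> has a convexity origin: \<open>t\<close> minimises
  \<open>\<Phi>(s) / s\<close>, whereas convergence of \<open>C\<close> at a point
  \<open>x > t / \<Phi>(t)\<close> would produce \<open>s\<close> with
  \<open>\<Phi>(s) / s = 1 / x\<close>. Types I and II differ only in the reason for this
  minimality, and are treated together.\<close>

unbundle no vec_syntax and fps_syntax

section \<open>Power series with nonnegative coefficients\<close>

definition fps_le :: "real fps \<Rightarrow> real fps \<Rightarrow> bool" (infix "\<preceq>" 50) where
  "F \<preceq> G \<longleftrightarrow> (\<forall>n. F $ n \<le> G $ n)"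

lemma fps_leD: "F \<preceq> G \<Longrightarrow> F $ n \<le> G $ n"
  by (simp add: fps_le_def)

lemma fps_le_refl [simp]: "F \<preceq> F"
  by (simp add: fps_le_def)

lemma fps_le_trans [trans]: "F \<preceq> G \<Longrightarrow> G \<preceq> H \<Longrightarrow> F \<preceq> H"
  unfolding fps_le_def by (meson order_trans)

lemma fps_nonneg_nth: "0 \<preceq> F \<Longrightarrow> 0 \<le> F $ n"
  by (simp add: fps_le_def)

lemma fps_nonneg_mult: "0 \<preceq> F \<Longrightarrow> 0 \<preceq> G \<Longrightarrow> 0 \<preceq> F * G"
  unfolding fps_le_def by (auto simp: fps_mult_nth intro!: sum_nonneg)

lemma fps_nonneg_1 [simp]: "0 \<preceq> 1"
  by (simp add: fps_le_def)

lemma fps_nonneg_X [simp]: "0 \<preceq> fps_X"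
  by (simp add: fps_le_def fps_X_def)

lemma fps_nonneg_const: "0 \<le> c \<Longrightarrow> 0 \<preceq> fps_const c"
  by (simp add: fps_le_def fps_const_def)

lemma fps_nonneg_power: "0 \<preceq> F \<Longrightarrow> 0 \<preceq> F ^ n"
  by (induction n) (auto intro: fps_nonneg_mult)

lemma fps_nonneg_prod: "(\<And>i. i \<in> I \<Longrightarrow> 0 \<preceq> F i) \<Longrightarrow> 0 \<preceq> prod F I"
  by (induction I rule: infinite_finite_induct) (auto intro!: fps_nonneg_mult)

lemma fps_nonneg_compose: "0 \<preceq> a \<Longrightarrow> 0 \<preceq> F \<Longrightarrow> 0 \<preceq> a oo F"
  using fps_nonneg_power[of F]
  by (auto simp: fps_le_def fps_compose_nth intro!: sum_nonneg)

lemma fps_le_add: "F \<preceq> F' \<Longrightarrow> G \<preceq> G' \<Longrightarrow> F + G \<preceq> F' + G'"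
  by (simp add: fps_le_def add_mono)

lemma fps_le_mult:
  assumes "F \<preceq> F'" "G \<preceq> G'" "0 \<preceq> F" "0 \<preceq> G"
  shows "F * G \<preceq> F' * G'"
  using assms unfolding fps_le_def fps_mult_nth
  by (intro allI sum_mono mult_mono) (auto intro: order_trans)

lemma fps_le_mult_left: "0 \<preceq> H \<Longrightarrow> F \<preceq> G \<Longrightarrow> H * F \<preceq> H * G"
  unfolding fps_le_def fps_mult_nth by (intro allI sum_mono mult_left_mono) auto

lemma fps_le_mult_right: "0 \<preceq> H \<Longrightarrow> F \<preceq> G \<Longrightarrow> F * H \<preceq> G * H"
  using fps_le_mult_left[of H F G] by (simp add: mult.commute)

lemma fps_le_power: "F \<preceq> G \<Longrightarrow> 0 \<preceq> F \<Longrightarrow> F ^ n \<preceq> G ^ n"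
proof (induction n)
  case (Suc n)
  then show ?case by (auto intro!: fps_le_mult fps_nonneg_power)
qed simp

lemma fps_le_compose: "0 \<preceq> a \<Longrightarrow> F \<preceq> G \<Longrightarrow> 0 \<preceq> F \<Longrightarrow> a oo F \<preceq> a oo G"
  using fps_le_power[of F G]
  by (auto simp: fps_le_def fps_compose_nth intro!: sum_mono mult_left_mono)

lemma fps_power_nth_below:
  assumes "(F :: real fps) $ 0 = 0" "n < k"
  shows "(F ^ k * G) $ n = 0"
proof -
  have "F ^ k $ i = 0" if "i < k" for i
    using startsby_zero_power_prefix[OF assms(1)] that by auto
  then show ?thesis
    using assms(2) by (auto simp: fps_mult_nth intro!: sum.neutral)
qed

text \<open>The bound \<open>N\<close> is left free so that several expansions can be compared term
  by term over one index range; the terms with \<open>k > n\<close> vanish.\<close>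

lemma fps_compose_mult_nth:
  assumes "(F :: real fps) $ 0 = 0" "n \<le> N"
  shows "((a oo F) * G) $ n = (\<Sum>k\<le>N. a $ k * (F ^ k * G) $ n)"
proof -
  have "(F ^ k) $ i = 0" if "i < k" for i k
    using startsby_zero_power_prefix[OF assms(1)] that by auto
  then have comp: "(a oo F) $ i = (\<Sum>k\<le>N. a $ k * (F ^ k) $ i)" if "i \<le> N" for i
    unfolding fps_compose_nth using that by (intro sum.mono_neutral_left) auto
  have "((a oo F) * G) $ n = (\<Sum>i\<le>n. (\<Sum>k\<le>N. a $ k * (F ^ k) $ i) * G $ (n - i))"
    unfolding fps_mult_nth using assms(2) comp by (simp add: atLeast0AtMost)
  also have "\<dots> = (\<Sum>k\<le>N. \<Sum>i\<le>n. a $ k * ((F ^ k) $ i * G $ (n - i)))"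
    by (simp add: sum_distrib_right mult.assoc) (rule sum.swap)
  finally show ?thesis
    by (simp add: fps_mult_nth sum_distrib_left atLeast0AtMost)
qed

text \<open>With values in \<open>ennreal\<close>, products and compositions of nonnegative series
  evaluate unconditionally, and divergence is simply the value \<open>top\<close>.\<close>

definition fps_ev :: "real fps \<Rightarrow> ennreal \<Rightarrow> ennreal" where
  "fps_ev F x = (\<Sum>n. ennreal (F $ n) * x ^ n)"

lemma suminf_swap_ennreal: "(\<Sum>i. \<Sum>j. f i j) = (\<Sum>j. \<Sum>i. f i j :: ennreal)"
  using nn_integral_suminf[of "\<lambda>i j. f i j" "count_space UNIV"]
  by (simp add: nn_integral_count_space_nat)

lemma sums_shift_ennreal:
  "(\<lambda>n. if i \<le> n then f (n - i) else 0) sums (\<Sum>n. f n :: ennreal)"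
proof (induction i)
  case 0
  then show ?case by (simp add: summable_sums)
next
  case (Suc i)
  have "(\<lambda>n. if Suc i \<le> Suc n then f (Suc n - Suc i) else 0) sums suminf f"
    using Suc by (simp only: diff_Suc_Suc Suc_le_mono)
  from sums_Suc[OF this] show ?case by simp
qed

lemma suminf_Cauchy_ennreal:
  fixes f g :: "nat \<Rightarrow> ennreal"
  shows "(\<Sum>n. \<Sum>i\<le>n. f i * g (n - i)) = (\<Sum>i. f i) * (\<Sum>j. g j)"
proof -
  have "(\<Sum>n. \<Sum>i\<le>n. f i * g (n - i)) = (\<Sum>n. \<Sum>i. if i \<le> n then f i * g (n - i) else 0)"
  proof (intro suminf_cong)
    fix n
    show "(\<Sum>i\<le>n. f i * g (n - i)) = (\<Sum>i. if i \<le> n then f i * g (n - i) else 0)"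
      by (subst suminf_finite[of "{..n}"]) auto
  qed
  also have "\<dots> = (\<Sum>i. \<Sum>n. if i \<le> n then f i * g (n - i) else 0)"
    by (rule suminf_swap_ennreal)
  also have "\<dots> = (\<Sum>i. \<Sum>n. f i * g n)"
    by (intro suminf_cong sums_unique[symmetric] sums_shift_ennreal[of _ "\<lambda>n. f _ * g n"])
  finally show ?thesis
    by (simp add: ennreal_suminf_cmult ennreal_suminf_multc)
qed

lemma fps_ev_mult:
  assumes "0 \<preceq> F" "0 \<preceq> G"
  shows "fps_ev (F * G) x = fps_ev F x * fps_ev G x"
proof -
  have "fps_ev (F * G) x = (\<Sum>n. \<Sum>i\<le>n. (ennreal (F $ i) * x ^ i) * (ennreal (G $ (n - i)) * x ^ (n - i)))"
    unfolding fps_ev_def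
  proof (intro suminf_cong)
    fix n
    have "ennreal ((F * G) $ n) * x ^ n = (\<Sum>i\<le>n. ennreal (F $ i * G $ (n - i)) * x ^ n)"
      using assms unfolding fps_le_def
      by (subst sum_distrib_right[symmetric], subst sum_ennreal)
         (auto simp: fps_mult_nth atLeast0AtMost)
    also have "\<dots> = (\<Sum>i\<le>n. (ennreal (F $ i) * x ^ i) * (ennreal (G $ (n - i)) * x ^ (n - i)))"
    proof (intro sum.cong refl)
      fix i assume "i \<in> {..n}"
      then have "x ^ n = x ^ i * x ^ (n - i)"
        by (simp flip: power_add)
      then show "ennreal (F $ i * G $ (n - i)) * x ^ n =
          (ennreal (F $ i) * x ^ i) * (ennreal (G $ (n - i)) * x ^ (n - i))"
        using assms by (simp add: fps_le_def ennreal_mult ac_simps)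
    qed
    finally show "ennreal ((F * G) $ n) * x ^ n = \<dots>" .
  qed
  also have "\<dots> = fps_ev F x * fps_ev G x"
    unfolding fps_ev_def by (rule suminf_Cauchy_ennreal)
  finally show ?thesis .
qed

lemma fps_ev_1 [simp]: "fps_ev 1 x = 1"
proof -
  have "fps_ev 1 x = (\<Sum>n\<in>{0}. ennreal ((1 :: real fps) $ n) * x ^ n)"
    unfolding fps_ev_def by (intro suminf_finite) auto
  then show ?thesis by simp
qed

lemma fps_ev_X [simp]: "fps_ev fps_X x = x"
proof -
  have "fps_ev fps_X x = (\<Sum>n\<in>{1}. ennreal (fps_X $ n) * x ^ n)"
    unfolding fps_ev_def by (intro suminf_finite) (auto simp: fps_X_def)
  then show ?thesis by simp
qed

lemma fps_ev_power: "0 \<preceq> F \<Longrightarrow> fps_ev (F ^ n) x = fps_ev F x ^ n"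
  by (induction n) (auto simp: fps_ev_mult fps_nonneg_power)

lemma fps_ev_prod:
  "(\<And>i. i \<in> I \<Longrightarrow> 0 \<preceq> F i) \<Longrightarrow> fps_ev (prod F I) x = (\<Prod>i\<in>I. fps_ev (F i) x)"
  by (induction I rule: infinite_finite_induct) (auto simp: fps_ev_mult fps_nonneg_prod)

lemma fps_ev_compose:
  assumes "0 \<preceq> a" "0 \<preceq> F" "F $ 0 = 0"
  shows "fps_ev (a oo F) x = fps_ev a (fps_ev F x)"
proof -
  have nn: "0 \<le> a $ k" "0 \<le> (F ^ k) $ n" for k n
    using assms fps_nonneg_power[of F k] by (auto simp: fps_le_def)
  have z: "(F ^ k) $ n = 0" if "n < k" for k n
    using startsby_zero_power_prefix[OF assms(3)] that by auto
  have "fps_ev (a oo F) x = (\<Sum>n. \<Sum>k. ennreal (a $ k) * (ennreal ((F ^ k) $ n) * x ^ n))"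
    unfolding fps_ev_def
  proof (intro suminf_cong)
    fix n
    have "ennreal ((a oo F) $ n) * x ^ n = (\<Sum>k\<le>n. ennreal (a $ k * (F ^ k) $ n) * x ^ n)"
      using nn by (subst sum_distrib_right[symmetric], subst sum_ennreal)
        (auto simp: fps_compose_nth atLeast0AtMost)
    also have "\<dots> = (\<Sum>k. ennreal (a $ k) * (ennreal ((F ^ k) $ n) * x ^ n))"
      by (subst suminf_finite[of "{..n}"]) (auto simp: z nn ennreal_mult ac_simps)
    finally show "ennreal ((a oo F) $ n) * x ^ n = \<dots>" .
  qed
  also have "\<dots> = (\<Sum>k. ennreal (a $ k) * fps_ev (F ^ k) x)"
    by (subst suminf_swap_ennreal) (simp add: fps_ev_def)
  finally show ?thesis
    using assms(2) by (simp add: fps_ev_power) (simp add: fps_ev_def)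
qed

lemma fps_ev_ge_nth: "ennreal (F $ n) * x ^ n \<le> fps_ev F x"
proof -
  have "(\<Sum>k\<in>{n}. ennreal (F $ k) * x ^ k) \<le> fps_ev F x"
    unfolding fps_ev_def by (intro sum_le_suminf) auto
  then show ?thesis by simp
qed

lemma fps_ev_mono: "F \<preceq> G \<Longrightarrow> fps_ev F x \<le> fps_ev G x"
  unfolding fps_ev_def
  by (intro suminf_le) (auto simp: fps_le_def intro!: mult_right_mono ennreal_leI)

lemma fps_ev_mono_arg: "x \<le> y \<Longrightarrow> fps_ev F x \<le> fps_ev F y"
  unfolding fps_ev_def
  by (intro suminf_le) (auto intro!: mult_left_mono power_mono)

text \<open>The comparison is made for each power separately, so that a gain depending on the
  exponent \<open>k\<close> is kept, as in \<open>big_C_le\<close>.\<close>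

lemma fps_le_compose_mult:
  assumes "F $ 0 = 0" "H $ 0 = 0"
    and "\<And>k n. a $ k * (F ^ k * G) $ n \<le> b $ k * (H ^ k * G') $ n"
  shows "(a oo F) * G \<preceq> (b oo H) * G'"
  unfolding fps_le_def
  using fps_compose_mult_nth[OF assms(1) order_refl] fps_compose_mult_nth[OF assms(2) order_refl]
  by (auto intro!: sum_mono assms(3))

lemma fps_const_mult_le:
  "c \<le> d \<Longrightarrow> 0 \<preceq> F \<Longrightarrow> fps_const c * F \<preceq> fps_const d * F"
  by (simp add: fps_le_def mult_right_mono)

lemma fps_compose_mono_left:
  assumes "a \<preceq> b" "0 \<preceq> F"
  shows "a oo F \<preceq> b oo F"
  using assms fps_nonneg_power[OF assms(2)]
  by (auto simp: fps_le_def fps_compose_nth intro!: sum_mono mult_right_mono)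

text \<open>Of the expansion of \<open>(a + b) ^ j\<close> only the \<open>j\<close> words with
  exactly one factor \<open>b\<close> are kept.\<close>

lemma fps_power_add_ge:
  assumes "0 \<preceq> a" "0 \<preceq> b"
  shows "of_nat j * (b * a ^ (j - 1)) \<preceq> (a + b) ^ j"
proof (induction j)
  case (Suc j)
  have le: "a ^ j \<preceq> (a + b) ^ j"
    using assms by (intro fps_le_power) (auto simp: fps_le_def)
  have "of_nat (Suc j) * (b * a ^ (Suc j - 1)) = a * (of_nat j * (b * a ^ (j - 1))) + b * a ^ j"
    by (cases j) (auto simp: algebra_simps)
  also have "\<dots> \<preceq> a * (a + b) ^ j + b * (a + b) ^ j"
    using assms Suc.IH le by (intro fps_le_add fps_le_mult_left)
  also have "\<dots> = (a + b) ^ Suc j"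
    by (simp add: algebra_simps)
  finally show ?case .
qed simp

text \<open>Double counting of the sum of the letters in words of length \<open>n\<close> and sum
  \<open>s\<close>, all positions being exchangeable; analytically, \<open>fps_X * fps_deriv\<close>
  is applied to \<open>F ^ n\<close>.\<close>

lemma fps_power_mean_identity:
  fixes F :: "real fps"
  shows "real s * (F ^ n) $ s = real n * (\<Sum>b\<le>s. real b * F $ b * (F ^ (n - 1)) $ (s - b))"
proof -
  have "real s * (F ^ n) $ s = (fps_X * fps_deriv (F ^ n)) $ s"
    by (cases s) auto
  also have "fps_X * fps_deriv (F ^ n) = fps_const (real n) * ((fps_X * fps_deriv F) * F ^ (n - 1))"
    unfolding fps_deriv_power by (simp only: ac_simps)
  also have "\<dots> $ s = real n * ((fps_X * fps_deriv F) * F ^ (n - 1)) $ s"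
    by (rule fps_mult_left_const_nth)
  also have "((fps_X * fps_deriv F) * F ^ (n - 1)) $ s =
      (\<Sum>b\<le>s. real b * F $ b * (F ^ (n - 1)) $ (s - b))"
    unfolding fps_mult_nth[of "fps_X * fps_deriv F"] atLeast0AtMost
  proof (intro sum.cong refl)
    fix b
    have "(fps_X * fps_deriv F) $ b = real b * F $ b"
      by (cases b) auto
    then show "(fps_X * fps_deriv F) $ b * F ^ (n - 1) $ (s - b) = real b * F $ b * (F ^ (n - 1)) $ (s - b)"
      by simp
  qed
  finally show ?thesis .
qed

section \<open>Generating functions of weighted trees\<close>

text \<open>Only the fixed point equation of \<open>T\<close> enters here; actual trees appear when
  the locale is interpreted with \<open>trees_gf w\<close>, and the asymptotics take place among
  power series.\<close>

locale weighted_trees =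
  fixes w :: "nat \<Rightarrow> real" and T :: "real fps"
  assumes w: "weight_sequence w" and T_nonneg: "0 \<preceq> T"
    and T_eq: "T = fps_X * (Abs_fps w oo T)"
begin

definition \<Phi> :: "real fps" where "\<Phi> = Abs_fps w"

definition C :: "real fps" where "C = Abs_fps (\<lambda>n. (\<Phi> ^ n) $ n)"

text \<open>Trees without leaves at depth less than \<open>k\<close>: subtracting \<open>w 0\<close>
  forbids a childless root. The identification is \<open>D_gf\<close>.\<close>

fun D :: "nat \<Rightarrow> real fps" where
  "D 0 = T"
| "D (Suc k) = fps_X * ((\<Phi> - fps_const (w 0)) oo D k)"

declare D.simps(2) [simp del]

text \<open>One ancestor of the marked vertex: the derivative selects the child on the path, and the
  other children carry trees counted by \<open>D i\<close>.\<close>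

definition A :: "nat \<Rightarrow> real fps" where "A i = fps_X * (fps_deriv \<Phi> oo D i)"

lemma w_nonneg [simp]: "0 \<le> w k"
  using w by (auto simp: weight_sequence_def)

lemma w_0: "0 < w 0"
  using w by (auto simp: weight_sequence_def)

lemma \<Phi>_nth [simp]: "\<Phi> $ k = w k"
  by (simp add: \<Phi>_def)

lemma \<Phi>_nonneg: "0 \<preceq> \<Phi>"
  by (simp add: fps_le_def)

lemma \<Phi>_pow_nonneg: "0 \<preceq> \<Phi> ^ n"
  by (simp add: \<Phi>_nonneg fps_nonneg_power)

lemma \<Phi>_minus_nonneg: "0 \<preceq> \<Phi> - fps_const (w 0)"
  by (simp add: fps_le_def fps_const_def)

lemma deriv_\<Phi>_nonneg: "0 \<preceq> fps_deriv \<Phi>"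
  by (simp add: fps_le_def)

lemma C_nonneg: "0 \<preceq> C"
  using \<Phi>_pow_nonneg by (auto simp: fps_le_def C_def)

lemma T_\<Phi>: "T = fps_X * (\<Phi> oo T)"
  using T_eq by (simp add: \<Phi>_def)

lemma T_0 [simp]: "T $ 0 = 0"
  by (subst T_\<Phi>) simp

lemma D_0 [simp]: "D k $ 0 = 0"
  by (cases k) (auto simp: D.simps)

lemma D_nonneg: "0 \<preceq> D k"
  by (induction k) (auto simp: T_nonneg D.simps intro!: fps_nonneg_mult fps_nonneg_compose \<Phi>_minus_nonneg)

lemma A_nonneg: "0 \<preceq> A i"
  unfolding A_def by (intro fps_nonneg_mult fps_nonneg_compose deriv_\<Phi>_nonneg D_nonneg fps_nonneg_X)

text \<open>Lagrange inversion, by induction on \<open>n\<close>: removing one letter from the word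
  on the right matches the expansion of one factor \<open>T = fps_X * (\<Phi> oo T)\<close> on the
  left. It translates all products with \<open>C\<close> into weights of words.\<close>

lemma T_power_C: "(T ^ j * C) $ n = (fps_X ^ j * \<Phi> ^ n) $ n"
proof (induction n arbitrary: j)
  case 0
  then show ?case by (cases j) (auto simp: C_def)
next
  case (Suc m)
  show ?case
  proof (cases j)
    case 0
    then show ?thesis by (simp add: C_def)
  next
    case (Suc i)
    have "(fps_X ^ j * \<Phi> ^ Suc m) = fps_X * (\<Phi> * (fps_X ^ i * \<Phi> ^ m))"
      by (simp add: Suc algebra_simps)
    then have "(fps_X ^ j * \<Phi> ^ Suc m) $ Suc m = (\<Phi> * (fps_X ^ i * \<Phi> ^ m)) $ m"
      by (simp only: fps_X_mult_nth nat.distinct if_False diff_Suc_1)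
    also have "\<dots> = ((\<Phi> oo fps_X) * (fps_X ^ i * \<Phi> ^ m)) $ m"
      by simp
    also have "\<dots> = (\<Sum>k\<le>m. \<Phi> $ k * (fps_X ^ k * (fps_X ^ i * \<Phi> ^ m)) $ m)"
      by (subst fps_compose_mult_nth[of _ _ m]) auto
    also have "\<dots> = (\<Sum>k\<le>m. \<Phi> $ k * (T ^ k * (T ^ i * C)) $ m)"
      using Suc.IH[of "_ + i"] by (simp add: power_add mult.assoc)
    also have "\<dots> = ((\<Phi> oo T) * (T ^ i * C)) $ m"
      by (subst fps_compose_mult_nth[of _ _ m]) auto
    also have "\<dots> = (fps_X * ((\<Phi> oo T) * (T ^ i * C))) $ Suc m"
      by simp
    also have "fps_X * ((\<Phi> oo T) * (T ^ i * C)) = T ^ j * C"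
      by (simp add: Suc T_\<Phi>[symmetric] flip: mult.assoc)
    finally show ?thesis ..
  qed
qed

text \<open>In a word of length and sum \<open>n\<close> the mean letter is 1, so differentiating
  \<open>\<Phi> ^ n\<close> reproduces the coefficient of \<open>C\<close>; \<open>T_power_C\<close>
  then turns the differentiated letter into \<open>fps_deriv \<Phi> oo T\<close>.\<close>

lemma C_eq: "C = 1 + A 0 * C"
proof (rule fps_ext)
  fix n
  show "C $ n = (1 + A 0 * C) $ n"
  proof (cases n)
    case 0
    then show ?thesis by (simp add: C_def A_def)
  next
    case (Suc m)
    have "real (Suc m) * (\<Phi> ^ Suc m) $ Suc m = fps_deriv (\<Phi> ^ Suc m) $ m"
      by (simp only: fps_deriv_nth Suc_eq_plus1)
    also have "\<dots> = real (Suc m) * (fps_deriv \<Phi> * \<Phi> ^ m) $ m"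
      unfolding fps_deriv_power by (simp only: mult.assoc fps_mult_left_const_nth diff_Suc_1)
    finally have "C $ n = (fps_deriv \<Phi> * \<Phi> ^ m) $ m"
      using Suc by (simp add: C_def)
    also have "\<dots> = ((fps_deriv \<Phi> oo fps_X) * \<Phi> ^ m) $ m"
      by simp
    also have "\<dots> = (\<Sum>k\<le>m. fps_deriv \<Phi> $ k * (fps_X ^ k * \<Phi> ^ m) $ m)"
      by (subst fps_compose_mult_nth[of _ _ m]) auto
    also have "\<dots> = ((fps_deriv \<Phi> oo T) * C) $ m"
      by (subst fps_compose_mult_nth[of _ _ m]) (auto simp: T_power_C)
    also have "\<dots> = (A 0 * C) $ Suc m"
      by (simp add: A_def mult.assoc)
    finally show ?thesis using Suc by simp
  qed
qed

lemma C_0 [simp]: "C $ 0 = 1"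
  by (simp add: C_def)

text \<open>Differentiating the equation of \<open>T\<close> gives
  \<open>(1 - A 0) * (fps_X * fps_deriv T) = T\<close>, and \<open>C\<close> is the inverse of
  \<open>1 - A 0\<close>.\<close>

lemma T_C: "T * C = fps_X * fps_deriv T"
proof -
  have "fps_deriv T = (\<Phi> oo T) + fps_X * ((fps_deriv \<Phi> oo T) * fps_deriv T)"
    by (subst (1) T_\<Phi>) (simp add: fps_compose_deriv)
  then have "fps_X * fps_deriv T = fps_X * (\<Phi> oo T) + A 0 * (fps_X * fps_deriv T)"
    unfolding A_def D.simps(1) by (rule trans[OF arg_cong[of _ _ "(*) fps_X"]]) (simp only: distrib_left ac_simps)
  then have "(1 - A 0) * (fps_X * fps_deriv T) = T"
    unfolding T_\<Phi>[symmetric] by (simp only: left_diff_distrib mult_1) (simp only: diff_eq_eq)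
  then have "T * C = ((1 - A 0) * C) * (fps_X * fps_deriv T)"
    by (simp add: ac_simps)
  also have "(1 - A 0) * C = 1"
    using C_eq by (simp add: algebra_simps)
  finally show ?thesis by simp
qed

lemma T_C_nth: "(T * C) $ n = real n * T $ n"
  unfolding T_C by (cases n) auto

lemma T_C_nth': "0 < n \<Longrightarrow> (T * C) $ n = (\<Phi> ^ n) $ (n - 1)"
  using T_power_C[of 1 n] by (cases n) auto

lemma D_Suc_le: "D (Suc k) \<preceq> D k"
proof (induction k)
  case 0
  have "D 1 \<preceq> fps_X * (\<Phi> oo T)"
    using w_0 T_nonneg unfolding One_nat_def D.simps
    by (intro fps_le_mult_left fps_nonneg_X fps_compose_mono_left) (auto simp: fps_le_def)
  then show ?case using T_\<Phi> by simp
next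
  case (Suc k)
  have "D (Suc (Suc k)) = fps_X * ((\<Phi> - fps_const (w 0)) oo D (Suc k))"
    by (rule D.simps)
  also have "\<dots> \<preceq> fps_X * ((\<Phi> - fps_const (w 0)) oo D k)"
    by (intro fps_le_mult_left fps_nonneg_X fps_le_compose \<Phi>_minus_nonneg Suc.IH D_nonneg)
  also have "\<dots> = D (Suc k)"
    by (rule D.simps [symmetric])
  finally show ?case .
qed

lemma D_antimono: "i \<le> j \<Longrightarrow> D j \<preceq> D i"
  by (induction rule: dec_induct) (auto intro: fps_le_trans D_Suc_le)

lemma A_antimono: "i \<le> j \<Longrightarrow> A j \<preceq> A i"
  unfolding A_def
  by (intro fps_le_mult_left fps_nonneg_X fps_le_compose deriv_\<Phi>_nonneg D_nonneg D_antimono)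

lemma D_1: "D 1 = T - fps_const (w 0) * fps_X"
proof -
  have "D 1 = fps_X * (\<Phi> oo T) - fps_const (w 0) * fps_X"
    by (simp add: fps_compose_sub_distrib D.simps algebra_simps)
  then show ?thesis using T_\<Phi> by simp
qed

lemma A_0_C_le: "A 0 * C \<preceq> C"
  by (subst (2) C_eq) (simp add: fps_le_def)

text \<open>In a word of length \<open>n\<close> and sum \<open>n - 1\<close> the mean letter is
  less than 1, so a letter is 0 with probability at least \<open>1 / n\<close>; in other words,
  every tree has a leaf. The bound serves for the finitely many small \<open>n\<close> in
  \<open>leaf_constant\<close>.\<close>

lemma leaf_weight_ge:
  assumes "0 < n"
  shows "(T * C) $ n \<le> real n * (w 0 * (fps_X * C) $ n)"
proof -
  define s where "s = n - 1"
  define z where "z b = w b * (\<Phi> ^ s) $ (s - b)" for b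
  have z: "0 \<le> z b" for b
    using \<Phi>_pow_nonneg[of s] by (simp add: z_def fps_le_def)
  have n: "n = Suc s" using assms by (simp add: s_def)
  have 1: "(T * C) $ n = (\<Sum>b\<le>s. z b)"
    using T_C_nth'[OF assms] by (simp add: n fps_mult_nth z_def atLeast0AtMost)
  have 2: "real s * (T * C) $ n = real n * (\<Sum>b\<le>s. real b * z b)"
    using T_C_nth'[OF assms] fps_power_mean_identity[of s \<Phi> n]
    by (simp add: n z_def mult.assoc)
  have "(\<Sum>b\<le>s. z b) \<le> (\<Sum>b\<le>s. real b * z b + (if b = 0 then z b else 0))"
    using z by (intro sum_mono) (use mult_right_mono[OF _ z, of 1 "real _"] in auto)
  also have "\<dots> = (\<Sum>b\<le>s. real b * z b) + z 0"
    by (simp add: sum.distrib)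
  finally have "(T * C) $ n \<le> (\<Sum>b\<le>s. real b * z b) + z 0"
    using 1 by simp
  then have "real n * (T * C) $ n \<le> real n * ((\<Sum>b\<le>s. real b * z b) + z 0)"
    by (intro mult_left_mono) auto
  then have "real n * (T * C) $ n \<le> real s * (T * C) $ n + real n * z 0"
    using 2 by (simp add: algebra_simps)
  moreover have "z 0 = w 0 * (fps_X * C) $ n"
    by (simp add: n z_def C_def)
  ultimately show ?thesis by (simp add: n algebra_simps)
qed

text \<open>An ancestor with at least \<open>K\<close> children besides the one on the path, none of
  them a leaf; \<open>small K\<close> is the rest of \<open>A 1\<close>.\<close>

definition big :: "nat \<Rightarrow> real fps" where
  "big K = fps_X * (Abs_fps (\<lambda>j. if K \<le> j then fps_deriv \<Phi> $ j else 0) oo D 1)"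

definition small :: "nat \<Rightarrow> real fps" where
  "small K = fps_X * (Abs_fps (\<lambda>j. if j < K then fps_deriv \<Phi> $ j else 0) oo D 1)"

lemma big_nonneg: "0 \<preceq> big K"
  unfolding big_def
  by (intro fps_nonneg_mult fps_nonneg_X fps_nonneg_compose D_nonneg) (auto simp: fps_le_def)

lemma small_nonneg: "0 \<preceq> small K"
  unfolding small_def
  by (intro fps_nonneg_mult fps_nonneg_X fps_nonneg_compose D_nonneg) (auto simp: fps_le_def)

lemma A_1_split: "A 1 = small K + big K"
proof -
  have "fps_deriv \<Phi> = Abs_fps (\<lambda>j. if j < K then fps_deriv \<Phi> $ j else 0) +
      Abs_fps (\<lambda>j. if K \<le> j then fps_deriv \<Phi> $ j else 0)"
    by (rule fps_ext) simp
  from arg_cong[OF this, of "\<lambda>f. fps_X * (f oo D 1)"] show ?thesis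
    unfolding A_def small_def big_def by (simp only: fps_compose_add_distrib distrib_left)
qed

text \<open>Planting a tree at the open child yields an ordinary tree whose root has degree at most
  \<open>K\<close>, and each tree arises from at most \<open>K\<close> choices of that
  child.\<close>

lemma T_small_le: "T * small K \<preceq> fps_const (real K) * T"
proof -
  define a where "a = Abs_fps (\<lambda>j. if j < K then fps_deriv \<Phi> $ j else 0)"
  have a: "0 \<preceq> a" by (auto simp: a_def fps_le_def)
  have "T * small K = fps_X * ((a oo D 1) * T)"
    by (simp add: small_def a_def ac_simps)
  also have "\<dots> \<preceq> fps_X * ((a oo T) * T)"
    using D_antimono[of 0 1]
    by (intro fps_le_mult_left fps_le_mult_right fps_nonneg_X T_nonneg fps_le_compose a D_nonneg) auto
  also have "(a oo T) * T = (a * fps_X) oo T"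
    by (simp add: fps_compose_mult_distrib)
  also have "fps_X * ((a * fps_X) oo T) \<preceq> fps_X * ((fps_const (real K) * \<Phi>) oo T)"
  proof (intro fps_le_mult_left fps_nonneg_X fps_compose_mono_left T_nonneg)
    show "a * fps_X \<preceq> fps_const (real K) * \<Phi>"
      unfolding fps_le_def
    proof
      fix n show "(a * fps_X) $ n \<le> (fps_const (real K) * \<Phi>) $ n"
        by (cases n) (auto simp: a_def intro!: mult_right_mono)
    qed
  qed
  also have "\<dots> = fps_const (real K) * (fps_X * (\<Phi> oo T))"
    by (simp add: fps_compose_mult_distrib ac_simps)
  finally show ?thesis using T_\<Phi> by simp
qed

end

text \<open>The quotient of the two sides is the probability that a uniform vertex is a leaf. As
  \<open>\<epsilon>\<close> works for every \<open>n\<close>, its consequences are coefficientwise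
  inequalities, which can be multiplied by nonnegative series.\<close>

locale weighted_trees_leaf = weighted_trees +
  fixes \<epsilon> :: real
  assumes eps: "0 < \<epsilon>" "\<epsilon> \<le> 1"
    and leaf: "\<And>n. \<epsilon> * (T * C) $ n \<le> w 0 * (fps_X * C) $ n"
begin

lemma D_1_C_le: "D 1 * C \<preceq> fps_const (1 - \<epsilon>) * (T * C)"
  unfolding fps_le_def
proof
  fix n
  have "(D 1 * C) $ n = (T * C) $ n - w 0 * (fps_X * C) $ n"
    unfolding D_1 by (simp only: left_diff_distrib fps_sub_nth mult.assoc fps_mult_left_const_nth)
  moreover have "(fps_const (1 - \<epsilon>) * (T * C)) $ n = (T * C) $ n - \<epsilon> * (T * C) $ n"
    by (simp only: fps_mult_left_const_nth left_diff_distrib mult_1)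
  ultimately show "(D 1 * C) $ n \<le> (fps_const (1 - \<epsilon>) * (T * C)) $ n"
    using leaf[of n] by linarith
qed

text \<open>Following the leftmost children, each further vertex is a leaf with probability at least \<open>\<epsilon>\<close>.\<close>

lemma D_C_le: "D k * C \<preceq> fps_const ((1 - \<epsilon>) ^ k) * (T * C)"
proof (induction k)
  case (Suc k)
  \<comment> \<open>Factoring one \<open>fps_X\<close> out of
    \<open>\<Phi> - fps_const (w 0)\<close> singles out one child of the root; it keeps the
    restriction, while the other children are relaxed to \<open>T\<close>.\<close>
  define a where "a = fps_shift 1 \<Phi>"
  have a: "\<Phi> - fps_const (w 0) = a * fps_X"
    by (rule fps_ext) (simp add: a_def)
  have DS: "D (Suc k) = fps_X * ((a oo D k) * D k)" for k
    by (simp add: a fps_compose_mult_distrib D.simps)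
  have ann: "0 \<preceq> a" by (simp add: a_def fps_le_def)
  have nn: "0 \<preceq> fps_const ((1 - \<epsilon>) ^ k) * (T * C)"
    using eps by (intro fps_nonneg_mult fps_nonneg_const T_nonneg C_nonneg) auto
  have "D (Suc k) * C = fps_X * ((a oo D k) * (D k * C))"
    unfolding DS by (simp only: mult.assoc)
  also have "\<dots> \<preceq> fps_X * ((a oo T) * (fps_const ((1 - \<epsilon>) ^ k) * (T * C)))"
    using D_antimono[of 0 k]
    by (intro fps_le_mult_left fps_nonneg_X fps_le_mult[OF fps_le_compose[OF ann _ D_nonneg] Suc.IH]
        fps_nonneg_compose ann D_nonneg fps_nonneg_mult C_nonneg) auto
  also have "\<dots> = fps_const ((1 - \<epsilon>) ^ k) * (D 1 * C)"
    using DS[of 0] by (simp add: ac_simps)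
  also have "\<dots> \<preceq> fps_const ((1 - \<epsilon>) ^ k) * (fps_const (1 - \<epsilon>) * (T * C))"
    using eps by (intro fps_le_mult_left D_1_C_le fps_nonneg_const) auto
  also have "\<dots> = fps_const ((1 - \<epsilon>) ^ Suc k) * (T * C)"
    by (simp add: ac_simps flip: fps_const_mult)
  finally show ?case .
qed simp

text \<open>
  A vertex with \<open>j\<close> non-leaf children besides a given one is compared with a vertex for which
  exactly one of these \<open>j\<close> children is a leaf: there are \<open>j\<close> choices for it.
\<close>

lemma D_1_power_C_le:
  assumes "0 < j"
  shows "D 1 ^ j * C \<preceq> fps_const (1 / (\<epsilon> * real j)) * (T ^ j * C)"
proof -
  have TC: "T * C \<preceq> fps_const (1 / \<epsilon>) * (fps_const (w 0) * fps_X * C)"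
    unfolding fps_le_def mult.assoc fps_mult_left_const_nth
  proof
    have "a \<le> 1 / \<epsilon> * b" if "\<epsilon> * a \<le> b" for a b
      using that eps by (simp add: field_simps)
    then show "(T * C) $ n \<le> 1 / \<epsilon> * (w 0 * (fps_X * C) $ n)" for n
      using leaf by blast
  qed
  have "D 1 ^ j * C = D 1 ^ (j - 1) * (D 1 * C)"
    using assms by (cases j) (auto simp: ac_simps)
  \<comment> \<open>One child is released from being a non-leaf and then turned into a leaf at the
    price \<open>1 / \<epsilon>\<close>.\<close>
  also have "\<dots> \<preceq> D 1 ^ (j - 1) * (T * C)"
    using D_antimono[of 0 1] by (intro fps_le_mult_left fps_nonneg_power D_nonneg fps_le_mult_right C_nonneg) auto
  also have "\<dots> \<preceq> D 1 ^ (j - 1) * (fps_const (1 / \<epsilon>) * (fps_const (w 0) * fps_X * C))"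
    by (intro fps_le_mult_left fps_nonneg_power D_nonneg TC)
  also have "\<dots> = fps_const (1 / (\<epsilon> * real j)) *
      (of_nat j * ((fps_const (w 0) * fps_X) * D 1 ^ (j - 1)) * C)"
  proof -
    have "fps_const (1 / \<epsilon>) = fps_const (1 / (\<epsilon> * real j)) * of_nat j"
      using assms by (simp flip: fps_of_nat)
    then show ?thesis by (simp only: ac_simps)
  qed
  also have "\<dots> \<preceq> fps_const (1 / (\<epsilon> * real j)) * ((D 1 + fps_const (w 0) * fps_X) ^ j * C)"
    using eps w_0
    by (intro fps_le_mult_left fps_le_mult_right fps_power_add_ge fps_nonneg_const C_nonneg
        D_nonneg fps_nonneg_mult fps_nonneg_X) auto
  also have "D 1 + fps_const (w 0) * fps_X = T"
    unfolding D_1 by simp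
  finally show ?thesis .
qed

text \<open>The gain \<open>1 / (\<epsilon> * j)\<close> of \<open>D_1_power_C_le\<close> is at most
  \<open>1 / (\<epsilon> * K)\<close> for all \<open>j \<ge> K\<close>; summing over
  \<open>j\<close> leaves \<open>A 0 * C\<close>, which is at most \<open>C\<close>.\<close>

lemma big_C_le:
  assumes "0 < K"
  shows "big K * C \<preceq> fps_const (1 / (\<epsilon> * real K)) * C"
proof -
  have "big K * C = fps_X * ((Abs_fps (\<lambda>j. if K \<le> j then fps_deriv \<Phi> $ j else 0) oo D 1) * C)"
    by (simp add: big_def mult.assoc)
  also have "\<dots> \<preceq> fps_X * ((fps_deriv \<Phi> oo T) * (fps_const (1 / (\<epsilon> * real K)) * C))"
  proof (intro fps_le_mult_left fps_nonneg_X fps_le_compose_mult)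
    fix j n
    show "Abs_fps (\<lambda>j. if K \<le> j then fps_deriv \<Phi> $ j else 0) $ j * (D 1 ^ j * C) $ n \<le>
        fps_deriv \<Phi> $ j * (T ^ j * (fps_const (1 / (\<epsilon> * real K)) * C)) $ n"
    proof (cases "K \<le> j")
      case True
      have nn: "0 \<le> (T ^ j * C) $ n"
        by (intro fps_nonneg_nth fps_nonneg_mult fps_nonneg_power T_nonneg C_nonneg)
      have "(D 1 ^ j * C) $ n \<le> 1 / (\<epsilon> * real j) * (T ^ j * C) $ n"
        using fps_leD[OF D_1_power_C_le[of j], of n] True assms by simp
      also have "\<dots> \<le> 1 / (\<epsilon> * real K) * (T ^ j * C) $ n"
        using True assms eps nn by (intro mult_right_mono divide_left_mono mult_left_mono) auto
      also have "\<dots> = (T ^ j * (fps_const (1 / (\<epsilon> * real K)) * C)) $ n"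
        by (subst mult.left_commute) simp
      finally show ?thesis
        using True by (auto intro!: mult_left_mono)
    next
      case False
      have "0 \<le> (T ^ j * (fps_const (1 / (\<epsilon> * real K)) * C)) $ n"
        using eps by (intro fps_nonneg_nth fps_nonneg_mult fps_nonneg_power T_nonneg C_nonneg fps_nonneg_const) auto
      then show ?thesis using False by simp
    qed
  qed auto
  also have "\<dots> = fps_const (1 / (\<epsilon> * real K)) * (A 0 * C)"
    by (simp add: A_def ac_simps)
  also have "\<dots> \<preceq> fps_const (1 / (\<epsilon> * real K)) * C"
    using eps by (intro fps_le_mult_left fps_nonneg_const A_0_C_le) auto
  finally show ?thesis .
qed

end

lemma fps_mult_nth_ge:
  assumes "0 \<preceq> F" "0 \<preceq> G"
  shows "F $ i * G $ j \<le> (F * G) $ (i + j)"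
proof -
  have "(\<Sum>k\<in>{i}. F $ k * G $ (i + j - k)) \<le> (\<Sum>k=0..i+j. F $ k * G $ (i + j - k))"
    using assms by (intro sum_mono2) (auto simp: fps_le_def)
  then show ?thesis by (simp add: fps_mult_nth)
qed

lemma fps_compose_ge_term:
  assumes "0 \<preceq> a" "0 \<preceq> F" "0 \<preceq> G" "F $ 0 = 0"
  shows "fps_const (a $ j) * (F ^ j * G) \<preceq> (a oo F) * G"
  unfolding fps_le_def fps_mult_left_const_nth
proof
  fix n
  have "((a oo F) * G) $ n = (\<Sum>k\<le>max n j. a $ k * (F ^ k * G) $ n)"
    using assms by (intro fps_compose_mult_nth) auto
  also have "\<dots> \<ge> (\<Sum>k\<in>{j}. a $ k * (F ^ k * G) $ n)"
    using assms by (intro sum_mono2 mult_nonneg_nonneg fps_nonneg_nth fps_nonneg_mult fps_nonneg_power) auto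
  finally show "a $ j * (F ^ j * G) $ n \<le> ((a oo F) * G) $ n" by simp
qed

lemma fps_ev_real:
  assumes "0 \<preceq> F" "0 \<le> r" "fps_ev F (ennreal r) \<noteq> top"
  shows "summable (\<lambda>n. F $ n * r ^ n)" "fps_ev F (ennreal r) = ennreal (\<Sum>n. F $ n * r ^ n)"
proof -
  have eq: "fps_ev F (ennreal r) = (\<Sum>n. ennreal (F $ n * r ^ n))"
    using assms by (simp add: fps_ev_def fps_le_def ennreal_mult ennreal_power)
  then show s: "summable (\<lambda>n. F $ n * r ^ n)"
    using assms by (intro summable_suminf_not_top) (auto simp: fps_le_def)
  show "fps_ev F (ennreal r) = ennreal (\<Sum>n. F $ n * r ^ n)"
    unfolding eq using assms s by (intro suminf_ennreal2) (auto simp: fps_le_def)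
qed

lemma fps_ev_sums:
  assumes "0 \<preceq> F" "0 \<le> r" "(\<lambda>n. F $ n * r ^ n) sums g"
  shows "fps_ev F (ennreal r) = ennreal g"
proof -
  have "fps_ev F (ennreal r) = (\<Sum>n. ennreal (F $ n * r ^ n))"
    using assms by (simp add: fps_ev_def fps_le_def ennreal_mult ennreal_power)
  also have "\<dots> = ennreal (\<Sum>n. F $ n * r ^ n)"
    using assms by (intro suminf_ennreal2) (auto simp: fps_le_def sums_iff)
  finally show ?thesis using assms by (simp add: sums_iff)
qed

lemma fps_power_nth_upper:
  assumes "0 \<preceq> F" "0 \<le> r" "(\<lambda>n. F $ n * r ^ n) sums g"
  shows "(F ^ n) $ s * r ^ s \<le> g ^ n"
proof -
  have g: "0 \<le> g"
    using assms by (auto simp: sums_iff fps_le_def intro!: suminf_nonneg)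
  have "ennreal ((F ^ n) $ s * r ^ s) \<le> fps_ev (F ^ n) (ennreal r)"
    using fps_ev_ge_nth[of "F ^ n" s "ennreal r"] assms(2) fps_nonneg_power[OF assms(1), of n]
    by (simp add: ennreal_mult ennreal_power fps_le_def)
  also have "\<dots> = ennreal (g ^ n)"
    using assms g by (simp add: fps_ev_power fps_ev_sums ennreal_power)
  finally show ?thesis using g by (simp add: ennreal_le_iff)
qed

text \<open>
  Jensen's inequality for the number of letters \<open>b\<close> in a random word of length \<open>n\<close> and sum \<open>s\<close>;
  \<open>a\<close> is its expectation.
\<close>

lemma fps_power_tilt:
  assumes F: "0 \<preceq> F" and n: "0 < n" and pos: "0 < (F ^ n) $ s"
    and a: "a = real n * F $ b * (fps_X ^ b * F ^ (n - 1)) $ s / (F ^ n) $ s"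
  shows "exp (\<theta> * a) * (F ^ n) $ s \<le> ((F + fps_const ((exp \<theta> - 1) * F $ b) * fps_X ^ b) ^ n) $ s"
proof -
  define x where "x = fps_const (F $ b) * fps_X ^ b"
  define \<Psi> where "\<Psi> = F - x"
  have x_nth: "x $ k = (if k = b then F $ b else 0)" for k
    by (simp add: x_def)
  have nn: "0 \<preceq> \<Psi>" "0 \<preceq> x"
    using F by (auto simp: \<Psi>_def fps_le_def x_nth)
  \<comment> \<open>Total weight of the words with exactly \<open>j\<close> letters
    \<open>b\<close>.\<close>
  define g where "g j = real (n choose j) * (x ^ j * \<Psi> ^ (n - j)) $ s" for j
  have g: "0 \<le> g j" for j
    using nn by (auto simp: g_def intro!: mult_nonneg_nonneg fps_nonneg_nth fps_nonneg_mult fps_nonneg_power)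
  have nth_of_nat: "(of_nat m * H) $ s = real m * H $ s" for m and H :: "real fps"
    by (metis fps_of_nat fps_mult_left_const_nth)
  have expand: "((fps_const y * x + \<Psi>) ^ n) $ s = (\<Sum>j\<le>n. y ^ j * g j)" for y
  proof -
    have "((fps_const y * x + \<Psi>) ^ n) $ s =
        (\<Sum>j\<le>n. (of_nat (n choose j) * (fps_const y * x) ^ j * \<Psi> ^ (n - j)) $ s)"
      unfolding binomial_ring by (simp only: fps_sum_nth)
    also have "\<dots> = (\<Sum>j\<le>n. y ^ j * g j)"
    proof (intro sum.cong refl)
      fix j
      have "of_nat (n choose j) * (fps_const y * x) ^ j * \<Psi> ^ (n - j) =
          fps_const (y ^ j) * (of_nat (n choose j) * (x ^ j * \<Psi> ^ (n - j)))"
        by (simp add: power_mult_distrib fps_const_power ac_simps)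
      then show "(of_nat (n choose j) * (fps_const y * x) ^ j * \<Psi> ^ (n - j)) $ s = y ^ j * g j"
        by (simp only: fps_mult_left_const_nth nth_of_nat g_def)
    qed
    finally show ?thesis .
  qed
  have F_eq: "F = fps_const 1 * x + \<Psi>"
    by (simp add: \<Psi>_def)
  have total: "(F ^ n) $ s = (\<Sum>j\<le>n. g j)"
    using expand[of 1] by (simp add: \<Psi>_def)
  \<comment> \<open>The factor \<open>j\<close> is absorbed into the binomial coefficient, which
    marks one of the letters \<open>b\<close>.\<close>
  have mean: "(\<Sum>j\<le>n. real j * g j) = a * (F ^ n) $ s"
  proof -
    obtain m where m: "n = Suc m" using n by (cases n) auto
    have "(\<Sum>j\<le>n. real j * g j) = (\<Sum>i\<le>m. real (Suc i) * g (Suc i))"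
      unfolding m by (subst sum.atMost_Suc_shift) simp
    also have "\<dots> = (\<Sum>i\<le>m. real (Suc m) * (of_nat (m choose i) * (x * (x ^ i * \<Psi> ^ (m - i)))) $ s)"
    proof (intro sum.cong refl)
      fix i
      have "real (Suc i) * real (Suc m choose Suc i) = real (Suc m) * real (m choose i)"
        by (metis Suc_times_binomial of_nat_mult)
      then have "real (Suc i) * (real (Suc m choose Suc i) * H) = real (Suc m) * (real (m choose i) * H)" for H
        by (metis mult.assoc)
      then show "real (Suc i) * g (Suc i) =
          real (Suc m) * (of_nat (m choose i) * (x * (x ^ i * \<Psi> ^ (m - i)))) $ s"
        unfolding g_def nth_of_nat m by (simp only: power_Suc mult.assoc diff_Suc_Suc)
    qed
    also have "\<dots> = real (Suc m) * (x * (x + \<Psi>) ^ m) $ s"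
      unfolding binomial_ring by (simp add: sum_distrib_left fps_sum_nth ac_simps del: of_nat_Suc)
    also have "x + \<Psi> = F" by (simp add: \<Psi>_def)
    also have "(x * F ^ m) $ s = F $ b * (fps_X ^ b * F ^ m) $ s"
      unfolding x_def mult.assoc by (rule fps_mult_left_const_nth)
    finally show ?thesis using pos m by (simp add: a)
  qed
  \<comment> \<open>The tangent of the exponential at the mean \<open>a\<close> is summed: the
    linear part cancels.\<close>
  have "exp (\<theta> * a) * (F ^ n) $ s = (\<Sum>j\<le>n. exp (\<theta> * a) * (1 + \<theta> * (real j - a)) * g j)"
  proof -
    have "(\<Sum>j\<le>n. exp (\<theta> * a) * (1 + \<theta> * (real j - a)) * g j) =
        (\<Sum>j\<le>n. exp (\<theta> * a) * g j + exp (\<theta> * a) * \<theta> * (real j * g j) - exp (\<theta> * a) * \<theta> * a * g j)"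
      by (intro sum.cong refl) (simp add: algebra_simps)
    also have "\<dots> = exp (\<theta> * a) * ((\<Sum>j\<le>n. g j) + \<theta> * ((\<Sum>j\<le>n. real j * g j) - a * (\<Sum>j\<le>n. g j)))"
      unfolding sum_subtractf sum.distrib sum_distrib_left[symmetric] by (simp only: algebra_simps)
    finally have "(\<Sum>j\<le>n. exp (\<theta> * a) * (1 + \<theta> * (real j - a)) * g j) =
        exp (\<theta> * a) * ((\<Sum>j\<le>n. g j) + \<theta> * ((\<Sum>j\<le>n. real j * g j) - a * (\<Sum>j\<le>n. g j)))" .
    then show ?thesis using mean total by simp
  qed
  also have "\<dots> \<le> (\<Sum>j\<le>n. exp \<theta> ^ j * g j)"
  proof (intro sum_mono mult_right_mono g)
    fix j
    have "exp (\<theta> * a) * (1 + \<theta> * (real j - a)) \<le> exp (\<theta> * a) * exp (\<theta> * (real j - a))"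
      by (intro mult_left_mono exp_ge_add_one_self) auto
    also have "\<dots> = exp \<theta> ^ j"
      by (simp add: algebra_simps flip: exp_add exp_of_nat_mult)
    finally show "exp (\<theta> * a) * (1 + \<theta> * (real j - a)) \<le> exp \<theta> ^ j" .
  qed
  also have "\<dots> = ((fps_const (exp \<theta>) * x + \<Psi>) ^ n) $ s"
    by (rule expand[symmetric])
  also have "fps_const (exp \<theta>) * x + \<Psi> = F + fps_const ((exp \<theta> - 1) * F $ b) * fps_X ^ b"
    by (rule fps_ext) (simp add: \<Psi>_def x_nth algebra_simps)
  finally show ?thesis .
qed

section \<open>Ratio limits\<close>

context weighted_trees
begin

text \<open>\<open>Z n c\<close> is the total weight of the words of length \<open>n\<close> and sum \<open>n - c\<close>.\<close>

definition Z :: "nat \<Rightarrow> int \<Rightarrow> real" where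
  "Z n c = (if c \<le> int n then (\<Phi> ^ n) $ nat (int n - c) else 0)"

text \<open>For all other \<open>n\<close> a quotient by \<open>Z n c\<close> is the default value
  0, so these \<open>n\<close> must be left out; this is how periodic weights are handled.\<close>

definition flt :: "int \<Rightarrow> nat filter" where
  "flt c = inf sequentially (principal {n. 0 < Z n c})"

lemma eventually_flt: "eventually P (flt c) \<longleftrightarrow> (\<forall>\<^sub>F n in sequentially. 0 < Z n c \<longrightarrow> P n)"
  by (simp add: flt_def eventually_inf_principal)

lemma eventually_flt_pos: "eventually (\<lambda>n. 0 < Z n c) (flt c)"
  by (simp add: eventually_flt)

lemma eventually_flt_ge: "eventually (\<lambda>n. N \<le> n) (flt c)"
  unfolding eventually_flt by (rule eventually_mono[OF eventually_ge_at_top[of N]]) simp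

lemma Z_nonneg: "0 \<le> Z n c"
  using \<Phi>_pow_nonneg[of n] by (auto simp: Z_def fps_le_def)

lemma Z_0: "Z n 0 = C $ n"
  by (simp add: Z_def C_def)

lemma Z_1: "Z n 1 = (T * C) $ n"
  using T_C_nth'[of n] by (cases "n = 0") (auto simp: Z_def T_C_nth nat_diff_distrib)

text \<open>Appending a word of length \<open>N\<close> and sum \<open>N\<close> does not change the
  defect \<open>c\<close>.\<close>

lemma Z_supermult: "Z n c * C $ N \<le> Z (n + N) c"
proof (cases "c \<le> int n")
  case True
  have "nat (int (n + N) - c) = nat (int n - c) + N"
    using True by simp
  then show ?thesis
    using True fps_mult_nth_ge[OF \<Phi>_pow_nonneg \<Phi>_pow_nonneg, of n "nat (int n - c)" N N]
    by (simp add: Z_def C_def power_add)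
next
  case False
  then show ?thesis using Z_nonneg[of "n + N" c] by (simp add: Z_def[of n])
qed

lemma Z_supermult_power: "Z n c * (C $ N) ^ q \<le> Z (n + q * N) c"
proof (induction q)
  case (Suc q)
  have "Z n c * (C $ N) ^ Suc q = (Z n c * (C $ N) ^ q) * C $ N" by simp
  also have "\<dots> \<le> Z (n + q * N) c * C $ N"
    using Suc C_nonneg by (intro mult_right_mono) (auto simp: fps_le_def)
  also have "\<dots> \<le> Z (n + Suc q * N) c"
    using Z_supermult[of "n + q * N" c N] by (simp add: ac_simps)
  finally show ?case .
qed simp

lemma Z_shift:
  assumes "0 < n" "c \<le> int n"
  shows "(fps_X ^ b * \<Phi> ^ (n - 1)) $ nat (int n - c) = Z (n - 1) (c + int b - 1)"
  using assms by (auto simp: Z_def fps_X_power_mult_nth nat_diff_distrib intro!: arg_cong[of _ _ "fps_nth _"])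

text \<open>One good length \<open>N\<close> suffices: in each residue class modulo \<open>N\<close>
  the least admissible length is prolonged by blocks of length \<open>N\<close>, and there are only
  finitely many classes.\<close>

lemma Z_growth:
  assumes N: "0 < N" "\<rho> ^ N \<le> C $ N" and "0 < \<rho>"
  shows "\<exists>\<kappa>>0. \<forall>n. 0 < Z n c \<longrightarrow> \<kappa> * \<rho> ^ n \<le> Z n c"
proof -
  define R where "R = {r. r < N \<and> (\<exists>n. n mod N = r \<and> 0 < Z n c)}"
  define f where "f r = (LEAST n. n mod N = r \<and> 0 < Z n c)" for r
  have f: "f r mod N = r" "0 < Z (f r) c" if "r \<in> R" for r
  proof -
    have "\<exists>n. n mod N = r \<and> 0 < Z n c" using that by (auto simp: R_def)
    from LeastI_ex[OF this] show "f r mod N = r" "0 < Z (f r) c" by (auto simp: f_def)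
  qed
  \<comment> \<open>The inserted 1 keeps the minimum meaningful when no class is admissible.\<close>
  define \<kappa> where "\<kappa> = Min (insert 1 ((\<lambda>r. Z (f r) c / \<rho> ^ f r) ` R))"
  have fin: "finite R" by (rule finite_subset[of _ "{..<N}"]) (auto simp: R_def)
  have "0 < \<kappa>"
    unfolding \<kappa>_def using fin f assms by (subst Min_gr_iff) auto
  moreover have "\<kappa> * \<rho> ^ n \<le> Z n c" if n: "0 < Z n c" for n
  proof -
    define r where "r = n mod N"
    have r: "r \<in> R" using n N by (auto simp: R_def r_def)
    have le: "f r \<le> n" unfolding f_def using n by (intro Least_le) (auto simp: r_def)
    have "n mod N = f r mod N" using f(1)[OF r] by (simp add: r_def)
    then obtain q where q: "n = f r + q * N"
      using le by (metis mod_eq_dvd_iff_nat dvdE le_add_diff_inverse mult.commute)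
    have "\<kappa> \<le> Z (f r) c / \<rho> ^ f r"
      unfolding \<kappa>_def using fin r by (intro Min_le) auto
    then have "\<kappa> * \<rho> ^ f r \<le> Z (f r) c"
      using assms by (simp add: pos_le_divide_eq)
    then have "\<kappa> * \<rho> ^ f r * (\<rho> ^ N) ^ q \<le> Z (f r) c * (C $ N) ^ q"
      using assms f(2)[OF r] by (intro mult_mono power_mono) auto
    also have "\<dots> \<le> Z n c"
      unfolding q by (rule Z_supermult_power)
    finally show ?thesis by (simp add: q power_add power_mult[symmetric] mult.commute ac_simps)
  qed
  ultimately show ?thesis by blast
qed

lemma T_1: "T $ 1 = w 0"
  by (subst T_\<Phi>) simp

lemma fps_ev_T: "fps_ev T x = x * fps_ev \<Phi> (fps_ev T x)"
  by (subst (1) T_\<Phi>) (simp add: fps_ev_mult fps_nonneg_compose \<Phi>_nonneg T_nonneg fps_ev_compose)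

text \<open>Some degree \<open>k \<ge> 2\<close> has positive weight, so \<open>A 0\<close>
  dominates a positive multiple of \<open>fps_X * T ^ (k - 1)\<close>; an infinite value of
  \<open>T\<close> would make \<open>C\<close> infinite through
  \<open>A 0 * C \<preceq> C\<close>.\<close>

lemma fps_ev_T_finite:
  assumes "fps_ev C x \<noteq> top" "0 < x"
  shows "fps_ev T x \<noteq> top"
proof
  assume top: "fps_ev T x = top"
  obtain k where k: "k \<ge> 2" "0 < w k"
    using w by (auto simp: weight_sequence_def)
  define j where "j = k - 1"
  define d where "d = fps_deriv \<Phi> $ j"
  have d: "0 < d" using k by (simp add: d_def j_def)
  have "fps_X * (fps_const d * (T ^ j * C)) \<preceq> fps_X * ((fps_deriv \<Phi> oo T) * C)"
    unfolding d_def
    by (intro fps_le_mult_left fps_nonneg_X fps_compose_ge_term deriv_\<Phi>_nonneg T_nonneg C_nonneg T_0)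
  also have "\<dots> = A 0 * C" by (simp add: A_def ac_simps)
  also have "\<dots> \<preceq> C" by (rule A_0_C_le)
  finally have "fps_ev (fps_X * (fps_const d * (T ^ j * C))) x \<le> fps_ev C x"
    by (rule fps_ev_mono)
  moreover have "fps_ev (fps_X * (fps_const d * (T ^ j * C))) x =
      x * (fps_ev (fps_const d) x * (fps_ev T x ^ j * fps_ev C x))"
    using d by (simp add: fps_ev_mult fps_nonneg_mult fps_nonneg_const fps_nonneg_power T_nonneg C_nonneg
        fps_ev_power)
  moreover have "fps_ev T x ^ j = top"
    using k by (simp add: top j_def top_power_ennreal)
  moreover have "fps_ev C x \<noteq> 0"
    using fps_ev_ge_nth[of C 0 x] by auto
  moreover have "fps_ev (fps_const d) x \<noteq> 0"
    using fps_ev_ge_nth[of "fps_const d" 0 x] d by auto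
  ultimately show False
    using assms by (auto simp: ennreal_mult_eq_top_iff ennreal_mult_top ennreal_top_mult top_unique split: if_splits)
qed

end

lemma fps_power_nth_cong:
  assumes "\<And>k. k \<le> n \<Longrightarrow> (F :: real fps) $ k = G $ k"
  shows "k \<le> n \<Longrightarrow> (F ^ i) $ k = (G ^ i) $ k"
proof (induction i arbitrary: k)
  case (Suc i)
  then show ?case by (auto simp: fps_mult_nth assms intro!: sum.cong)
qed simp

text \<open>Types I and II at once: the law tilted by \<open>t\<close> has mean at most 1, and if
  the mean is not 1 then \<open>t\<close> cannot be increased. Either way \<open>t\<close> minimises
  \<open>\<Phi>(s) / s\<close>.\<close>

locale tilted_trees = weighted_trees +
  fixes t :: real
  assumes t_pos: "0 < t"
    and summable_w: "summable (\<lambda>k. w k * t ^ k)"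
    and summable_mean: "summable (\<lambda>k. real k * w k * t ^ k)"
    and mean_le: "(\<Sum>k. real k * w k * t ^ k) \<le> (\<Sum>k. w k * t ^ k)"
    and critical: "(\<Sum>k. real k * w k * t ^ k) = (\<Sum>k. w k * t ^ k) \<or>
      (\<forall>s>t. \<not> summable (\<lambda>k. w k * s ^ k))"
begin

definition G :: real where "G = (\<Sum>k. w k * t ^ k)"

definition p :: "nat \<Rightarrow> real" where "p k = w k * t ^ k / G"

lemma G_pos: "0 < G"
  unfolding G_def using w_0 t_pos by (intro suminf_pos2[OF summable_w, of 0]) auto

lemma G_sums: "(\<lambda>k. w k * t ^ k) sums G"
  unfolding G_def by (rule summable_sums[OF summable_w])

lemma p_nonneg: "0 \<le> p k"
  using t_pos G_pos by (auto simp: p_def)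

lemma p_sums: "p sums 1"
  using sums_divide[OF G_sums, of G] G_pos by (simp add: p_def[abs_def])

lemma p_le_1: "p k \<le> 1"
  using sum_le_suminf[OF sums_summable[OF p_sums], of "{k}"] sums_unique[OF p_sums] p_nonneg by auto

lemma p_0: "0 < p 0"
  using w_0 G_pos by (simp add: p_def)

lemma tangent_term_nonneg:
  assumes "0 \<le> s"
  shows "0 \<le> w k * s ^ k - w k * t ^ k - (s / t - 1) * (real k * w k * t ^ k)"
proof -
  have "1 + real k * (s / t - 1) \<le> (1 + (s / t - 1)) ^ k"
    using assms t_pos by (intro Bernoulli_inequality) auto
  then have "w k * t ^ k * (1 + real k * (s / t - 1)) \<le> w k * t ^ k * (s / t) ^ k"
    using t_pos by (intro mult_left_mono) auto
  then show ?thesis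
    using t_pos by (simp add: power_divide algebra_simps)
qed

lemma tangent_sums:
  assumes "summable (\<lambda>k. w k * s ^ k)"
  shows "(\<lambda>k. w k * s ^ k - w k * t ^ k - (s / t - 1) * (real k * w k * t ^ k)) sums
    ((\<Sum>k. w k * s ^ k) - G - (s / t - 1) * (\<Sum>k. real k * w k * t ^ k))"
  using assms by (intro sums_diff sums_mult summable_sums summable_mean G_sums)

text \<open>With \<open>m\<close> the mean of the tilted law, this says
  \<open>(s / t - 1) * (1 - m) \<le> 0\<close>, and \<open>critical\<close> ensures
  \<open>s \<le> t\<close> or \<open>m = 1\<close>.\<close>

lemma tangent_at_most:
  assumes "summable (\<lambda>k. w k * s ^ k)" "0 < s"
  shows "G * (s / t) \<le> G + (s / t - 1) * (\<Sum>k. real k * w k * t ^ k)"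
proof -
  have "s \<le> t \<or> (\<Sum>k. real k * w k * t ^ k) = G"
    using critical assms unfolding G_def by force
  then show ?thesis
  proof
    assume "s \<le> t"
    then have "(s / t - 1) * G \<le> (s / t - 1) * (\<Sum>k. real k * w k * t ^ k)"
      using mean_le t_pos unfolding G_def[symmetric] by (intro mult_left_mono_neg) auto
    then show ?thesis by (simp add: algebra_simps)
  next
    assume eq: "(\<Sum>k. real k * w k * t ^ k) = G"
    show ?thesis unfolding eq by (simp add: algebra_simps)
  qed
qed

lemma gen_fun_ratio_ge:
  assumes "summable (\<lambda>k. w k * s ^ k)" "0 < s"
  shows "G * s \<le> t * (\<Sum>k. w k * s ^ k)"
proof -
  have "0 \<le> (\<Sum>k. w k * s ^ k) - G - (s / t - 1) * (\<Sum>k. real k * w k * t ^ k)"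
    unfolding sums_unique[OF tangent_sums[OF assms(1)]]
    using assms(2) by (intro suminf_nonneg[OF sums_summable[OF tangent_sums[OF assms(1)]]] tangent_term_nonneg) simp
  then have "G * (s / t) \<le> (\<Sum>k. w k * s ^ k)"
    using tangent_at_most[OF assms] by linarith
  then show ?thesis using t_pos by (simp add: field_simps)
qed

text \<open>A single term of degree \<open>k \<ge> 2\<close> makes the inequality strict, as
  Bernoulli's inequality is strict there for \<open>s < t\<close>.\<close>

lemma gen_fun_ratio_gt:
  assumes "summable (\<lambda>k. w k * s ^ k)" "0 < s" "s < t"
  shows "G * s < t * (\<Sum>k. w k * s ^ k)"
proof -
  obtain k where k: "k \<ge> 2" "0 < w k"
    using w by (auto simp: weight_sequence_def)
  have lt: "1 + real k * (s / t - 1) < (s / t) ^ k"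
  proof -
    obtain j where j: "k = Suc (Suc j)" using k by (metis add_2_eq_Suc le_Suc_ex)
    define y where "y = s / t"
    have y: "0 < y" "y < 1" using assms t_pos by (auto simp: y_def)
    \<comment> \<open>Bernoulli for exponent \<open>k - 1\<close>, then multiplied by
      \<open>y\<close>: the surplus is a positive multiple of \<open>(y - 1) ^ 2\<close>.\<close>
    have "(1 + (1 + real j) * (y - 1)) \<le> (1 + (y - 1)) ^ Suc j"
      using Bernoulli_inequality[of "y - 1" "Suc j"] y by simp
    then have "y * (1 + (1 + real j) * (y - 1)) \<le> y * y ^ Suc j"
      using y by (intro mult_left_mono) auto
    moreover have "y * (1 + (1 + real j) * (y - 1)) - (1 + real k * (y - 1)) = (1 + real j) * (y - 1) ^ 2"
      by (simp add: j power2_eq_square algebra_simps)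
    moreover have "0 < (1 + real j) * (y - 1) ^ 2"
      using y by (intro mult_pos_pos) auto
    ultimately show ?thesis by (simp add: j y_def)
  qed
  have "w k * t ^ k * (1 + real k * (s / t - 1)) < w k * t ^ k * (s / t) ^ k"
    using t_pos k lt by (intro mult_strict_left_mono) auto
  then have term_pos: "0 < w k * s ^ k - w k * t ^ k - (s / t - 1) * (real k * w k * t ^ k)"
    using t_pos by (simp add: power_divide algebra_simps)
  have "0 < (\<Sum>k. w k * s ^ k) - G - (s / t - 1) * (\<Sum>k. real k * w k * t ^ k)"
    unfolding sums_unique[OF tangent_sums[OF assms(1)]]
    by (rule suminf_pos2[OF sums_summable[OF tangent_sums[OF assms(1)]] tangent_term_nonneg term_pos])
       (rule less_imp_le[OF assms(2)])
  then have "G * (s / t) < (\<Sum>k. w k * s ^ k)"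
    using tangent_at_most[OF assms(1,2)] by linarith
  then show ?thesis using t_pos by (simp add: field_simps)
qed

lemma fps_ev_\<Phi>_t: "fps_ev \<Phi> (ennreal t) = ennreal G"
  using t_pos G_sums \<Phi>_nonneg by (intro fps_ev_sums) auto

lemma fps_ev_\<Phi>_real:
  assumes "0 \<le> s" "fps_ev \<Phi> (ennreal s) \<noteq> top"
  shows "summable (\<lambda>k. w k * s ^ k)" "fps_ev \<Phi> (ennreal s) = ennreal (\<Sum>k. w k * s ^ k)"
  using fps_ev_real[OF \<Phi>_nonneg assms] by auto

text \<open>Otherwise \<open>C\<close> would converge at some \<open>x > t / G\<close>, hence so
  would \<open>T\<close>, and its value \<open>s\<close> would satisfy
  \<open>s = x * \<Phi>(s)\<close>, that is \<open>\<Phi>(s) / s = 1 / x < G / t\<close>, against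
  the minimality of \<open>G / t\<close>.\<close>

lemma C_growth:
  assumes "0 < \<rho>" "\<rho> < G / t"
  shows "\<exists>N>0. \<rho> ^ N \<le> C $ N"
proof (rule ccontr)
  assume contra: "\<not> ?thesis"
  obtain x where x: "t / G < x" "x < 1 / \<rho>"
  proof -
    have "t / G < 1 / \<rho>" using assms t_pos G_pos by (simp add: field_simps)
    from dense[OF this] show ?thesis using that by blast
  qed
  have x0: "0 < x" using x t_pos G_pos by (meson divide_pos_pos less_trans)
  have xr: "\<rho> * x < 1" using x assms by (simp add: field_simps)
  have C: "C $ n \<le> \<rho> ^ n" for n
  proof (cases "n = 0")
    case False
    have "\<not> (0 < n \<and> \<rho> ^ n \<le> C $ n)"
      using contra by (rule contrapos_nn) (rule exI)
    then show ?thesis using False by linarith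
  qed simp
  have "fps_ev C (ennreal x) \<le> fps_ev (Abs_fps (\<lambda>n. \<rho> ^ n)) (ennreal x)"
    using C by (intro fps_ev_mono) (auto simp: fps_le_def)
  also have "\<dots> = ennreal (1 / (1 - \<rho> * x))"
    using xr x0 assms geometric_sums[of "\<rho> * x"]
    by (intro fps_ev_sums) (auto simp: fps_le_def power_mult_distrib)
  finally have Cx: "fps_ev C (ennreal x) \<noteq> top"
    by (auto simp: top_unique)
  have "fps_ev T (ennreal x) \<noteq> top"
    using x0 by (intro fps_ev_T_finite[OF Cx]) auto
  then obtain s where s: "0 \<le> s" "fps_ev T (ennreal x) = ennreal s"
    by (cases "fps_ev T (ennreal x)") auto
  have "ennreal (w 0 * x) \<le> ennreal s"
    using fps_ev_ge_nth[of T 1 "ennreal x"] x0 s by (simp add: T_1 ennreal_mult del: One_nat_def)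
  then have s0: "0 < s" using x0 w_0 s by (simp add: ennreal_le_iff) (metis less_le_trans mult_pos_pos)
  have eq: "ennreal s = ennreal x * fps_ev \<Phi> (ennreal s)"
    using fps_ev_T[of "ennreal x"] by (simp only: s(2))
  then have fin: "fps_ev \<Phi> (ennreal s) \<noteq> top"
    using x0 by (auto simp: ennreal_mult_top)
  note r = fps_ev_\<Phi>_real[OF s(1) fin]
  have "s = x * (\<Sum>k. w k * s ^ k)"
    using eq x0 s(1) r by (simp add: ennreal_mult''[symmetric] suminf_nonneg)
  moreover have "x * (G * s) \<le> x * (t * (\<Sum>k. w k * s ^ k))"
    using x0 by (intro mult_left_mono gen_fun_ratio_ge[OF r(1) s0]) simp
  ultimately have "G * x * s \<le> t * s"
    by (simp only: ac_simps)
  then have "G * x \<le> t" using s0 by simp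
  then show False using x G_pos by (simp add: field_simps)
qed

text \<open>The cutoff of order \<open>N + 1\<close> is at most
  \<open>fps_X * (\<Phi> oo U)\<close>, where \<open>U\<close> is the cutoff of order
  \<open>N\<close>; since \<open>t = (t / G) * \<Phi>(t)\<close>, all cutoffs remain below
  \<open>t\<close>.\<close>

lemma fps_ev_T_le: "fps_ev T (ennreal (t / G)) \<le> ennreal t"
proof -
  let ?x = "ennreal (t / G)"
  have cut: "fps_ev (fps_cutoff N T) ?x \<le> ennreal t" for N
  proof (induction N)
    case 0
    then show ?case by (simp add: fps_ev_def)
  next
    case (Suc N)
    let ?U = "fps_cutoff N T"
    have U: "0 \<preceq> ?U" using T_nonneg by (auto simp: fps_le_def)
    have "fps_cutoff (Suc N) T \<preceq> fps_X * (\<Phi> oo ?U)"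
      unfolding fps_le_def
    proof
      fix n
      have nn: "0 \<le> (fps_X * (\<Phi> oo ?U)) $ n"
        by (intro fps_nonneg_nth fps_nonneg_mult fps_nonneg_X fps_nonneg_compose \<Phi>_nonneg U)
      show "fps_cutoff (Suc N) T $ n \<le> (fps_X * (\<Phi> oo ?U)) $ n"
      proof (cases "n \<le> N \<and> n \<noteq> 0")
        case True
        then obtain m where m: "n = Suc m" "m < N" by (cases n) auto
        have "(\<Phi> oo ?U) $ m = (\<Phi> oo T) $ m"
          unfolding fps_compose_nth
          using m by (intro sum.cong refl arg_cong2[of _ _ _ _ "(*)"] fps_power_nth_cong[of m]) auto
        moreover have "T $ n = (\<Phi> oo T) $ m" by (subst T_\<Phi>) (simp add: m)
        ultimately show ?thesis using m by simp
      qed (use nn in auto)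
    qed
    then have "fps_ev (fps_cutoff (Suc N) T) ?x \<le> fps_ev (fps_X * (\<Phi> oo ?U)) ?x"
      by (rule fps_ev_mono)
    also have "\<dots> = ?x * fps_ev \<Phi> (fps_ev ?U ?x)"
      using U by (simp add: fps_ev_mult fps_nonneg_compose \<Phi>_nonneg fps_ev_compose)
    also have "\<dots> \<le> ?x * fps_ev \<Phi> (ennreal t)"
      by (intro mult_left_mono fps_ev_mono_arg Suc.IH) auto
    also have "\<dots> = ennreal t"
      using t_pos G_pos by (simp add: fps_ev_\<Phi>_t flip: ennreal_mult')
    finally show ?case .
  qed
  show ?thesis
    unfolding fps_ev_def
  proof (rule suminf_le_const)
    fix N
    have "(\<Sum>n<N. ennreal (T $ n) * ?x ^ n) = (\<Sum>n<N. ennreal (fps_cutoff N T $ n) * ?x ^ n)"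
      by (intro sum.cong) auto
    also have "\<dots> \<le> fps_ev (fps_cutoff N T) ?x"
      unfolding fps_ev_def by (intro sum_le_suminf) auto
    also note cut
    finally show "(\<Sum>n<N. ennreal (T $ n) * ?x ^ n) \<le> ennreal t" .
  qed auto
qed

text \<open>A value \<open>s < t\<close> would also solve \<open>s = (t / G) * \<Phi>(s)\<close>,
  which \<open>gen_fun_ratio_gt\<close> excludes. This is the almost sure finiteness of the
  Galton-Watson tree with the tilted offspring law.\<close>

lemma fps_ev_T_eq: "fps_ev T (ennreal (t / G)) = ennreal t"
proof (rule ccontr)
  define x where "x = t / G"
  have x0: "0 < x" using t_pos G_pos by (simp add: x_def)
  assume ne: "\<not> ?thesis"
  obtain s where s: "0 \<le> s" "fps_ev T (ennreal x) = ennreal s"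
    using fps_ev_T_le unfolding x_def[symmetric] by (cases "fps_ev T (ennreal x)") (auto simp: top_unique)
  have st: "s < t"
    using ne fps_ev_T_le s t_pos unfolding x_def[symmetric] by (auto simp: ennreal_le_iff)
  have "ennreal (w 0 * x) \<le> ennreal s"
    using fps_ev_ge_nth[of T 1 "ennreal x"] x0 s by (simp add: T_1 ennreal_mult del: One_nat_def)
  then have s0: "0 < s" using x0 w_0 s by (simp add: ennreal_le_iff) (metis less_le_trans mult_pos_pos)
  have eq: "ennreal s = ennreal x * fps_ev \<Phi> (ennreal s)"
    using fps_ev_T[of "ennreal x"] by (simp only: s(2))
  then have fin: "fps_ev \<Phi> (ennreal s) \<noteq> top"
    using x0 by (auto simp: ennreal_mult_top)
  note r = fps_ev_\<Phi>_real[OF s(1) fin]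
  have "s = x * (\<Sum>k. w k * s ^ k)"
    using eq x0 s(1) r by (simp add: ennreal_mult''[symmetric] suminf_nonneg)
  moreover have "G * s < t * (\<Sum>k. w k * s ^ k)"
    by (rule gen_fun_ratio_gt[OF r(1) s0 st])
  ultimately show False using G_pos by (simp add: x_def field_simps)
qed

text \<open>With \<open>r\<close> the frequency of \<open>b\<close>, Jensen bounds
  \<open>exp (\<theta> * n * r) * Z n c\<close> by a coefficient of the tilted power, hence by
  \<open>(G * q) ^ n / t ^ s\<close>, and \<open>Z n c\<close> is at least
  \<open>\<kappa> * \<rho> ^ n\<close>. Of the error \<open>3 * \<theta>\<^sup>2\<close>, two units
  come from expanding \<open>exp \<theta>\<close>, one half from \<open>\<rho> < G / t\<close>, and
  one half from the constant \<open>K\<close>.\<close>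

lemma letter_upper:
  assumes "\<theta> \<noteq> 0" "\<bar>\<theta>\<bar> \<le> 1/2"
  shows "eventually (\<lambda>n. \<theta> * (w b * Z (n - 1) (c + int b - 1) / Z n c) \<le> \<theta> * p b + 3 * \<theta>\<^sup>2) (flt c)"
proof -
  define \<rho> where "\<rho> = G / t * exp (- (\<theta>\<^sup>2 / 2))"
  have \<rho>: "0 < \<rho>" "\<rho> < G / t"
    using t_pos G_pos assms mult_strict_left_mono[of "exp (- (\<theta>\<^sup>2 / 2))" 1 "G / t"]
    by (simp_all add: \<rho>_def)
  obtain \<kappa> where \<kappa>: "0 < \<kappa>" "\<And>n. 0 < Z n c \<Longrightarrow> \<kappa> * \<rho> ^ n \<le> Z n c"
    using C_growth[OF \<rho>] Z_growth[of _ \<rho> c] \<rho> by blast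
  \<comment> \<open>The factor \<open>t powr c\<close> accounts for \<open>s = n - c\<close> in
    \<open>t ^ s\<close>.\<close>
  define K where "K = t powr c / \<kappa>"
  have K: "0 < K" using \<kappa> t_pos by (simp add: K_def)
  obtain N where N: "ln K / (\<theta>\<^sup>2 / 2) \<le> real N"
    using real_arch_simple by blast
  have "eventually (\<lambda>n. 0 < Z n c \<and> max 1 N \<le> n) (flt c)"
    by (intro eventually_conj eventually_flt_pos eventually_flt_ge)
  then show ?thesis
  proof (rule eventually_mono)
    fix n assume "0 < Z n c \<and> max 1 N \<le> n"
    then have Zpos: "0 < Z n c" and n: "0 < n" "N \<le> n" by auto
    define r where "r = w b * Z (n - 1) (c + int b - 1) / Z n c"
    define s where "s = nat (int n - c)"
    have cn: "c \<le> int n" using Zpos by (auto simp: Z_def split: if_splits)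
    have Zs: "Z n c = (\<Phi> ^ n) $ s" using cn by (simp add: Z_def s_def)
    define F where "F = \<Phi> + fps_const ((exp \<theta> - 1) * \<Phi> $ b) * fps_X ^ b"
    define q where "q = 1 + (exp \<theta> - 1) * p b"
    have "exp (\<theta> * (real n * r)) * (\<Phi> ^ n) $ s \<le> (F ^ n) $ s"
      unfolding F_def
    proof (rule fps_power_tilt[OF \<Phi>_nonneg n(1)])
      show "real n * r = real n * \<Phi> $ b * (fps_X ^ b * \<Phi> ^ (n - 1)) $ s / (\<Phi> ^ n) $ s"
        unfolding s_def Z_shift[OF n(1) cn] r_def Zs by (simp add: s_def)
    qed (use Zpos Zs in simp)
    moreover have "(F ^ n) $ s * t ^ s \<le> (G * q) ^ n"
    proof (rule fps_power_nth_upper)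
      show "0 \<preceq> F"
        by (auto simp: F_def fps_le_def algebra_simps)
      have "(\<lambda>k. w k * t ^ k + (if k = b then (exp \<theta> - 1) * w b * t ^ b else 0)) sums
          (G + (exp \<theta> - 1) * w b * t ^ b)"
        by (intro sums_add G_sums sums_single)
      also have "(\<lambda>k. w k * t ^ k + (if k = b then (exp \<theta> - 1) * w b * t ^ b else 0)) = (\<lambda>n. F $ n * t ^ n)"
        by (auto simp: F_def algebra_simps)
      also have "G + (exp \<theta> - 1) * w b * t ^ b = G * q"
        using G_pos by (simp add: q_def p_def field_simps)
      finally show "(\<lambda>n. F $ n * t ^ n) sums (G * q)" .
    qed (use t_pos in simp)
    moreover have "t ^ s = t ^ n / t powr c"
    proof -
      have "t ^ s = t powr (real_of_int (int n - c))"
        using t_pos cn by (simp add: s_def powr_realpow[symmetric])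
      then show ?thesis using t_pos by (simp add: powr_diff powr_realpow)
    qed
    ultimately have "exp (\<theta> * (real n * r)) * Z n c * (t ^ n / t powr c) \<le> (G * q) ^ n"
      using t_pos unfolding Zs by (smt (verit) mult_right_mono zero_le_power divide_nonneg_nonneg powr_ge_zero)
    moreover have "exp (\<theta> * (real n * r)) * (\<kappa> * \<rho> ^ n) * (t ^ n / t powr c) \<le>
        exp (\<theta> * (real n * r)) * Z n c * (t ^ n / t powr c)"
      using \<kappa>(2)[OF Zpos] t_pos by (intro mult_right_mono mult_left_mono) auto
    ultimately have "exp (\<theta> * (real n * r)) * (\<kappa> * \<rho> ^ n) * (t ^ n / t powr c) \<le> (G * q) ^ n"
      by linarith
    also have "\<rho> ^ n = (G / t) ^ n * exp (- (real n * (\<theta>\<^sup>2 / 2)))"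
    proof -
      have "exp (- (\<theta>\<^sup>2 / 2)) ^ n = exp (- (real n * (\<theta>\<^sup>2 / 2)))"
        by (simp only: exp_of_nat_mult[symmetric] mult_minus_right)
      then show ?thesis by (simp add: \<rho>_def power_mult_distrib power_divide)
    qed
    finally have "exp (\<theta> * (real n * r)) * exp (- (real n * (\<theta>\<^sup>2 / 2))) / K \<le> q ^ n"
      using G_pos t_pos \<kappa> by (simp add: K_def power_divide power_mult_distrib field_simps)
    moreover have q_le: "q \<le> exp (\<theta> * p b + 2 * \<theta>\<^sup>2)"
    proof -
      have "exp \<theta> - 1 \<le> \<theta> + 2 * \<theta>\<^sup>2"
      proof -
        have "1 + (- \<theta>) \<le> exp (- \<theta>)" by (rule exp_ge_add_one_self)
        then have "exp \<theta> * (1 - \<theta>) \<le> exp \<theta> * exp (- \<theta>)" by (intro mult_left_mono) auto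
        then have "exp \<theta> * (1 - \<theta>) \<le> 1" by (simp flip: exp_add)
        then have "exp \<theta> \<le> 1 / (1 - \<theta>)" using assms by (simp add: field_simps abs_le_iff)
        also have "\<dots> \<le> 1 + \<theta> + 2 * \<theta>\<^sup>2"
        proof -
          have "(1 + \<theta> + 2 * \<theta>\<^sup>2) * (1 - \<theta>) - 1 = \<theta>\<^sup>2 * (1 - 2 * \<theta>)"
            by (simp add: power2_eq_square algebra_simps)
          moreover have "0 \<le> \<theta>\<^sup>2 * (1 - 2 * \<theta>)"
            using assms by (intro mult_nonneg_nonneg) (auto simp: abs_le_iff)
          ultimately have "1 \<le> (1 + \<theta> + 2 * \<theta>\<^sup>2) * (1 - \<theta>)" by linarith
          then show ?thesis using assms by (simp add: pos_divide_le_eq abs_le_iff)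
        qed
        finally show ?thesis by simp
      qed
      then have "(exp \<theta> - 1) * p b \<le> (\<theta> + 2 * \<theta>\<^sup>2) * p b"
        by (intro mult_right_mono p_nonneg)
      also have "\<dots> \<le> \<theta> * p b + 2 * \<theta>\<^sup>2"
        using mult_right_mono[OF p_le_1[of b], of "\<theta>\<^sup>2"] by (simp add: algebra_simps)
      finally show ?thesis
        unfolding q_def using exp_ge_add_one_self[of "\<theta> * p b + 2 * \<theta>\<^sup>2"] by linarith
    qed
    moreover have "0 \<le> q"
    proof -
      have "- 1 * p b \<le> (exp \<theta> - 1) * p b" by (intro mult_right_mono p_nonneg) auto
      then show ?thesis using p_le_1[of b] by (simp add: q_def)
    qed
    ultimately have "exp (\<theta> * (real n * r)) * exp (- (real n * (\<theta>\<^sup>2 / 2))) / K \<le>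
        exp (\<theta> * p b + 2 * \<theta>\<^sup>2) ^ n"
      by (meson order_trans power_mono)
    then have "exp (\<theta> * (real n * r) - real n * (\<theta>\<^sup>2 / 2)) \<le> exp (ln K + real n * (\<theta> * p b + 2 * \<theta>\<^sup>2))"
    proof -
      assume le: "exp (\<theta> * (real n * r)) * exp (- (real n * (\<theta>\<^sup>2 / 2))) / K \<le> exp (\<theta> * p b + 2 * \<theta>\<^sup>2) ^ n"
      have "exp (\<theta> * p b + 2 * \<theta>\<^sup>2) ^ n = exp (real n * (\<theta> * p b + 2 * \<theta>\<^sup>2))"
        by (simp only: exp_of_nat_mult)
      moreover have "exp (\<theta> * (real n * r) - real n * (\<theta>\<^sup>2 / 2)) =
          exp (\<theta> * (real n * r)) * exp (- (real n * (\<theta>\<^sup>2 / 2)))"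
        by (simp only: exp_add[symmetric] diff_conv_add_uminus)
      moreover have "exp (ln K + real n * (\<theta> * p b + 2 * \<theta>\<^sup>2)) = K * exp (real n * (\<theta> * p b + 2 * \<theta>\<^sup>2))"
        using K by (simp only: exp_add exp_ln)
      ultimately show ?thesis
        using le K by (simp only: pos_divide_le_eq mult.commute)
    qed
    then have "\<theta> * (real n * r) - real n * (\<theta>\<^sup>2 / 2) \<le> ln K + real n * (\<theta> * p b + 2 * \<theta>\<^sup>2)"
      by simp
    moreover have "ln K \<le> real n * (\<theta>\<^sup>2 / 2)"
    proof -
      have "ln K / (\<theta>\<^sup>2 / 2) \<le> real n" using N n by linarith
      then show ?thesis using assms by (subst (asm) pos_divide_le_eq) auto
    qed
    ultimately have "real n * (\<theta> * r) \<le> real n * (\<theta> * p b + 3 * \<theta>\<^sup>2)"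
      by (simp add: algebra_simps)
    then show "\<theta> * (w b * Z (n - 1) (c + int b - 1) / Z n c) \<le> \<theta> * p b + 3 * \<theta>\<^sup>2"
      unfolding r_def[symmetric] by (rule mult_left_le_imp_le) (use n in simp)
  qed
qed

text \<open>The bound for \<open>\<theta>\<close> and for \<open>- \<theta>\<close>, divided by
  \<open>\<theta>\<close>, confines the ratio to within \<open>3 * \<theta>\<close> of
  \<open>p b\<close>.\<close>

lemma letter_limit:
  "((\<lambda>n. w b * Z (n - 1) (c + int b - 1) / Z n c) \<longlongrightarrow> p b) (flt c)"
proof (rule tendstoI)
  fix \<delta> :: real assume \<delta>: "0 < \<delta>"
  define \<theta> where "\<theta> = min (1/2) (\<delta> / 4)"
  have \<theta>: "0 < \<theta>" "\<theta> \<le> 1/2" "3 * \<theta> < \<delta>" using \<delta> by (auto simp: \<theta>_def)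
  have "eventually (\<lambda>n. \<theta> * (w b * Z (n - 1) (c + int b - 1) / Z n c) \<le> \<theta> * p b + 3 * \<theta>\<^sup>2 \<and>
      (- \<theta>) * (w b * Z (n - 1) (c + int b - 1) / Z n c) \<le> (- \<theta>) * p b + 3 * (- \<theta>)\<^sup>2) (flt c)"
    using \<theta> by (intro eventually_conj letter_upper) auto
  then show "eventually (\<lambda>n. dist (w b * Z (n - 1) (c + int b - 1) / Z n c) (p b) < \<delta>) (flt c)"
  proof (rule eventually_mono)
    fix n
    define r where "r = w b * Z (n - 1) (c + int b - 1) / Z n c"
    assume "\<theta> * (w b * Z (n - 1) (c + int b - 1) / Z n c) \<le> \<theta> * p b + 3 * \<theta>\<^sup>2 \<and>
      (- \<theta>) * (w b * Z (n - 1) (c + int b - 1) / Z n c) \<le> (- \<theta>) * p b + 3 * (- \<theta>)\<^sup>2"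
    then have "\<theta> * r \<le> \<theta> * (p b + 3 * \<theta>)" "\<theta> * (p b - 3 * \<theta>) \<le> \<theta> * r"
      unfolding r_def[symmetric] by (auto simp: power2_eq_square algebra_simps)
    then have "r \<le> p b + 3 * \<theta>" "p b - 3 * \<theta> \<le> r"
      using \<theta> by simp_all
    then show "dist (w b * Z (n - 1) (c + int b - 1) / Z n c) (p b) < \<delta>"
      unfolding r_def[symmetric] dist_real_def using \<theta> by linarith
  qed
qed

text \<open>As the limit \<open>p b\<close> is positive, the numerator is eventually positive:
  removing a letter \<open>b\<close> leads from admissible lengths to admissible lengths, so that
  letter limits can be chained.\<close>

lemma filterlim_pred_flt:
  assumes "0 < w b"
  shows "filterlim (\<lambda>n. n - 1) (flt (c + int b - 1)) (flt c)"
  unfolding flt_def[of "c + int b - 1"] filterlim_inf filterlim_principal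
proof
  have "filterlim (\<lambda>n. n - 1) sequentially sequentially"
    by (rule filterlim_minus_const_nat_at_top)
  then show "filterlim (\<lambda>n. n - 1) sequentially (flt c)"
    by (rule filterlim_mono) (auto simp: flt_def)
  have "0 < p b" using assms t_pos G_pos by (simp add: p_def)
  from order_tendstoD(1)[OF letter_limit this]
  show "\<forall>\<^sub>F n in flt c. n - 1 \<in> {n. 0 < Z n (c + int b - 1)}"
  proof (rule eventually_mono)
    fix n assume "0 < w b * Z (n - 1) (c + int b - 1) / Z n c"
    then show "n - 1 \<in> {n. 0 < Z n (c + int b - 1)}"
      using Z_nonneg[of "n - 1" "c + int b - 1"] by (auto simp: less_le)
  qed
qed

text \<open>Any word of length \<open>l\<close> and sum \<open>l - d\<close> may be split off letter by letter.\<close>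

lemma word_limit:
  assumes "0 < Z l d"
  shows "((\<lambda>n. Z (n - l) (c - d) / Z n c) \<longlongrightarrow> t ^ nat (int l - d) / G ^ l) (flt c)"
  using assms
proof (induction l arbitrary: c d)
  case 0
  then have d: "d = 0" by (auto simp: Z_def split: if_splits)
  have "eventually (\<lambda>n. Z n c / Z n c = 1) (flt c)"
    using eventually_flt_pos by (rule eventually_mono) simp
  then show ?case unfolding d by (auto intro: tendsto_eventually)
next
  case (Suc l)
  define s where "s = nat (int (Suc l) - d)"
  have dl: "d \<le> int (Suc l)" using Suc.prems by (auto simp: Z_def split: if_splits)
  have "0 < (\<Phi> ^ Suc l) $ s" using Suc.prems dl by (simp add: Z_def s_def)
  then have "0 < (\<Sum>b=0..s. w b * (\<Phi> ^ l) $ (s - b))" by (simp add: fps_mult_nth)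
  \<comment> \<open>First letter of a word of positive weight. The limit depends only on
    \<open>l\<close> and \<open>d\<close>, so the choice is immaterial.\<close>
  then obtain b where b: "b \<le> s" "0 < w b * (\<Phi> ^ l) $ (s - b)"
    by (metis (no_types, lifting) atLeastAtMost_iff linorder_not_less sum_nonpos)
  have wb: "0 < w b" and lb: "0 < (\<Phi> ^ l) $ (s - b)"
    using b w_nonneg[of b] by (auto simp: zero_less_mult_iff)
  define d' where "d' = d + int b - 1"
  define c' where "c' = c + int b - 1"
  have sb: "int s = int (Suc l) - d" using dl by (simp add: s_def)
  have nat': "nat (int l - d') = s - b" "d' \<le> int l"
    using b sb by (auto simp: d'_def)
  have "0 < Z l d'" using lb nat' by (simp add: Z_def)
  from filterlim_compose[OF Suc.IH[OF this, of c'] filterlim_pred_flt[OF wb, of c, folded c'_def]]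
  have 1: "((\<lambda>n. Z (n - 1 - l) (c' - d') / Z (n - 1) c') \<longlongrightarrow> t ^ (s - b) / G ^ l) (flt c)"
    by (simp add: nat')
  have "((\<lambda>n. (w b * Z (n - 1) c' / Z n c) / w b) \<longlongrightarrow> p b / w b) (flt c)"
    using letter_limit[of b c] wb unfolding c'_def by (intro tendsto_divide tendsto_const) auto
  then have 2: "((\<lambda>n. Z (n - 1) c' / Z n c) \<longlongrightarrow> t ^ b / G) (flt c)"
    using wb by (simp add: p_def)
  have "((\<lambda>n. (Z (n - 1 - l) (c' - d') / Z (n - 1) c') * (Z (n - 1) c' / Z n c)) \<longlongrightarrow>
      (t ^ (s - b) / G ^ l) * (t ^ b / G)) (flt c)"
    by (rule tendsto_mult[OF 1 2])
  moreover have "(t ^ (s - b) / G ^ l) * (t ^ b / G) = t ^ s / G ^ Suc l"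
    using b by (simp flip: power_add)
  ultimately have lim: "((\<lambda>n. (Z (n - 1 - l) (c' - d') / Z (n - 1) c') * (Z (n - 1) c' / Z n c))
      \<longlongrightarrow> t ^ s / G ^ Suc l) (flt c)"
    by (simp only:)
  have "eventually (\<lambda>n. 0 < Z (n - 1) c') (flt c)"
    using filterlim_pred_flt[OF wb, of c, folded c'_def] eventually_flt_pos[of c']
    by (auto simp: filterlim_iff)
  then have "eventually (\<lambda>n. (Z (n - 1 - l) (c' - d') / Z (n - 1) c') * (Z (n - 1) c' / Z n c) =
      Z (n - Suc l) (c - d) / Z n c) (flt c)"
  proof (rule eventually_mono)
    fix n assume "0 < Z (n - 1) c'"
    moreover have "c' - d' = c - d" by (simp add: c'_def d'_def)
    ultimately show "(Z (n - 1 - l) (c' - d') / Z (n - 1) c') * (Z (n - 1) c' / Z n c) =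
      Z (n - Suc l) (c - d) / Z n c" by simp
  qed
  from Lim_transform_eventually[OF lim this] show ?case
    unfolding s_def .
qed

text \<open>Positivity of \<open>T $ l\<close> supplies a word of length \<open>l\<close> and sum
  \<open>l - 1\<close> to split off. The limit is \<open>(t / G) ^ l / t\<close>; times
  \<open>T $ l\<close> it is the probability that the Galton-Watson tree has \<open>l\<close>
  vertices.\<close>

lemma C_ratio_limit:
  assumes "0 < T $ l"
  shows "((\<lambda>n. C $ (n - l) / (T * C) $ n) \<longlongrightarrow> t ^ (l - 1) / G ^ l) (flt 1)"
proof -
  have "0 < l" using assms by (cases l) auto
  then have "0 < Z l 1" using assms by (simp add: Z_1 T_C_nth)
  from word_limit[OF this, of 1] \<open>0 < l\<close> show ?thesis
    by (simp add: Z_0 Z_1 nat_diff_distrib)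
qed

end

section \<open>Tightness of the fringe subtrees\<close>

lemma fps_prod_nth_below:
  fixes F :: "nat \<Rightarrow> real fps"
  assumes "\<And>j. F j $ 0 = 0" "n < h"
  shows "((\<Prod>j=1..h. F j) * H) $ n = 0"
  using assms(2)
proof (induction h arbitrary: n H)
  case (Suc h)
  have "(\<Prod>j=1..Suc h. F j) * H = (\<Prod>j=1..h. F j) * (F (Suc h) * H)"
    by (simp add: mult.assoc)
  also have "\<dots> $ n = 0"
  proof (cases "n < h")
    case False
    have F0: "F (Suc h) * H = fps_X * (fps_shift 1 (F (Suc h)) * H)"
    proof -
      have "F (Suc h) = fps_X * fps_shift 1 (F (Suc h))"
        by (rule fps_ext) (use assms(1) in \<open>auto simp: fps_X_mult_nth\<close>)
      then show ?thesis by (metis mult.assoc)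
    qed
    have "((\<Prod>j=1..h. F j) * (F (Suc h) * H)) $ n =
        (fps_X * ((\<Prod>j=1..h. F j) * (fps_shift 1 (F (Suc h)) * H))) $ n"
      unfolding F0 by (simp only: ac_simps)
    also have "\<dots> = 0"
      using Suc.IH[of "n - 1"] Suc.prems False by (auto simp: fps_X_mult_nth less_Suc_eq)
    finally show ?thesis .
  qed (rule Suc.IH)
  finally show ?case .
qed simp

context weighted_trees
begin

lemma T_C_nonneg: "0 \<preceq> T * C"
  by (intro fps_nonneg_mult T_nonneg C_nonneg)

text \<open>The limit takes care of \<open>n \<ge> N\<close>, and the bound \<open>1 / n\<close> of
  \<open>leaf_weight_ge\<close> of the smaller \<open>n\<close>; these are the two entries of the
  minimum \<open>\<epsilon>\<close>.\<close>

lemma leaf_constant: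
  assumes lim: "((\<lambda>n. w 0 * (fps_X * C) $ n / (T * C) $ n) \<longlongrightarrow> p0) (flt 1)" and "0 < p0"
  shows "\<exists>\<epsilon>. weighted_trees_leaf w T \<epsilon>"
proof -
  have "eventually (\<lambda>n. p0 / 2 < w 0 * (fps_X * C) $ n / (T * C) $ n) (flt 1)"
    using assms by (intro order_tendstoD(1)[OF lim]) auto
  then obtain N where N: "\<And>n. N \<le> n \<Longrightarrow> 0 < (T * C) $ n \<Longrightarrow> p0 / 2 < w 0 * (fps_X * C) $ n / (T * C) $ n"
    unfolding eventually_flt Z_1 eventually_sequentially by blast
  define \<epsilon> where "\<epsilon> = min (p0 / 2) (1 / (1 + real N))"
  have \<epsilon>: "0 < \<epsilon>" "\<epsilon> \<le> 1" "\<epsilon> \<le> p0 / 2" "\<epsilon> \<le> 1 / (1 + real N)"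
    using assms by (auto simp: \<epsilon>_def min_le_iff_disj)
  have "\<epsilon> * (T * C) $ n \<le> w 0 * (fps_X * C) $ n" for n
  proof (cases "0 < (T * C) $ n")
    case True
    show ?thesis
    proof (cases "N \<le> n")
      case True
      have "\<epsilon> * (T * C) $ n \<le> p0 / 2 * (T * C) $ n"
        using \<epsilon> \<open>0 < (T * C) $ n\<close> by (intro mult_right_mono) auto
      then show ?thesis
        using N[OF True \<open>0 < (T * C) $ n\<close>] \<open>0 < (T * C) $ n\<close>
        by (subst (asm) pos_less_divide_eq) linarith+
    next
      case False
      have n: "0 < n" using True by (cases n) auto
      have "1 / real n * (T * C) $ n \<le> 1 / real n * (real n * (w 0 * (fps_X * C) $ n))"
        by (intro mult_left_mono leaf_weight_ge[OF n]) simp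
      also have "\<dots> = w 0 * (fps_X * C) $ n"
        unfolding mult.assoc[symmetric] using n by simp
      finally have "1 / real n * (T * C) $ n \<le> w 0 * (fps_X * C) $ n" .
      moreover have "1 / (1 + real N) \<le> 1 / real n"
        using False n by (intro divide_left_mono) auto
      then have "\<epsilon> \<le> 1 / real n" using \<epsilon>(4) by linarith
      then have "\<epsilon> * (T * C) $ n \<le> 1 / real n * (T * C) $ n"
        using True by (intro mult_right_mono) auto
      ultimately show ?thesis
        by (rule order_trans[rotated])
    qed
  next
    case False
    then have "(T * C) $ n = 0"
      using fps_nonneg_nth[OF T_C_nonneg, of n] by simp
    moreover have "0 \<le> (fps_X * C) $ n"
      by (intro fps_nonneg_nth fps_nonneg_mult fps_nonneg_X C_nonneg)
    ultimately show ?thesis using w_0 by simp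
  qed
  then have "weighted_trees_leaf w T \<epsilon>"
    using \<epsilon> by unfold_locales auto
  then show ?thesis ..
qed

definition tail :: "nat \<Rightarrow> real fps \<Rightarrow> real fps" where
  "tail L F = Abs_fps (\<lambda>n. if L \<le> n then F $ n else 0)"

lemma tail_nth [simp]: "tail L F $ n = (if L \<le> n then F $ n else 0)"
  by (simp add: tail_def)

lemma tail_nonneg: "0 \<preceq> F \<Longrightarrow> 0 \<preceq> tail L F"
  by (auto simp: fps_le_def)

lemma tail_le: "0 \<preceq> F \<Longrightarrow> tail L F \<preceq> F"
  by (auto simp: fps_le_def)

lemma tail_mono: "F \<preceq> G \<Longrightarrow> tail L F \<preceq> tail L G"
  by (auto simp: fps_le_def)

lemma tail_antimono: "0 \<preceq> F \<Longrightarrow> L \<le> L' \<Longrightarrow> tail L' F \<preceq> tail L F"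
  by (auto simp: fps_le_def)

text \<open>
  \<open>F * C\<close> counts trees with a marked vertex at which an \<open>F\<close>-structure is attached. Tightness says
  that this structure has bounded size with high probability as the size of the tree grows.
\<close>

definition tight :: "real fps \<Rightarrow> bool" where
  "tight F \<longleftrightarrow> 0 \<preceq> F \<and>
     (\<forall>\<delta>>0. \<exists>L. \<forall>\<^sub>F n in flt 1. (tail L F * C) $ n \<le> \<delta> * (T * C) $ n)"

lemma tightD:
  assumes "tight F" "0 < \<delta>"
  obtains L where "\<And>L'. L \<le> L' \<Longrightarrow> \<forall>\<^sub>F n in flt 1. (tail L' F * C) $ n \<le> \<delta> * (T * C) $ n"
proof -
  obtain L where L: "\<forall>\<^sub>F n in flt 1. (tail L F * C) $ n \<le> \<delta> * (T * C) $ n" and F: "0 \<preceq> F"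
    using assms by (auto simp: tight_def)
  show ?thesis
  proof (rule that)
    fix L' assume "L \<le> L'"
    have "tail L' F * C \<preceq> tail L F * C"
      by (intro fps_le_mult_right C_nonneg tail_antimono F \<open>L \<le> L'\<close>)
    then show "\<forall>\<^sub>F n in flt 1. (tail L' F * C) $ n \<le> \<delta> * (T * C) $ n"
      using L by (auto elim!: eventually_mono intro: order_trans simp: fps_le_def)
  qed
qed

lemma tight_mono:
  assumes "tight G" "0 \<preceq> F" "F \<preceq> G"
  shows "tight F"
  unfolding tight_def
proof (intro conjI allI impI)
  fix \<delta> :: real assume "0 < \<delta>"
  then obtain L where L: "\<forall>\<^sub>F n in flt 1. (tail L G * C) $ n \<le> \<delta> * (T * C) $ n"
    using assms(1) by (auto simp: tight_def)
  have "tail L F * C \<preceq> tail L G * C"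
    by (intro fps_le_mult_right C_nonneg tail_mono assms)
  then have "\<forall>\<^sub>F n in flt 1. (tail L F * C) $ n \<le> \<delta> * (T * C) $ n"
    using L by (auto elim!: eventually_mono intro: order_trans simp: fps_le_def)
  then show "\<exists>L. \<forall>\<^sub>F n in flt 1. (tail L F * C) $ n \<le> \<delta> * (T * C) $ n" ..
qed fact

text \<open>
  \<open>B R h\<close> is the generating function of the trees with a marked vertex of height \<open>h\<close>
  at distance at least \<open>R\<close> from the leaves. By truncated subtraction, the factors with \<open>j \<ge> R - 1\<close>
  are \<open>A 0\<close>, that is, these ancestors are unrestricted.
\<close>

definition B :: "nat \<Rightarrow> nat \<Rightarrow> real fps" where
  "B R h = D R * (\<Prod>j=1..h. A (R - 1 - j))"

definition pointed :: "nat \<Rightarrow> nat \<Rightarrow> real" where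
  "pointed R n = (\<Sum>h\<le>n. B R h $ n)"

lemma A_0 [simp]: "A i $ 0 = 0"
  by (simp add: A_def)

lemma B_nonneg: "0 \<preceq> B R h"
  unfolding B_def by (intro fps_nonneg_mult fps_nonneg_prod D_nonneg A_nonneg)

lemma B_0: "B R 0 = D R"
  by (simp add: B_def)

lemma B_Suc: "B R (Suc h) = B R h * A (R - 1 - Suc h)"
  by (simp add: B_def mult.assoc)

lemma B_below: "n < h \<Longrightarrow> B R h $ n = 0"
  unfolding B_def by (subst mult.commute) (rule fps_prod_nth_below, auto)

lemma A_0_pow_C_le: "A 0 ^ h * C \<preceq> C"
proof (induction h)
  case (Suc h)
  have "A 0 ^ Suc h * C = A 0 * (A 0 ^ h * C)" by (simp add: mult.assoc)
  also have "\<dots> \<preceq> A 0 * C" by (intro fps_le_mult_left A_nonneg Suc.IH)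
  also have "\<dots> \<preceq> C" by (rule A_0_C_le)
  finally show ?case .
qed simp

lemma le_mult_C: "0 \<preceq> F \<Longrightarrow> F \<preceq> F * C"
proof -
  assume "0 \<preceq> F"
  moreover have "1 \<preceq> C"
    unfolding fps_le_def using C_nonneg by (auto simp: fps_le_def)
  ultimately show "F \<preceq> F * C"
    using fps_le_mult_left[of F 1 C] by simp
qed

lemma B_le: "B R h \<preceq> D R * A 0 ^ h"
proof (induction h)
  case (Suc h)
  show ?case unfolding B_Suc power_Suc2 mult.assoc[symmetric]
    by (intro fps_le_mult Suc.IH A_antimono B_nonneg A_nonneg) simp
qed (simp add: B_0)

lemma B_le_T_C: "B R h \<preceq> T * C"
proof -
  have "B R h \<preceq> D R * A 0 ^ h" by (rule B_le)
  also have "\<dots> \<preceq> (D R * A 0 ^ h) * C"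
    by (intro le_mult_C fps_nonneg_mult D_nonneg fps_nonneg_power A_nonneg)
  also have "\<dots> = D R * (A 0 ^ h * C)" by (simp add: mult.assoc)
  also have "\<dots> \<preceq> D R * C" by (intro fps_le_mult_left D_nonneg A_0_pow_C_le)
  also have "\<dots> \<preceq> T * C"
    using D_antimono[of 0 R] by (intro fps_le_mult_right C_nonneg) auto
  finally show ?thesis .
qed

text \<open>Makes \<open>C_ratio_limit\<close> applicable to every size that occurs with positive
  weight.\<close>

lemma B_supp: "0 < B R h $ l \<Longrightarrow> 0 < T $ l"
  using fps_leD[OF B_le_T_C[of R h], of l] T_C_nth[of l]
  by (cases "l = 0") (auto simp: zero_less_mult_iff dest: less_le_trans)

lemma C_geometric: "C = (\<Sum>i<m. A 0 ^ i) + A 0 ^ m * C"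
proof (induction m)
  case (Suc m)
  have "A 0 ^ m * C = A 0 ^ m * (1 + A 0 * C)"
    by (rule arg_cong[OF C_eq])
  also have "\<dots> = A 0 ^ m + A 0 ^ Suc m * C"
    by (simp only: distrib_left mult_1_right power_Suc2 mult.assoc)
  finally have "(\<Sum>i<m. A 0 ^ i) + A 0 ^ m * C = (\<Sum>i<Suc m. A 0 ^ i) + A 0 ^ Suc m * C"
    by (simp only: sum.lessThan_Suc add.assoc)
  with Suc.IH show ?case by (rule trans)
qed simp

lemma B_eventually_geometric:
  assumes "R - 2 \<le> h"
  shows "B R h = B R (R - 2) * A 0 ^ (h - (R - 2))"
  using assms
proof (induction h rule: dec_induct)
  case (step h)
  then have "R - 1 - Suc h = 0" by simp
  then have "B R (Suc h) = B R (R - 2) * A 0 ^ (h - (R - 2)) * A 0"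
    unfolding B_Suc using step by simp
  also have "\<dots> = B R (R - 2) * A 0 ^ (Suc h - (R - 2))"
    using step.hyps by (simp add: Suc_diff_le ac_simps)
  finally show ?case .
qed simp

text \<open>Beyond height \<open>R - 2\<close> each further factor is \<open>A 0\<close>, and the
  powers of \<open>A 0\<close> sum to \<open>C\<close>; the remainder in \<open>C_geometric\<close>
  has order above \<open>n\<close>. The finite sum belongs to marked vertices close to the root and
  is negligible later.\<close>

lemma pointed_eq: "pointed R n = (\<Sum>h<R - 2. B R h $ n) + (B R (R - 2) * C) $ n"
proof -
  let ?K = "R - 2"
  have "pointed R n = (\<Sum>h<?K + Suc n. B R h $ n)"
    unfolding pointed_def
    by (rule sum.mono_neutral_left) (auto simp: B_below)
  also have "\<dots> = (\<Sum>h<?K. B R h $ n) + (\<Sum>h=?K..<?K + Suc n. B R h $ n)"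
    unfolding lessThan_atLeast0 by (rule sum.atLeastLessThan_concat[symmetric]) auto
  also have "(\<Sum>h=?K..<?K + Suc n. B R h $ n) = (\<Sum>i<Suc n. (B R ?K * A 0 ^ i) $ n)"
  proof -
    have "(\<Sum>h=?K..<?K + Suc n. B R h $ n) = (\<Sum>h=0 + ?K..<Suc n + ?K. B R h $ n)"
      by (simp only: add_0 add.commute)
    also have "\<dots> = (\<Sum>i=0..<Suc n. B R (i + ?K) $ n)"
      by (rule sum.shift_bounds_nat_ivl)
    also have "\<dots> = (\<Sum>i<Suc n. (B R ?K * A 0 ^ i) $ n)"
      unfolding lessThan_atLeast0
    proof (intro sum.cong refl)
      fix i
      show "B R (i + ?K) $ n = (B R ?K * A 0 ^ i) $ n"
        by (subst B_eventually_geometric) (simp_all del: add_diff_assoc2)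
    qed
    finally show ?thesis .
  qed
  also have "\<dots> = (B R ?K * (\<Sum>i<Suc n. A 0 ^ i)) $ n"
    by (simp add: sum_distrib_left fps_sum_nth del: sum.lessThan_Suc)
  also have "\<dots> = (B R ?K * C) $ n"
  proof -
    have "B R ?K * C = B R ?K * ((\<Sum>i<Suc n. A 0 ^ i) + A 0 ^ Suc n * C)"
      by (rule arg_cong[OF C_geometric])
    also have "\<dots> = B R ?K * (\<Sum>i<Suc n. A 0 ^ i) + A 0 ^ Suc n * (B R ?K * C)"
      by (simp only: distrib_left mult.left_commute)
    finally have "(B R ?K * C) $ n = (B R ?K * (\<Sum>i<Suc n. A 0 ^ i) + A 0 ^ Suc n * (B R ?K * C)) $ n"
      by (rule arg_cong[of _ _ "\<lambda>F. F $ n"])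
    then have "(B R ?K * C) $ n = (B R ?K * (\<Sum>i<Suc n. A 0 ^ i)) $ n + (A 0 ^ Suc n * (B R ?K * C)) $ n"
      unfolding fps_add_nth .
    moreover have "(A 0 ^ Suc n * (B R ?K * C)) $ n = 0"
      by (rule fps_power_nth_below) auto
    ultimately show ?thesis by simp
  qed
  finally show ?thesis .
qed

lemma pointed_0: "pointed 0 n = (T * C) $ n"
  by (simp add: pointed_eq B_0)

lemma pointed_nonneg: "0 \<le> pointed R n"
  unfolding pointed_def by (intro sum_nonneg fps_nonneg_nth B_nonneg)

lemma pointed_le: "pointed R n \<le> (D R * C) $ n"
proof -
  have "pointed R n \<le> (\<Sum>h\<le>n. (D R * A 0 ^ h) $ n)"
    unfolding pointed_def by (intro sum_mono fps_leD B_le)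
  also have "\<dots> = (D R * (\<Sum>h<Suc n. A 0 ^ h)) $ n"
    by (simp add: sum_distrib_left fps_sum_nth lessThan_Suc_atMost del: sum.lessThan_Suc)
  also have "\<dots> \<le> (D R * C) $ n"
  proof (rule fps_leD, rule fps_le_mult_left[OF D_nonneg])
    have "0 \<preceq> A 0 ^ Suc n * C"
      by (intro fps_nonneg_mult fps_nonneg_power A_nonneg C_nonneg)
    then have "(\<Sum>h<Suc n. A 0 ^ h) \<preceq> (\<Sum>h<Suc n. A 0 ^ h) + A 0 ^ Suc n * C"
      by (simp add: fps_le_def del: sum.lessThan_Suc power_Suc)
    also have "\<dots> = C" by (rule C_geometric[symmetric])
    finally show "(\<Sum>h<Suc n. A 0 ^ h) \<preceq> C" .
  qed
  finally show ?thesis .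
qed

end

lemma (in weighted_trees_leaf) pointed_exponential: "pointed R n \<le> (1 - \<epsilon>) ^ R * (T * C) $ n"
  using pointed_le[of R n] fps_leD[OF D_C_le[of R], of n] by simp

context tilted_trees
begin

abbreviation "x \<equiv> t / G"

lemma x_pos: "0 < x"
  using t_pos G_pos by simp

lemma leaf_fraction_limit: "((\<lambda>n. w 0 * (fps_X * C) $ n / (T * C) $ n) \<longlongrightarrow> p 0) (flt 1)"
proof -
  have "0 < T $ 1" using w_0 by (simp add: T_1 del: One_nat_def)
  from tendsto_mult_left[OF C_ratio_limit[OF this], of "w 0"]
  have "((\<lambda>n. w 0 * (C $ (n - 1) / (T * C) $ n)) \<longlongrightarrow> p 0) (flt 1)"
    by (simp add: p_def)
  then show ?thesis
  proof (rule Lim_transform_eventually)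
    show "\<forall>\<^sub>F n in flt 1. w 0 * (C $ (n - 1) / (T * C) $ n) = w 0 * (fps_X * C) $ n / (T * C) $ n"
      using eventually_flt_ge[of 1] by (rule eventually_mono) simp
  qed
qed

text \<open>Finitely many sizes \<open>l < L\<close> contribute, and each has a limit by
  \<open>C_ratio_limit\<close>.\<close>

lemma head_limit:
  assumes supp: "\<And>l. 0 < F $ l \<Longrightarrow> 0 < T $ l" and F: "0 \<preceq> F"
  shows "((\<lambda>n. ((F - tail L F) * C) $ n / (T * C) $ n) \<longlongrightarrow> (\<Sum>l<L. F $ l * x ^ l) / t) (flt 1)"
proof -
  have "((\<lambda>n. \<Sum>l<L. F $ l * (C $ (n - l) / (T * C) $ n)) \<longlongrightarrow> (\<Sum>l<L. F $ l * (x ^ l / t))) (flt 1)"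
  proof (intro tendsto_sum)
    fix l
    show "((\<lambda>n. F $ l * (C $ (n - l) / (T * C) $ n)) \<longlongrightarrow> F $ l * (x ^ l / t)) (flt 1)"
    proof (cases "0 < F $ l")
      case True
      note T = supp[OF True]
      then have l: "0 < l" by (cases l) auto
      then have "x ^ l / t = t ^ (l - 1) / G ^ l"
        using t_pos by (cases l) (auto simp: power_divide)
      then show ?thesis
        using C_ratio_limit[OF T] by (intro tendsto_mult_left) simp
    next
      case False
      then have "F $ l = 0" using fps_nonneg_nth[OF F, of l] by simp
      then show ?thesis by simp
    qed
  qed
  then show ?thesis
  proof (rule Lim_transform_eventually[THEN back_subst[of "\<lambda>l. (_ \<longlongrightarrow> l) _"]])
    show "(\<Sum>l<L. F $ l * (x ^ l / t)) = (\<Sum>l<L. F $ l * x ^ l) / t"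
      by (simp add: sum_divide_distrib)
    show "\<forall>\<^sub>F n in flt 1. (\<Sum>l<L. F $ l * (C $ (n - l) / (T * C) $ n)) = ((F - tail L F) * C) $ n / (T * C) $ n"
      using eventually_flt_ge[of L]
    proof (rule eventually_mono)
      fix n assume "L \<le> n"
      have "((F - tail L F) * C) $ n = (\<Sum>l<L. F $ l * C $ (n - l))"
        unfolding fps_mult_nth using \<open>L \<le> n\<close> by (intro sum.mono_neutral_cong_right) auto
      then show "(\<Sum>l<L. F $ l * (C $ (n - l) / (T * C) $ n)) = ((F - tail L F) * C) $ n / (T * C) $ n"
        by (simp add: sum_divide_distrib)
    qed
  qed
qed

lemma tight_limit:
  assumes F: "tight F" and supp: "\<And>l. 0 < F $ l \<Longrightarrow> 0 < T $ l"
    and S: "(\<lambda>l. F $ l * x ^ l) sums (t * S)"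
  shows "((\<lambda>n. (F * C) $ n / (T * C) $ n) \<longlongrightarrow> S) (flt 1)"
proof (rule tendstoI)
  fix \<delta> :: real assume \<delta>: "0 < \<delta>"
  have nn: "0 \<preceq> F" using F by (simp add: tight_def)
  obtain L where L: "\<And>L'. L \<le> L' \<Longrightarrow> \<forall>\<^sub>F n in flt 1. (tail L' F * C) $ n \<le> \<delta> / 3 * (T * C) $ n"
    using tightD[OF F, of "\<delta> / 3"] \<delta> by auto
  have "(\<lambda>L. (\<Sum>l<L. F $ l * x ^ l) / t) \<longlonglongrightarrow> t * S / t"
    using S t_pos unfolding sums_def by (intro tendsto_divide tendsto_const) auto
  then have "(\<lambda>L. (\<Sum>l<L. F $ l * x ^ l) / t) \<longlonglongrightarrow> S" using t_pos by simp
  from tendstoD[OF this, of "\<delta> / 3"] \<delta>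
  have "\<forall>\<^sub>F L' in sequentially. L \<le> L' \<and> dist ((\<Sum>l<L'. F $ l * x ^ l) / t) S < \<delta> / 3"
    by (intro eventually_conj eventually_ge_at_top) auto
  then obtain L' where L': "L \<le> L'" "dist ((\<Sum>l<L'. F $ l * x ^ l) / t) S < \<delta> / 3"
    by (auto simp: eventually_sequentially)
  have "\<forall>\<^sub>F n in flt 1. dist (((F - tail L' F) * C) $ n / (T * C) $ n) ((\<Sum>l<L'. F $ l * x ^ l) / t) < \<delta> / 3"
    using \<delta> by (intro tendstoD[OF head_limit] supp nn) auto
  then have "\<forall>\<^sub>F n in flt 1. 0 < Z n 1 \<and> (tail L' F * C) $ n \<le> \<delta> / 3 * (T * C) $ n \<and>
      dist (((F - tail L' F) * C) $ n / (T * C) $ n) ((\<Sum>l<L'. F $ l * x ^ l) / t) < \<delta> / 3"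
    by (intro eventually_conj eventually_flt_pos L L')
  then show "\<forall>\<^sub>F n in flt 1. dist ((F * C) $ n / (T * C) $ n) S < \<delta>"
  proof (rule eventually_mono)
    fix n assume n: "0 < Z n 1 \<and> (tail L' F * C) $ n \<le> \<delta> / 3 * (T * C) $ n \<and>
      dist (((F - tail L' F) * C) $ n / (T * C) $ n) ((\<Sum>l<L'. F $ l * x ^ l) / t) < \<delta> / 3"
    have "(F * C) $ n = ((F - tail L' F) * C) $ n + (tail L' F * C) $ n"
      by (simp add: left_diff_distrib)
    then have "(F * C) $ n / (T * C) $ n =
        ((F - tail L' F) * C) $ n / (T * C) $ n + (tail L' F * C) $ n / (T * C) $ n"
      by (simp add: add_divide_distrib)
    moreover have "(tail L' F * C) $ n / (T * C) $ n \<le> \<delta> / 3"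
      using n by (simp add: Z_1 pos_divide_le_eq)
    moreover have "0 \<le> (tail L' F * C) $ n / (T * C) $ n"
      using n by (intro divide_nonneg_pos fps_nonneg_nth fps_nonneg_mult tail_nonneg nn C_nonneg) (simp add: Z_1)
    ultimately show "dist ((F * C) $ n / (T * C) $ n) S < \<delta>"
      using n L'(2) unfolding dist_real_def by linarith
  qed
qed

lemma T_sums: "(\<lambda>l. T $ l * x ^ l) sums t"
proof -
  have "fps_ev T (ennreal x) \<noteq> top" by (simp add: fps_ev_T_eq)
  from fps_ev_real[OF T_nonneg _ this] x_pos
  have "summable (\<lambda>n. T $ n * x ^ n)" "ennreal t = ennreal (\<Sum>n. T $ n * x ^ n)"
    by (auto simp: fps_ev_T_eq)
  moreover have "0 \<le> (\<Sum>n. T $ n * x ^ n)"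
    using calculation(1) x_pos T_nonneg by (intro suminf_nonneg) (auto simp: fps_le_def)
  ultimately show ?thesis
    using t_pos by (auto simp: sums_iff)
qed

text \<open>No mass escapes, since the Galton--Watson tree is finite almost surely.\<close>

lemma tight_T: "tight T"
  unfolding tight_def
proof (intro conjI allI impI T_nonneg)
  fix \<delta> :: real assume \<delta>: "0 < \<delta>"
  have "(\<lambda>L. (\<Sum>l<L. T $ l * x ^ l) / t) \<longlonglongrightarrow> t / t"
    using T_sums t_pos unfolding sums_def by (intro tendsto_divide tendsto_const) auto
  then have "(\<lambda>L. (\<Sum>l<L. T $ l * x ^ l) / t) \<longlonglongrightarrow> 1" using t_pos by simp
  from order_tendstoD(1)[OF this, of "1 - \<delta>"] \<delta>
  obtain L where L: "1 - \<delta> < (\<Sum>l<L. T $ l * x ^ l) / t"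
    by (auto simp: eventually_sequentially)
  \<comment> \<open>Head and tail together have ratio exactly 1, so a head close to 1 leaves at most
    \<open>\<delta>\<close> for the tail.\<close>
  have "\<forall>\<^sub>F n in flt 1. 1 - \<delta> < ((T - tail L T) * C) $ n / (T * C) $ n"
    using L by (intro order_tendstoD(1)[OF head_limit[OF _ T_nonneg]])
  then have "\<forall>\<^sub>F n in flt 1. 0 < Z n 1 \<and> 1 - \<delta> < ((T - tail L T) * C) $ n / (T * C) $ n"
    by (intro eventually_conj eventually_flt_pos)
  then have "\<forall>\<^sub>F n in flt 1. (tail L T * C) $ n \<le> \<delta> * (T * C) $ n"
  proof (rule eventually_mono)
    fix n assume n: "0 < Z n 1 \<and> 1 - \<delta> < ((T - tail L T) * C) $ n / (T * C) $ n"
    then have "0 < (T * C) $ n" "1 - \<delta> < ((T - tail L T) * C) $ n / (T * C) $ n"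
      unfolding Z_1 by blast+
    then have "(1 - \<delta>) * (T * C) $ n < ((T - tail L T) * C) $ n"
      by (simp only: pos_less_divide_eq)
    moreover have "((T - tail L T) * C) $ n = (T * C) $ n - (tail L T * C) $ n"
      by (simp add: left_diff_distrib)
    ultimately show "(tail L T * C) $ n \<le> \<delta> * (T * C) $ n"
      by (simp add: left_diff_distrib)
  qed
  then show "\<exists>L. \<forall>\<^sub>F n in flt 1. (tail L T * C) $ n \<le> \<delta> * (T * C) $ n" ..
qed

end

locale tilted_trees_leaf = tilted_trees w T t + weighted_trees_leaf w T \<epsilon> for w T t \<epsilon>
begin

text \<open>A large structure in \<open>F * A 1\<close> has one of three causes. Either the part
  from \<open>F\<close> is large already; or that part and the degree are bounded, and then the
  whole is dominated by a multiple of the tight series \<open>T\<close>; or the degree is at least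
  \<open>K\<close>, with relative weight at most \<open>M / (\<epsilon> * K)\<close>. The index 1
  matters, as \<open>big_C_le\<close> rests on siblings that are not leaves.\<close>

lemma tight_mult_A_1:
  assumes F: "tight F" and supp: "\<And>l. 0 < F $ l \<Longrightarrow> 0 < T $ l"
  shows "tight (F * A 1)"
  unfolding tight_def
proof (intro conjI allI impI)
  have nn: "0 \<preceq> F" using F by (simp add: tight_def)
  then show "0 \<preceq> F * A 1" by (intro fps_nonneg_mult A_nonneg)
  fix \<delta> :: real assume \<delta>: "0 < \<delta>"
  obtain L where L: "\<forall>\<^sub>F n in flt 1. (tail L F * C) $ n \<le> \<delta> / 3 * (T * C) $ n"
    using tightD[OF F, of "\<delta> / 3"] \<delta> by auto
  define H where "H = F - tail L F"
  have H: "0 \<preceq> H" using nn by (auto simp: H_def fps_le_def)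
  \<comment> \<open>A crude bound for all ratios at once: \<open>H\<close> lives on finitely many
    sizes, at which \<open>T\<close> is positive, so \<open>H\<close> is at most \<open>M\<close>
    times \<open>T\<close>.\<close>
  define M where "M = (\<Sum>l<L. F $ l / T $ l)"
  have ratio_nn: "0 \<le> F $ l / T $ l" for l
    using nn T_nonneg by (auto simp: fps_le_def)
  have M: "0 \<le> M" unfolding M_def by (intro sum_nonneg ratio_nn)
  have HT: "H \<preceq> fps_const M * T"
    unfolding fps_le_def
  proof
    fix l
    show "H $ l \<le> (fps_const M * T) $ l"
    proof (cases "l < L \<and> 0 < F $ l")
      case True
      have "F $ l / T $ l \<le> M"
        unfolding M_def using True ratio_nn by (intro member_le_sum) auto
      then show ?thesis
        using supp[of l] True by (simp add: H_def pos_divide_le_eq)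
    next
      case False
      then have "H $ l \<le> 0" by (auto simp: H_def)
      then show ?thesis using M T_nonneg by (auto simp: fps_le_def intro: order_trans)
    qed
  qed
  obtain K :: nat where K: "0 < K" "M / (\<epsilon> * real K) \<le> \<delta> / 3"
  proof -
    obtain K :: nat where "M / (\<epsilon> * (\<delta> / 3)) < real K" using reals_Archimedean2 by blast
    then have "M / (\<epsilon> * (\<delta> / 3)) \<le> real (Suc K)" by simp
    then have "M / (\<epsilon> * real (Suc K)) \<le> \<delta> / 3"
      using eps \<delta> by (simp add: field_simps del: of_nat_Suc)
    then show ?thesis using that[of "Suc K"] by simp
  qed
  \<comment> \<open>The summand 1 allows division by \<open>c\<close> even if
    \<open>M = 0\<close>.\<close>
  define c where "c = M * real K + 1"
  have c: "0 < c" using M by (auto simp: c_def intro: add_nonneg_pos)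
  obtain L' where L': "\<forall>\<^sub>F n in flt 1. (tail L' T * C) $ n \<le> \<delta> / 3 / c * (T * C) $ n"
    using tightD[OF tight_T, of "\<delta> / 3 / c"] \<delta> c by auto
  have small: "H * small K \<preceq> fps_const c * T"
  proof -
    have "H * small K \<preceq> (fps_const M * T) * small K"
      by (intro fps_le_mult_right small_nonneg HT)
    also have "\<dots> = fps_const M * (T * small K)" by (rule mult.assoc)
    also have "\<dots> \<preceq> fps_const M * (fps_const (real K) * T)"
      using M by (intro fps_le_mult_left fps_nonneg_const T_small_le)
    also have "\<dots> = fps_const (M * real K) * T"
      by (simp add: mult.assoc[symmetric])
    also have "\<dots> \<preceq> fps_const c * T"
      by (intro fps_const_mult_le T_nonneg) (simp add: c_def)
    finally show ?thesis .
  qed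
  have 1: "tail L' (F * A 1) \<preceq> tail L F * A 1 + fps_const c * tail L' T + H * big K"
    unfolding fps_le_def
  proof
    fix n
    have "F * A 1 = tail L F * A 1 + H * A 1"
      unfolding H_def left_diff_distrib by simp
    also have "H * A 1 = H * small K + H * big K"
      unfolding A_1_split[of K] by (rule distrib_left)
    finally have "F * A 1 = tail L F * A 1 + H * small K + H * big K"
      by (simp only: add.assoc)
    then have "(F * A 1) $ n = (tail L F * A 1) $ n + (H * small K) $ n + (H * big K) $ n"
      by simp
    moreover have "0 \<le> (tail L F * A 1) $ n" "0 \<le> (H * big K) $ n" "0 \<le> T $ n"
      by (intro fps_nonneg_nth fps_nonneg_mult tail_nonneg nn A_nonneg H big_nonneg T_nonneg)+
    moreover have "(H * small K) $ n \<le> c * T $ n" using fps_leD[OF small, of n] by simp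
    ultimately show "tail L' (F * A 1) $ n \<le> (tail L F * A 1 + fps_const c * tail L' T + H * big K) $ n"
      by simp
  qed
  have 2: "tail L F * A 1 * C \<preceq> tail L F * C"
  proof -
    have "tail L F * A 1 * C = tail L F * (A 1 * C)" by (rule mult.assoc)
    also have "\<dots> \<preceq> tail L F * (A 0 * C)"
      by (intro fps_le_mult_left fps_le_mult_right tail_nonneg nn C_nonneg A_antimono) simp
    also have "\<dots> \<preceq> tail L F * C"
      by (intro fps_le_mult_left tail_nonneg nn A_0_C_le)
    finally show ?thesis .
  qed
  have 3: "H * big K * C \<preceq> fps_const (\<delta> / 3) * (T * C)"
  proof -
    have "H * big K * C = H * (big K * C)" by (rule mult.assoc)
    also have "\<dots> \<preceq> H * (fps_const (1 / (\<epsilon> * real K)) * C)"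
      by (intro fps_le_mult_left H big_C_le K)
    also have "\<dots> \<preceq> (fps_const M * T) * (fps_const (1 / (\<epsilon> * real K)) * C)"
      using eps by (intro fps_le_mult_right HT fps_nonneg_mult fps_nonneg_const C_nonneg) auto
    also have "\<dots> = fps_const (M / (\<epsilon> * real K)) * (T * C)"
    proof -
      have "fps_const (M / (\<epsilon> * real K)) = fps_const M * fps_const (1 / (\<epsilon> * real K))" by simp
      then show ?thesis by (simp only: ac_simps)
    qed
    also have "\<dots> \<preceq> fps_const (\<delta> / 3) * (T * C)"
      by (intro fps_const_mult_le K T_C_nonneg)
    finally show ?thesis .
  qed
  have "\<forall>\<^sub>F n in flt 1. (tail L F * C) $ n \<le> \<delta> / 3 * (T * C) $ n \<and>
      (tail L' T * C) $ n \<le> \<delta> / 3 / c * (T * C) $ n"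
    by (intro eventually_conj L L')
  then have "\<forall>\<^sub>F n in flt 1. (tail L' (F * A 1) * C) $ n \<le> \<delta> * (T * C) $ n"
  proof (rule eventually_mono)
    fix n assume n: "(tail L F * C) $ n \<le> \<delta> / 3 * (T * C) $ n \<and>
      (tail L' T * C) $ n \<le> \<delta> / 3 / c * (T * C) $ n"
    have "(tail L' (F * A 1) * C) $ n \<le> ((tail L F * A 1 + fps_const c * tail L' T + H * big K) * C) $ n"
      by (intro fps_leD fps_le_mult_right C_nonneg 1)
    also have "\<dots> = (tail L F * A 1 * C) $ n + c * (tail L' T * C) $ n + (H * big K * C) $ n"
      by (simp only: distrib_right fps_add_nth mult.assoc fps_mult_left_const_nth)
    also have "\<dots> \<le> \<delta> / 3 * (T * C) $ n + c * (\<delta> / 3 / c * (T * C) $ n) + \<delta> / 3 * (T * C) $ n"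
      using n c fps_leD[OF 2, of n] fps_leD[OF 3, of n]
      by (intro add_mono mult_left_mono) auto
    also have "\<dots> = \<delta> * (T * C) $ n" using c by simp
    finally show "(tail L' (F * A 1) * C) $ n \<le> \<delta> * (T * C) $ n" .
  qed
  then show "\<exists>L. \<forall>\<^sub>F n in flt 1. (tail L (F * A 1) * C) $ n \<le> \<delta> * (T * C) $ n" ..
qed

text \<open>For \<open>j \<le> R - 2\<close> the index \<open>R - 1 - j\<close> is at least 1, so
  that every factor is at most \<open>A 1\<close>; this is the reason for the range of
  \<open>h\<close>.\<close>

lemma tight_B: "h \<le> R - 2 \<Longrightarrow> tight (B R h)"
proof (induction h)
  case 0
  show ?case
    unfolding B_0 using D_antimono[of 0 R] by (intro tight_mono[OF tight_T] D_nonneg) auto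
next
  case (Suc h)
  show ?case
  proof (rule tight_mono[OF _ B_nonneg])
    show "tight (B R h * A 1)"
      using Suc by (intro tight_mult_A_1 B_supp) auto
    show "B R (Suc h) \<preceq> B R h * A 1"
      unfolding B_Suc using Suc.prems by (intro fps_le_mult_left B_nonneg A_antimono) auto
  qed
qed

text \<open>For \<open>n \<ge> L\<close> the coefficient \<open>F $ n\<close> belongs to the tail,
  and multiplication by \<open>C\<close> can only increase it because
  \<open>C $ 0 = 1\<close>.\<close>

lemma tight_nth_limit:
  assumes "tight F"
  shows "((\<lambda>n. F $ n / (T * C) $ n) \<longlongrightarrow> 0) (flt 1)"
proof (rule tendstoI)
  fix \<delta> :: real assume \<delta>: "0 < \<delta>"
  have nn: "0 \<preceq> F" using assms by (simp add: tight_def)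
  obtain L where L: "\<forall>\<^sub>F n in flt 1. (tail L F * C) $ n \<le> \<delta> / 2 * (T * C) $ n"
    using tightD[OF assms, of "\<delta> / 2"] \<delta> by auto
  have "\<forall>\<^sub>F n in flt 1. 0 < Z n 1 \<and> L \<le> n \<and> (tail L F * C) $ n \<le> \<delta> / 2 * (T * C) $ n"
    by (intro eventually_conj L eventually_flt_pos eventually_flt_ge)
  then show "\<forall>\<^sub>F n in flt 1. dist (F $ n / (T * C) $ n) 0 < \<delta>"
  proof (rule eventually_mono)
    fix n assume n: "0 < Z n 1 \<and> L \<le> n \<and> (tail L F * C) $ n \<le> \<delta> / 2 * (T * C) $ n"
    have "F $ n \<le> (tail L F * C) $ n"
      using fps_leD[OF le_mult_C[OF tail_nonneg[OF nn]], of L n] n by simp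
    then have "F $ n / (T * C) $ n \<le> \<delta> / 2"
      using n by (auto simp: Z_1 pos_divide_le_eq)
    moreover have "0 \<le> F $ n / (T * C) $ n"
      using n nn by (auto simp: Z_1 fps_le_def)
    ultimately show "dist (F $ n / (T * C) $ n) 0 < \<delta>"
      using \<delta> unfolding dist_real_def by linarith
  qed
qed

theorem pointed_limit:
  assumes S: "fps_ev (B R (R - 2)) (ennreal x) = ennreal (t * S)" "0 \<le> S"
  shows "((\<lambda>n. pointed R n / (T * C) $ n) \<longlongrightarrow> S) (flt 1)"
proof -
  have "(\<lambda>l. B R (R - 2) $ l * x ^ l) sums (t * S)"
  proof -
    have "fps_ev (B R (R - 2)) (ennreal x) \<noteq> top" by (simp add: S)
    from fps_ev_real[OF B_nonneg _ this] x_pos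
    have *: "summable (\<lambda>n. B R (R - 2) $ n * x ^ n)"
      "ennreal (t * S) = ennreal (\<Sum>n. B R (R - 2) $ n * x ^ n)"
      by (auto simp: S)
    moreover have "0 \<le> (\<Sum>n. B R (R - 2) $ n * x ^ n)"
      using *(1) x_pos B_nonneg[of R "R - 2"] by (intro suminf_nonneg) (auto simp: fps_le_def)
    ultimately show ?thesis using t_pos S(2) by (auto simp: sums_iff)
  qed
  then have "((\<lambda>n. (B R (R - 2) * C) $ n / (T * C) $ n) \<longlongrightarrow> S) (flt 1)"
    by (intro tight_limit tight_B B_supp) auto
  moreover have "((\<lambda>n. \<Sum>h<R - 2. B R h $ n / (T * C) $ n) \<longlongrightarrow> (\<Sum>h<R - 2. 0)) (flt 1)"
    by (intro tendsto_sum tight_nth_limit tight_B) auto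
  ultimately have "((\<lambda>n. (\<Sum>h<R - 2. B R h $ n / (T * C) $ n) + (B R (R - 2) * C) $ n / (T * C) $ n)
      \<longlongrightarrow> 0 + S) (flt 1)"
    by (intro tendsto_add) auto
  then show ?thesis
    by (simp add: pointed_eq add_divide_distrib sum_divide_distrib)
qed

end

section \<open>Zero radius of convergence\<close>

lemma conv_radius_0_unbounded:
  fixes w :: "nat \<Rightarrow> real"
  assumes "conv_radius w = 0" "\<And>k. 0 \<le> w k" "0 < a"
  shows "\<exists>k\<ge>N. a ^ k \<le> w k"
proof (rule ccontr)
  assume "\<not> ?thesis"
  then have lt: "w k < a ^ k" if "N \<le> k" for k using that by force
  have "summable (\<lambda>k. w k * (1 / (2 * a)) ^ k)"
  proof (rule summable_comparison_test')
    show "summable (\<lambda>k. (1 / 2) ^ k :: real)" by (rule summable_geometric) simp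
    fix k assume "N \<le> k"
    have "w k * (1 / (2 * a)) ^ k \<le> a ^ k * (1 / (2 * a)) ^ k"
      using lt[OF \<open>N \<le> k\<close>] assms(3) by (intro mult_right_mono) auto
    also have "\<dots> = (1 / 2) ^ k"
      using assms(3) by (simp flip: power_mult_distrib)
    finally show "norm (w k * (1 / (2 * a)) ^ k) \<le> (1 / 2) ^ k"
      using assms by simp
  qed
  from conv_radius_geI[OF this] assms show False by simp
qed

context weighted_trees
begin

lemma \<Phi>_ge_monomial: "fps_const (w b) * fps_X ^ b \<preceq> \<Phi>"
  by (auto simp: fps_le_def)

text \<open>The word with \<open>b\<close> letters \<open>k\<close> and \<open>k - b\<close> zeros
  has the same length and the same sum as \<open>k\<close> letters \<open>b\<close>.\<close>

lemma \<Phi>_power_ge: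
  assumes k: "b \<le> k"
  shows "fps_const (w k ^ b * w 0 ^ (k - b)) * fps_X ^ (b * k) \<preceq> \<Phi> ^ k"
proof -
  have "fps_const (w k ^ b * w 0 ^ (k - b)) * fps_X ^ (b * k) =
      (fps_const (w k) * fps_X ^ k) ^ b * (fps_const (w 0) * fps_X ^ 0) ^ (k - b)"
    unfolding power_0 mult_1_right power_mult_distrib fps_const_power fps_const_mult[symmetric]
      power_mult[symmetric] mult.commute[of k b] by (simp only: ac_simps)
  also have "\<dots> \<preceq> \<Phi> ^ b * \<Phi> ^ (k - b)"
    by (intro fps_le_mult fps_le_power \<Phi>_ge_monomial fps_nonneg_power fps_nonneg_mult
        fps_nonneg_const fps_nonneg_X) auto
  also have "\<dots> = \<Phi> ^ k"
    using k by (simp flip: power_add)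
  finally show ?thesis .
qed

text \<open>
  If the radius of convergence vanishes, a block of \<open>k\<close> letters \<open>b\<close> can be replaced by \<open>b\<close> letters \<open>k\<close>
  and \<open>k - b\<close> zeros, which increases the weight by an arbitrarily large exponential factor.
\<close>

lemma replace_letters:
  assumes radius: "conv_radius w = 0" and b: "0 < b" "0 < w b" and \<eta>: "0 < \<eta>" "\<eta> < 1"
  shows "\<exists>M>0. \<forall>n s j. j \<le> n \<longrightarrow> (fps_X ^ (b * j) * \<Phi> ^ (n - j)) $ s \<le> M * \<eta> ^ j * (\<Phi> ^ n) $ s"
proof -
  define c where "c = min 1 (w 0)"
  have c: "0 < c" "c \<le> 1" "c \<le> w 0" using w_0 by (auto simp: c_def)
  \<comment> \<open>The factor \<open>c\<close> compensates for the zeros, whose weight may be below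
    1; the aim is \<open>W \<ge> (1 / \<eta>) ^ k\<close>.\<close>
  define a where "a = 1 / (\<eta> * c)"
  have "\<eta> * c \<le> 1" using c \<eta> by (simp add: mult_le_one)
  then have a: "1 \<le> a" using c \<eta> by (simp add: a_def)
  obtain k where k: "b \<le> k" "a ^ k \<le> w k"
    using conv_radius_0_unbounded[OF radius, of a b] a by auto
  define W where "W = w k ^ b * w 0 ^ (k - b)"
  have W: "(1 / \<eta>) ^ k \<le> W"
  proof -
    have "(1 / \<eta>) ^ k = a ^ k * c ^ k"
      using c by (simp add: a_def flip: power_mult_distrib)
    also have "\<dots> \<le> (a ^ k) ^ b * c ^ (k - b)"
    proof (intro mult_mono)
      have "(a ^ k) ^ 1 \<le> (a ^ k) ^ b" using a b by (intro power_increasing) auto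
      then show "a ^ k \<le> (a ^ k) ^ b" by simp
      show "c ^ k \<le> c ^ (k - b)" using c by (intro power_decreasing) auto
    qed (use a c in auto)
    also have "\<dots> \<le> W"
      unfolding W_def using a c k by (intro mult_mono power_mono) auto
    finally show ?thesis .
  qed
  have W0: "0 < W" using W \<eta> by (smt (verit) zero_less_divide_1_iff zero_less_power)
  \<comment> \<open>Pays for the fewer than \<open>k\<close> letters \<open>b\<close> left over
    after forming blocks.\<close>
  define M where "M = (max 1 (1 / (\<eta> * w b))) ^ k"
  have M: "0 < M" by (simp add: M_def)
  have "(fps_X ^ (b * j) * \<Phi> ^ (n - j)) $ s \<le> M * \<eta> ^ j * (\<Phi> ^ n) $ s" if "j \<le> n" for n s j
  proof -
    define q where "q = j div k"
    define r where "r = j mod k"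
    have k0: "0 < k" using k b by simp
    have j: "j = k * q + r" "r < k" using k0 by (auto simp: q_def r_def)
    define Y where "Y = (fps_X ^ (b * j) * \<Phi> ^ (n - j)) $ s"
    have Y: "0 \<le> Y" unfolding Y_def
      by (intro fps_nonneg_nth fps_nonneg_mult fps_nonneg_power fps_nonneg_X \<Phi>_nonneg)
    have "fps_const (W ^ q * w b ^ r) * (fps_X ^ (b * j) * \<Phi> ^ (n - j)) =
        (fps_const W * fps_X ^ (b * k)) ^ q * (fps_const (w b) * fps_X ^ b) ^ r * \<Phi> ^ (n - j)"
    proof -
      have "(fps_X :: real fps) ^ (b * j) = (fps_X ^ (b * k)) ^ q * (fps_X ^ b) ^ r"
        unfolding j(1) by (simp only: distrib_left power_add power_mult[symmetric] mult.assoc)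
      moreover have "fps_const (W ^ q * w b ^ r) = fps_const W ^ q * fps_const (w b) ^ r"
        by (simp add: fps_const_power)
      ultimately show ?thesis by (simp only: power_mult_distrib ac_simps)
    qed
    also have "\<dots> \<preceq> (\<Phi> ^ k) ^ q * \<Phi> ^ r * \<Phi> ^ (n - j)"
      unfolding W_def
      by (intro fps_le_mult_right fps_le_mult fps_le_power \<Phi>_ge_monomial \<Phi>_power_ge k
          fps_nonneg_power fps_nonneg_mult fps_nonneg_const fps_nonneg_X \<Phi>_nonneg) auto
    also have "\<dots> = \<Phi> ^ (k * q + r + (n - j))"
      by (simp only: power_add power_mult)
    also have "k * q + r + (n - j) = n" using j that by simp
    finally have "W ^ q * w b ^ r * Y \<le> (\<Phi> ^ n) $ s"
      unfolding Y_def by (metis fps_leD fps_mult_left_const_nth)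
    moreover have "(1 / \<eta>) ^ (k * q) * w b ^ r * Y \<le> W ^ q * w b ^ r * Y"
      unfolding power_mult using W \<eta> Y by (intro mult_right_mono power_mono) auto
    ultimately have le: "(1 / \<eta>) ^ (k * q) * w b ^ r * Y \<le> (\<Phi> ^ n) $ s" by linarith
    have "(1 / (\<eta> * w b)) ^ r \<le> M"
    proof -
      have "(1 / (\<eta> * w b)) ^ r \<le> (max 1 (1 / (\<eta> * w b))) ^ r"
        using \<eta> b by (intro power_mono) auto
      also have "\<dots> \<le> M" unfolding M_def using j by (intro power_increasing) auto
      finally show ?thesis .
    qed
    have "Y = (1 / (\<eta> * w b)) ^ r * \<eta> ^ j * ((1 / \<eta>) ^ (k * q) * w b ^ r * Y)"
      using \<eta> b by (simp add: j(1) power_add power_divide power_mult_distrib)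
    also have "\<dots> \<le> M * \<eta> ^ j * (\<Phi> ^ n) $ s"
      using \<open>(1 / (\<eta> * w b)) ^ r \<le> M\<close> le \<eta> M Y b by (intro mult_mono) auto
    finally show ?thesis by (simp add: Y_def)
  qed
  with M show ?thesis by blast
qed

text \<open>Jensen with \<open>\<theta> = 1\<close>. In the binomial expansion a term with
  \<open>j\<close> selected letters is reduced by \<open>\<eta> ^ j\<close>, so the tilt enlarges
  the total weight by at most \<open>M * (1 + a * \<eta>) ^ n\<close>; the frequency is then at most
  about \<open>a * \<eta>\<close>, which is as small as desired.\<close>

lemma letter_limit_radius_0:
  assumes radius: "conv_radius w = 0" and b: "0 < b"
  shows "((\<lambda>n. w b * Z (n - 1) (c + int b - 1) / Z n c) \<longlongrightarrow> 0) (flt c)"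
proof (cases "0 < w b")
  case False
  then have "w b = 0" using w_nonneg[of b] by linarith
  then show ?thesis by simp
next
  case wb: True
  show ?thesis
  proof (rule tendstoI)
    fix \<delta> :: real assume \<delta>: "0 < \<delta>"
    define a where "a = (exp 1 - 1) * w b"
    have a: "0 < a" using wb by (simp add: a_def)
    define \<eta> where "\<eta> = min (1/2) (\<delta> / (4 * a))"
    have \<eta>: "0 < \<eta>" "\<eta> < 1" using \<delta> a by (auto simp: \<eta>_def)
    have "a * \<eta> \<le> a * (\<delta> / (4 * a))" using a by (intro mult_left_mono) (auto simp: \<eta>_def)
    then have a\<eta>: "a * \<eta> \<le> \<delta> / 4" using a by simp
    obtain M where M: "0 < M" "\<And>n s j. j \<le> n \<Longrightarrow>
        (fps_X ^ (b * j) * \<Phi> ^ (n - j)) $ s \<le> M * \<eta> ^ j * (\<Phi> ^ n) $ s"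
      using replace_letters[OF radius b wb \<eta>] by blast
    obtain N where N: "ln M / (\<delta> / 4) \<le> real N" using real_arch_simple by blast
    have "eventually (\<lambda>n. 0 < Z n c \<and> max 1 N \<le> n) (flt c)"
      by (intro eventually_conj eventually_flt_pos eventually_flt_ge)
    then show "\<forall>\<^sub>F n in flt c. dist (w b * Z (n - 1) (c + int b - 1) / Z n c) 0 < \<delta>"
    proof (rule eventually_mono)
      fix n assume "0 < Z n c \<and> max 1 N \<le> n"
      then have Zpos: "0 < Z n c" and n: "0 < n" "N \<le> n" by auto
      define r where "r = w b * Z (n - 1) (c + int b - 1) / Z n c"
      define s where "s = nat (int n - c)"
      have cn: "c \<le> int n" using Zpos by (auto simp: Z_def split: if_splits)
      have Zs: "Z n c = (\<Phi> ^ n) $ s" using cn by (simp add: Z_def s_def)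
      have r: "0 \<le> r" unfolding r_def using Zpos Z_nonneg by simp
      have "exp (1 * (real n * r)) * (\<Phi> ^ n) $ s \<le>
          ((\<Phi> + fps_const ((exp 1 - 1) * \<Phi> $ b) * fps_X ^ b) ^ n) $ s"
      proof (rule fps_power_tilt[OF \<Phi>_nonneg n(1)])
        show "real n * r = real n * \<Phi> $ b * (fps_X ^ b * \<Phi> ^ (n - 1)) $ s / (\<Phi> ^ n) $ s"
          unfolding s_def Z_shift[OF n(1) cn] r_def Zs by (simp add: s_def)
      qed (use Zpos Zs in simp)
      also have "(\<Phi> + fps_const ((exp 1 - 1) * \<Phi> $ b) * fps_X ^ b) ^ n =
          (\<Sum>j\<le>n. of_nat (n choose j) * (fps_const a * fps_X ^ b) ^ j * \<Phi> ^ (n - j))"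
        by (subst add.commute, subst binomial_ring) (simp add: a_def)
      also have "\<dots> $ s = (\<Sum>j\<le>n. real (n choose j) * a ^ j * (fps_X ^ (b * j) * \<Phi> ^ (n - j)) $ s)"
        unfolding fps_sum_nth
      proof (intro sum.cong refl)
        fix j
        have "of_nat (n choose j) * (fps_const a * fps_X ^ b) ^ j * \<Phi> ^ (n - j) =
            fps_const (real (n choose j) * a ^ j) * (fps_X ^ (b * j) * \<Phi> ^ (n - j))"
          by (simp add: power_mult_distrib power_mult fps_const_power ac_simps flip: fps_of_nat fps_const_mult)
        then show "(of_nat (n choose j) * (fps_const a * fps_X ^ b) ^ j * \<Phi> ^ (n - j)) $ s =
            real (n choose j) * a ^ j * (fps_X ^ (b * j) * \<Phi> ^ (n - j)) $ s"
          by (simp only: fps_mult_left_const_nth)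
      qed
      also have "\<dots> \<le> (\<Sum>j\<le>n. real (n choose j) * a ^ j * (M * \<eta> ^ j * (\<Phi> ^ n) $ s))"
        using a by (intro sum_mono mult_left_mono M) auto
      also have "\<dots> = M * (\<Phi> ^ n) $ s * (\<Sum>j\<le>n. of_nat (n choose j) * (a * \<eta>) ^ j * 1 ^ (n - j))"
        by (simp add: sum_distrib_left power_mult_distrib ac_simps)
      also have "\<dots> = M * (\<Phi> ^ n) $ s * (a * \<eta> + 1) ^ n"
        by (simp only: binomial_ring)
      finally have "exp (real n * r) * Z n c \<le> (M * (a * \<eta> + 1) ^ n) * Z n c"
        by (simp add: Zs ac_simps)
      then have "exp (real n * r) \<le> M * (a * \<eta> + 1) ^ n"
        using Zpos by simp
      also have "\<dots> \<le> M * exp (a * \<eta>) ^ n"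
        using M a \<eta> exp_ge_add_one_self[of "a * \<eta>"] by (intro mult_left_mono power_mono) (auto simp: add.commute)
      also have "\<dots> = exp (ln M + real n * (a * \<eta>))"
        using M by (simp add: exp_add exp_of_nat_mult)
      finally have "real n * r \<le> ln M + real n * (a * \<eta>)" by simp
      moreover have "ln M \<le> real n * (\<delta> / 4)"
      proof -
        have "ln M / (\<delta> / 4) \<le> real n" using N n by linarith
        then show ?thesis using \<delta> by (subst (asm) pos_divide_le_eq) auto
      qed
      moreover have "real n * (a * \<eta>) \<le> real n * (\<delta> / 4)"
        by (intro mult_left_mono a\<eta>) auto
      ultimately have "real n * r \<le> real n * (\<delta> / 2)" by (simp add: algebra_simps)
      then have "r \<le> \<delta> / 2" using n by simp
      then show "dist (w b * Z (n - 1) (c + int b - 1) / Z n c) 0 < \<delta>"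
        unfolding r_def[symmetric] using \<delta> r by simp
    qed
  qed
qed

text \<open>Each of the letters 1 to \<open>K\<close> has vanishing frequency, and the letters above
  \<open>K\<close> have total frequency at most \<open>1 / K\<close> by Markov's inequality, as the
  mean letter is at most 1. The letter 0 takes the rest.\<close>

lemma leaf_fraction_limit_radius_0:
  assumes radius: "conv_radius w = 0"
  shows "((\<lambda>n. w 0 * (fps_X * C) $ n / (T * C) $ n) \<longlongrightarrow> 1) (flt 1)"
proof (rule tendstoI)
  fix \<delta> :: real assume \<delta>: "0 < \<delta>"
  define r where "r b n = w b * Z (n - 1) (1 + int b - 1) / Z n 1" for b n
  obtain K :: nat where K: "2 / \<delta> < real K" using reals_Archimedean2 by blast
  have K0: "0 < real K" using K \<delta> by (smt (verit) divide_pos_pos)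
  have "((\<lambda>n. \<Sum>b=1..K. r b n) \<longlongrightarrow> (\<Sum>b=1..K. 0)) (flt 1)"
    unfolding r_def by (intro tendsto_sum letter_limit_radius_0 radius) auto
  then have "\<forall>\<^sub>F n in flt 1. (\<Sum>b=1..K. r b n) < \<delta> / 2"
    using \<delta> by (intro order_tendstoD(2)[where y = 0]) auto
  then have "\<forall>\<^sub>F n in flt 1. 0 < Z n 1 \<and> 1 \<le> n \<and> (\<Sum>b=1..K. r b n) < \<delta> / 2"
    by (intro eventually_conj eventually_flt_pos eventually_flt_ge)
  then show "\<forall>\<^sub>F n in flt 1. dist (w 0 * (fps_X * C) $ n / (T * C) $ n) 1 < \<delta>"
  proof (rule eventually_mono)
    fix n assume n': "0 < Z n 1 \<and> 1 \<le> n \<and> (\<Sum>b=1..K. r b n) < \<delta> / 2"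
    define s where "s = n - 1"
    have n: "n = Suc s" using n' by (simp add: s_def)
    have Zn: "Z n 1 = (\<Phi> ^ n) $ s" by (simp add: Z_def n)
    have r: "r b n = w b * (\<Phi> ^ s) $ (s - b) / (\<Phi> ^ n) $ s" if "b \<le> s" for b
      using that by (simp add: r_def Zn Z_def n nat_diff_distrib)
    have r0: "0 \<le> r b n" for b using n' Z_nonneg by (simp add: r_def)
    have "(\<Phi> ^ n) $ s = (\<Sum>b\<le>s. w b * (\<Phi> ^ s) $ (s - b))"
      by (simp add: n fps_mult_nth atLeast0AtMost)
    then have "(\<Sum>b\<le>s. r b n) * (\<Phi> ^ n) $ s = (\<Phi> ^ n) $ s"
      using n' by (simp add: r Zn sum_divide_distrib[symmetric])
    then have total: "(\<Sum>b\<le>s. r b n) = 1" using n' Zn by simp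
    have "real s * (\<Phi> ^ n) $ s = real n * (\<Sum>b\<le>s. real b * w b * (\<Phi> ^ s) $ (s - b))"
      using fps_power_mean_identity[of s \<Phi> n] by (simp add: n)
    also have "(\<Sum>b\<le>s. real b * w b * (\<Phi> ^ s) $ (s - b)) = (\<Sum>b\<le>s. real b * r b n) * (\<Phi> ^ n) $ s"
      using n' by (simp add: r Zn sum_distrib_right mult.assoc)
    finally have "real s = real n * (\<Sum>b\<le>s. real b * r b n)" using n' Zn by simp
    then have "real n * (\<Sum>b\<le>s. real b * r b n) \<le> real n * 1" by (simp add: n)
    then have mean: "(\<Sum>b\<le>s. real b * r b n) \<le> 1" by (rule mult_left_le_imp_le) (simp add: n)
    have "(\<Sum>b\<le>s. r b n) \<le> (\<Sum>b\<le>s. (if b = 0 then r 0 n else 0) + (if b \<in> {1..K} then r b n else 0)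
        + 1 / real K * (real b * r b n))"
    proof (rule sum_mono)
      fix b
      have "r b n \<le> 1 / real K * (real b * r b n)" if "K < b"
      proof -
        have "1 * r b n \<le> (1 / real K * real b) * r b n"
          using that K0 r0 by (intro mult_right_mono) (auto simp: field_simps)
        then show ?thesis by (simp only: mult_1 mult.assoc)
      qed
      moreover have "0 \<le> 1 / real K * (real b * r b n)" using r0 by simp
      ultimately show "r b n \<le> (if b = 0 then r 0 n else 0) + (if b \<in> {1..K} then r b n else 0)
          + 1 / real K * (real b * r b n)"
        using r0[of b] by (cases "b = 0"; cases "b \<le> K") auto
    qed
    also have "\<dots> = r 0 n + (\<Sum>b\<le>s. if b \<in> {1..K} then r b n else 0) + 1 / real K * (\<Sum>b\<le>s. real b * r b n)"
      by (simp add: sum.distrib sum_distrib_left)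
    also have "(\<Sum>b\<le>s. if b \<in> {1..K} then r b n else 0) \<le> (\<Sum>b=1..K. r b n)"
      using r0 by (subst sum.inter_restrict[symmetric]) (auto intro: sum_mono2)
    also have "1 / real K * (\<Sum>b\<le>s. real b * r b n) \<le> 1 / real K * 1"
      by (intro mult_left_mono mean) auto
    finally have "1 \<le> r 0 n + (\<Sum>b=1..K. r b n) + 1 / real K"
      using total by simp
    moreover have "1 / real K < \<delta> / 2" using K \<delta> K0 by (simp add: field_simps)
    moreover have "r 0 n \<le> (\<Sum>b\<le>s. r b n)" using r0 by (intro member_le_sum) auto
    moreover have "r 0 n = w 0 * (fps_X * C) $ n / (T * C) $ n"
      by (simp add: r_def Z_1 Z_0 n)
    ultimately show "dist (w 0 * (fps_X * C) $ n / (T * C) $ n) 1 < \<delta>"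
      using n' total unfolding dist_real_def by linarith
  qed
qed

text \<open>For \<open>R > 0\<close> the marked vertex is not a leaf, whereas asymptotically almost
  all vertices are.\<close>

lemma pointed_limit_radius_0:
  assumes radius: "conv_radius w = 0" and "0 < R"
  shows "((\<lambda>n. pointed R n / (T * C) $ n) \<longlongrightarrow> 0) (flt 1)"
proof (rule tendsto_sandwich[where f = "\<lambda>_. 0" and
      h = "\<lambda>n. 1 - w 0 * (fps_X * C) $ n / (T * C) $ n"])
  have "((\<lambda>n. 1 - w 0 * (fps_X * C) $ n / (T * C) $ n) \<longlongrightarrow> 1 - 1) (flt 1)"
    by (intro tendsto_diff tendsto_const leaf_fraction_limit_radius_0 radius)
  then show "((\<lambda>n. 1 - w 0 * (fps_X * C) $ n / (T * C) $ n) \<longlongrightarrow> 0) (flt 1)" by simp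
  show "\<forall>\<^sub>F n in flt 1. pointed R n / (T * C) $ n \<le> 1 - w 0 * (fps_X * C) $ n / (T * C) $ n"
    using eventually_flt_pos
  proof (rule eventually_mono)
    fix n assume n: "0 < Z n 1"
    have "pointed R n \<le> (D R * C) $ n" by (rule pointed_le)
    also have "\<dots> \<le> (D 1 * C) $ n"
      using \<open>0 < R\<close> by (intro fps_leD fps_le_mult_right C_nonneg D_antimono) simp
    also have "\<dots> = (T * C) $ n - w 0 * (fps_X * C) $ n"
      unfolding D_1 by (simp only: left_diff_distrib fps_sub_nth mult.assoc fps_mult_left_const_nth)
    finally have "pointed R n / (T * C) $ n \<le> ((T * C) $ n - w 0 * (fps_X * C) $ n) / (T * C) $ n"
      using n by (intro divide_right_mono) (auto simp: Z_1)
    then show "pointed R n / (T * C) $ n \<le> 1 - w 0 * (fps_X * C) $ n / (T * C) $ n"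
      using n by (simp add: Z_1 diff_divide_distrib)
  qed
  show "\<forall>\<^sub>F n in flt 1. 0 \<le> pointed R n / (T * C) $ n"
    by (intro always_eventually allI divide_nonneg_nonneg pointed_nonneg fps_nonneg_nth T_C_nonneg)
qed simp

end

section \<open>The offspring law\<close>

text \<open>
  \<open>surv \<xi> k\<close> is the probability that the Galton--Watson tree has no leaf of depth less than \<open>k\<close>,
  and \<open>side \<xi> y\<close> the probability that all siblings on the spine satisfy a property
  of probability \<open>y < 1\<close>; infinitely many siblings contribute \<open>0\<close>.
\<close>

fun surv :: "nat pmf \<Rightarrow> nat \<Rightarrow> ennreal" where
  "surv \<xi> 0 = 1"
| "surv \<xi> (Suc k) = (\<integral>\<^sup>+ j. (if j = 0 then 0 else surv \<xi> k ^ j) \<partial>measure_pmf \<xi>)"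

definition side :: "nat pmf \<Rightarrow> ennreal \<Rightarrow> ennreal" where
  "side \<xi> y = (\<integral>\<^sup>+ j. of_nat j * y ^ (j - 1) \<partial>measure_pmf \<xi>)"

text \<open>The siblings at ancestor \<open>j\<close> are at distance \<open>j + 1\<close> from the
  marked vertex, so ancestors beyond \<open>R - 2\<close> impose no condition. The product has to
  stop there: another factor \<open>side \<xi> 1\<close> would be the mean, which is less than 1 in
  type II.\<close>

definition limit_tail :: "nat pmf \<Rightarrow> nat \<Rightarrow> ennreal" where
  "limit_tail \<xi> R = surv \<xi> R * (\<Prod>j=1..R - 2. side \<xi> (surv \<xi> (R - 1 - j)))"

lemma ennreal_mult3:
  "0 \<le> a \<Longrightarrow> 0 \<le> b \<Longrightarrow> 0 \<le> c \<Longrightarrow> ennreal a * ennreal b * ennreal c = ennreal (a * b * c)"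
  by (simp add: ennreal_mult)

lemma ennreal_power_le_self: "(x :: ennreal) \<le> 1 \<Longrightarrow> 0 < j \<Longrightarrow> x ^ j \<le> x"
  using power_decreasing[of 1 j x] by simp

lemma ennreal_power_le_one: "(x :: ennreal) \<le> 1 \<Longrightarrow> x ^ j \<le> 1"
  using power_decreasing[of 0 j x] by simp

lemma surv_Suc_le:
  assumes "surv \<xi> k \<le> 1"
  shows "surv \<xi> (Suc k) \<le> ennreal (1 - pmf \<xi> 0) * surv \<xi> k"
proof -
  have "surv \<xi> (Suc k) \<le> (\<integral>\<^sup>+ j. surv \<xi> k * indicator (- {0}) j \<partial>measure_pmf \<xi>)"
    unfolding surv.simps using assms
    by (intro nn_integral_mono) (auto simp: ennreal_power_le_self split: split_indicator)
  also have "\<dots> = surv \<xi> k * emeasure (measure_pmf \<xi>) (- {0})"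
    by (rule nn_integral_cmult_indicator) simp
  also have "emeasure (measure_pmf \<xi>) (- {0}) = ennreal (1 - pmf \<xi> 0)"
    using measure_pmf.prob_compl[of "{0}" \<xi>]
    by (simp add: measure_pmf.emeasure_eq_measure measure_pmf_single Compl_eq_Diff_UNIV)
  finally show ?thesis by (simp add: mult.commute)
qed

lemma surv_le: "surv \<xi> k \<le> ennreal ((1 - pmf \<xi> 0) ^ k)"
proof (induction k)
  case (Suc k)
  have nn: "0 \<le> 1 - pmf \<xi> 0" by (simp add: pmf_le_1)
  have "(1 - pmf \<xi> 0) ^ k \<le> 1" using nn by (intro power_le_one) auto
  then have "surv \<xi> k \<le> 1" using Suc by (metis ennreal_1 ennreal_leI order_trans)
  from surv_Suc_le[OF this] have "surv \<xi> (Suc k) \<le> ennreal (1 - pmf \<xi> 0) * surv \<xi> k" .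
  also have "\<dots> \<le> ennreal (1 - pmf \<xi> 0) * ennreal ((1 - pmf \<xi> 0) ^ k)"
    by (intro mult_left_mono Suc) auto
  finally show ?case using nn by (simp add: ennreal_mult)
qed simp

lemma surv_le_1: "surv \<xi> k \<le> 1"
proof -
  have "(1 - pmf \<xi> 0) ^ k \<le> 1" by (intro power_le_one) (auto simp: pmf_le_1)
  then show ?thesis using surv_le[of \<xi> k] by (metis ennreal_1 ennreal_leI order_trans)
qed

lemma surv_less_1: "0 < pmf \<xi> 0 \<Longrightarrow> 0 < k \<Longrightarrow> surv \<xi> k < 1"
proof -
  assume "0 < pmf \<xi> 0" "0 < k"
  then have "(1 - pmf \<xi> 0) ^ k < 1" by (intro power_less_one_iff[THEN iffD2]) (auto simp: pmf_le_1)
  then have "ennreal ((1 - pmf \<xi> 0) ^ k) < 1"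
    using ennreal_less_iff[of "(1 - pmf \<xi> 0) ^ k" 1] by (simp add: pmf_le_1)
  then show ?thesis using surv_le[of \<xi> k] by (rule le_less_trans[rotated])
qed

context tilted_trees
begin

lemma G_gen_fun: "G = gen_fun w t"
  by (simp add: G_def gen_fun_def)

lemma pmf_tilted: "pmf (tilted_pmf w t) k = p k"
proof -
  have "(\<integral>\<^sup>+ k. ennreal (p k) \<partial>count_space UNIV) = 1"
    using p_nonneg p_sums by (simp add: nn_integral_count_space_nat suminf_ennreal2 sums_iff)
  then show ?thesis
    unfolding tilted_pmf_def G_gen_fun[symmetric] p_def[symmetric]
    by (intro pmf_embed_pmf p_nonneg)
qed

lemma nn_integral_tilted:
  "(\<integral>\<^sup>+ j. f j \<partial>measure_pmf (tilted_pmf w t)) = (\<Sum>j. ennreal (p j) * f j)"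
  by (simp add: nn_integral_measure_pmf pmf_tilted nn_integral_count_space_nat)

text \<open>At \<open>x = t / G\<close> a root with \<open>j\<close> subtrees of value
  \<open>t * q\<close> contributes \<open>x * w j * (t * q) ^ j = t * p j * q ^ j\<close>, which is
  the recursion of \<open>surv\<close>.\<close>

lemma fps_ev_D: "fps_ev (D k) (ennreal x) = ennreal t * surv (tilted_pmf w t) k"
proof (induction k)
  case 0
  then show ?case by (simp add: fps_ev_T_eq)
next
  case (Suc k)
  let ?q = "surv (tilted_pmf w t) k"
  have "fps_ev (D (Suc k)) (ennreal x) = ennreal x * fps_ev (\<Phi> - fps_const (w 0)) (ennreal t * ?q)"
    by (simp add: D.simps fps_ev_mult fps_nonneg_compose \<Phi>_minus_nonneg D_nonneg fps_ev_compose Suc)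
  also have "\<dots> = (\<Sum>j. ennreal x * (ennreal ((\<Phi> - fps_const (w 0)) $ j) * (ennreal t * ?q) ^ j))"
    unfolding fps_ev_def by simp
  also have "\<dots> = (\<Sum>j. ennreal t * (ennreal (p j) * (if j = 0 then 0 else ?q ^ j)))"
  proof (rule suminf_cong)
    fix j
    have "ennreal x * (ennreal (w j) * (ennreal t * ?q) ^ j) = (ennreal x * ennreal (w j) * ennreal (t ^ j)) * ?q ^ j"
      using t_pos by (simp add: power_mult_distrib ennreal_power ac_simps)
    also have "ennreal x * ennreal (w j) * ennreal (t ^ j) = ennreal (x * w j * t ^ j)"
      using x_pos t_pos by (intro ennreal_mult3) auto
    also have "x * w j * t ^ j = t * p j" by (simp add: p_def)
    also have "ennreal (t * p j) = ennreal t * ennreal (p j)"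
      using t_pos p_nonneg by (simp add: ennreal_mult)
    finally show "ennreal x * (ennreal ((\<Phi> - fps_const (w 0)) $ j) * (ennreal t * ?q) ^ j) =
        ennreal t * (ennreal (p j) * (if j = 0 then 0 else ?q ^ j))"
      by (cases "j = 0") (simp_all add: mult.assoc)
  qed
  also have "\<dots> = ennreal t * surv (tilted_pmf w t) (Suc k)"
    by (simp add: nn_integral_tilted)
  finally show ?case .
qed

text \<open>The subtree on the path is missing, so one factor \<open>t\<close> is lost:
  \<open>x * (j + 1) * w (j + 1) * t ^ j = (j + 1) * p (j + 1)\<close>, the size-biased law.\<close>

lemma fps_ev_A: "fps_ev (A i) (ennreal x) = side (tilted_pmf w t) (surv (tilted_pmf w t) i)"
proof -
  let ?q = "surv (tilted_pmf w t) i"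
  have "fps_ev (A i) (ennreal x) = ennreal x * fps_ev (fps_deriv \<Phi>) (ennreal t * ?q)"
    by (simp add: A_def fps_ev_mult fps_nonneg_compose deriv_\<Phi>_nonneg D_nonneg fps_ev_compose fps_ev_D)
  also have "\<dots> = (\<Sum>j. ennreal x * (ennreal (fps_deriv \<Phi> $ j) * (ennreal t * ?q) ^ j))"
    unfolding fps_ev_def by simp
  also have "\<dots> = (\<Sum>j. ennreal (p (Suc j)) * (of_nat (Suc j) * ?q ^ j))"
  proof (rule suminf_cong)
    fix j
    have "ennreal x * (ennreal (fps_deriv \<Phi> $ j) * (ennreal t * ?q) ^ j) =
        (ennreal x * ennreal (fps_deriv \<Phi> $ j) * ennreal (t ^ j)) * ?q ^ j"
      using t_pos by (simp add: power_mult_distrib ennreal_power ac_simps)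
    also have "ennreal x * ennreal (fps_deriv \<Phi> $ j) * ennreal (t ^ j) = ennreal (x * fps_deriv \<Phi> $ j * t ^ j)"
      using x_pos t_pos by (intro ennreal_mult3) auto
    also have "x * fps_deriv \<Phi> $ j * t ^ j = p (Suc j) * real (Suc j)"
      by (simp add: p_def)
    also have "ennreal (p (Suc j) * real (Suc j)) = ennreal (p (Suc j)) * of_nat (Suc j)"
      using p_nonneg by (simp add: ennreal_mult ennreal_of_nat_eq_real_of_nat)
    finally show "ennreal x * (ennreal (fps_deriv \<Phi> $ j) * (ennreal t * ?q) ^ j) =
        ennreal (p (Suc j)) * (of_nat (Suc j) * ?q ^ j)"
      by (simp only: mult.assoc)
  qed
  also have "\<dots> = (\<Sum>j. ennreal (p j) * (of_nat j * ?q ^ (j - 1)))"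
  proof -
    have "(\<lambda>j. ennreal (p (Suc j)) * (of_nat (Suc j) * ?q ^ j)) sums
        (\<Sum>j. ennreal (p (Suc j)) * (of_nat (Suc j) * ?q ^ j))"
      by (rule summable_sums) simp
    then have "(\<lambda>j. ennreal (p (Suc j)) * (of_nat (Suc j) * ?q ^ (Suc j - 1))) sums
        (\<Sum>j. ennreal (p (Suc j)) * (of_nat (Suc j) * ?q ^ j))"
      by simp
    from sums_Suc[OF this] show ?thesis by (simp add: sums_iff)
  qed
  also have "\<dots> = side (tilted_pmf w t) ?q"
    by (simp add: side_def nn_integral_tilted)
  finally show ?thesis .
qed

lemma mean_sums: "(\<lambda>k. real k * p k) sums ((\<Sum>k. real k * w k * t ^ k) / G)"
  using sums_divide[OF summable_sums[OF summable_mean], of G] by (simp add: p_def mult.assoc)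

lemma mean_le_1: "(\<Sum>k. real k * w k * t ^ k) / G \<le> 1"
  using mean_le G_pos by (simp add: G_def[symmetric])

lemma nn_mean: "(\<integral>\<^sup>+ j. ennreal (real j) \<partial>measure_pmf (tilted_pmf w t)) =
    ennreal ((\<Sum>k. real k * w k * t ^ k) / G)"
proof -
  have "(\<integral>\<^sup>+ j. ennreal (real j) \<partial>measure_pmf (tilted_pmf w t)) = (\<Sum>j. ennreal (real j * p j))"
    using p_nonneg by (simp add: nn_integral_tilted ennreal_mult mult.commute)
  also have "\<dots> = ennreal ((\<Sum>k. real k * w k * t ^ k) / G)"
    using mean_sums p_nonneg by (subst suminf_ennreal2) (auto simp: sums_iff)
  finally show ?thesis .
qed

lemma fps_ev_B: "fps_ev (B R (R - 2)) (ennreal x) = ennreal t * limit_tail (tilted_pmf w t) R"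
  unfolding B_def limit_tail_def
  by (simp add: fps_ev_mult D_nonneg fps_nonneg_prod A_nonneg fps_ev_prod fps_ev_A fps_ev_D mult.assoc)

lemma side_le_1:
  assumes "y \<le> 1"
  shows "side (tilted_pmf w t) y \<le> 1"
proof -
  have "side (tilted_pmf w t) y \<le> (\<integral>\<^sup>+ j. ennreal (real j) \<partial>measure_pmf (tilted_pmf w t))"
    unfolding side_def
    using mult_left_mono[OF ennreal_power_le_one[OF assms]]
    by (intro nn_integral_mono) (metis ennreal_of_nat_eq_real_of_nat mult.right_neutral zero_le)
  also have "\<dots> \<le> 1"
    unfolding nn_mean using mean_le_1 by (metis ennreal_1 ennreal_leI)
  finally show ?thesis .
qed

lemma limit_tail_le_1: "limit_tail (tilted_pmf w t) R \<le> 1"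
proof -
  have "(\<Prod>j=1..R - 2. side (tilted_pmf w t) (surv (tilted_pmf w t) (R - 1 - j))) \<le> 1"
    by (intro prod_le_1 conjI side_le_1 surv_le_1) auto
  then show ?thesis
    unfolding limit_tail_def using mult_mono[OF surv_le_1] by (metis mult_1 zero_le)
qed

end

lemma (in tilted_trees_leaf) pointed_limit_tail:
  "((\<lambda>n. pointed R n / (T * C) $ n) \<longlongrightarrow> enn2real (limit_tail (tilted_pmf w t) R)) (flt 1)"
proof (rule pointed_limit)
  have "limit_tail (tilted_pmf w t) R < top"
    using limit_tail_le_1 by (rule le_less_trans) simp
  then show "fps_ev (B R (R - 2)) (ennreal x) = ennreal (t * enn2real (limit_tail (tilted_pmf w t) R))"
    using t_pos by (simp add: fps_ev_B ennreal_mult)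
qed simp

section \<open>The three types exhaust all weight sequences\<close>

lemma summable_diffs_iff:
  fixes w :: "nat \<Rightarrow> real"
  assumes "0 < t"
  shows "(\<lambda>k. diffs w k * t ^ k) sums s \<longleftrightarrow> (\<lambda>k. real k * w k * t ^ k) sums (t * s)"
proof -
  have "(\<lambda>k. real k * w k * t ^ k) sums (t * s) \<longleftrightarrow>
      (\<lambda>k. real (Suc k) * w (Suc k) * t ^ Suc k) sums (t * s)"
    using sums_Suc_iff[of "\<lambda>k. real k * w k * t ^ k" "t * s"] by simp
  also have "(\<lambda>k. real (Suc k) * w (Suc k) * t ^ Suc k) = (\<lambda>k. t * (diffs w k * t ^ k))"
    by (auto simp: diffs_def algebra_simps)
  also have "(\<lambda>k. t * (diffs w k * t ^ k)) sums (t * s) \<longleftrightarrow> (\<lambda>k. diffs w k * t ^ k) sums s"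
    using assms by (intro sums_mult_iff) auto
  finally show ?thesis ..
qed

context weighted_trees
begin

lemma gen_fun_pos:
  assumes "0 < t" "summable (\<lambda>k. w k * t ^ k)"
  shows "0 < gen_fun w t"
  unfolding gen_fun_def using w_0 assms by (intro suminf_pos2[OF assms(2), of 0]) auto

lemma mean_iff:
  assumes "0 < t" "summable (\<lambda>k. w k * t ^ k)"
  shows "summable (\<lambda>k. diffs w k * t ^ k) \<longleftrightarrow> summable (\<lambda>k. real k * w k * t ^ k)"
    and "summable (\<lambda>k. diffs w k * t ^ k) \<Longrightarrow>
      t * gen_fun_deriv w t / gen_fun w t = (\<Sum>k. real k * w k * t ^ k) / (\<Sum>k. w k * t ^ k)"
proof -
  show "summable (\<lambda>k. diffs w k * t ^ k) \<longleftrightarrow> summable (\<lambda>k. real k * w k * t ^ k)"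
  proof
    assume "summable (\<lambda>k. diffs w k * t ^ k)"
    then show "summable (\<lambda>k. real k * w k * t ^ k)"
      using summable_diffs_iff[OF assms(1), of w] unfolding summable_def by blast
  next
    assume "summable (\<lambda>k. real k * w k * t ^ k)"
    then obtain a where "(\<lambda>k. real k * w k * t ^ k) sums a" by (auto simp: summable_def)
    then have "(\<lambda>k. real k * w k * t ^ k) sums (t * (a / t))" using assms by simp
    then show "summable (\<lambda>k. diffs w k * t ^ k)"
      using summable_diffs_iff[OF assms(1), of w "a / t"] unfolding summable_def by blast
  qed
  assume "summable (\<lambda>k. diffs w k * t ^ k)"
  then have "(\<lambda>k. real k * w k * t ^ k) sums (t * gen_fun_deriv w t)"
    unfolding gen_fun_deriv_def using summable_diffs_iff[OF assms(1), of w] summable_sums by blast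
  then show "t * gen_fun_deriv w t / gen_fun w t = (\<Sum>k. real k * w k * t ^ k) / (\<Sum>k. w k * t ^ k)"
    by (simp add: sums_iff gen_fun_def)
qed

lemma tilted_if_type_I:
  assumes "type_I_at w t"
  shows "tilted_trees w T t"
proof
  show t: "0 < t" and s: "summable (\<lambda>k. w k * t ^ k)"
    using assms by (auto simp: type_I_at_def)
  show "summable (\<lambda>k. real k * w k * t ^ k)"
    using assms mean_iff(1)[OF t s] by (auto simp: type_I_at_def)
  have "(\<Sum>k. real k * w k * t ^ k) / (\<Sum>k. w k * t ^ k) = 1"
    using assms mean_iff(2)[OF t s] by (auto simp: type_I_at_def)
  then have "(\<Sum>k. real k * w k * t ^ k) = (\<Sum>k. w k * t ^ k)"
    using gen_fun_pos[OF t s] by (simp add: gen_fun_def)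
  then show "(\<Sum>k. real k * w k * t ^ k) \<le> (\<Sum>k. w k * t ^ k)"
    "(\<Sum>k. real k * w k * t ^ k) = (\<Sum>k. w k * t ^ k) \<or> (\<forall>s>t. \<not> summable (\<lambda>k. w k * s ^ k))"
    by auto
qed

lemma tilted_if_type_II:
  assumes "type_II_at w t"
  shows "tilted_trees w T t"
proof
  show t: "0 < t" and s: "summable (\<lambda>k. w k * t ^ k)"
    using assms by (auto simp: type_II_at_def)
  show "summable (\<lambda>k. real k * w k * t ^ k)"
    using assms mean_iff(1)[OF t s] by (auto simp: type_II_at_def)
  have "(\<Sum>k. real k * w k * t ^ k) / (\<Sum>k. w k * t ^ k) < 1"
    using assms mean_iff(2)[OF t s] by (auto simp: type_II_at_def)
  then show "(\<Sum>k. real k * w k * t ^ k) \<le> (\<Sum>k. w k * t ^ k)"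
    using gen_fun_pos[OF t s] by (simp add: gen_fun_def)
  have "\<not> summable (\<lambda>k. w k * s ^ k)" if "t < s" for s
  proof
    assume "summable (\<lambda>k. w k * s ^ k)"
    from conv_radius_geI[OF this] show False
      using assms that t by (auto simp: type_II_at_def)
  qed
  then show "(\<Sum>k. real k * w k * t ^ k) = (\<Sum>k. w k * t ^ k) \<or> (\<forall>s>t. \<not> summable (\<lambda>k. w k * s ^ k))"
    by blast
qed

text \<open>The function \<open>H(t) = t * \<Phi>'(t) - \<Phi>(t)\<close> starts at
  \<open>- w 0 < 0\<close>, and a zero inside the interval of convergence would give type I; so
  \<open>H < 0\<close> there, which bounds the sum of \<open>k * w (k + 1) * t ^ (k + 1)\<close> by
  \<open>w 0\<close>. An infinite radius contradicts this bound; at a finite radius the bound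
  persists and gives type I or II.\<close>

lemma type_III_if_not_type_I_II:
  assumes nI: "\<not> (\<exists>t. type_I_at w t)" and nII: "\<not> (\<exists>t. type_II_at w t)"
  shows "conv_radius w = 0"
proof (rule ccontr)
  assume "conv_radius w \<noteq> 0"
  then have R0: "0 < conv_radius w"
    using conv_radius_nonneg[of w] by (simp add: less_le)
  have sm: "summable (\<lambda>k. w k * t ^ k)" "summable (\<lambda>k. real k * w k * t ^ k)"
    if "0 < t" "ereal t < conv_radius w" for t
  proof -
    show s: "summable (\<lambda>k. w k * t ^ k)"
      using that by (intro summable_in_conv_radius) auto
    obtain K where K: "ereal t < ereal K" "ereal K < conv_radius w"
      using ereal_dense2[OF \<open>ereal t < conv_radius w\<close>] by blast
    have "summable (\<lambda>k. diffs w k * t ^ k)"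
    proof (rule termdiff_converges[of t K])
      fix u :: real assume "norm u < K"
      then have "ereal (norm u) < conv_radius w" using K(2) by (metis ereal_less_eq(3) less_imp_le le_less_trans)
      then show "summable (\<lambda>k. w k * u ^ k)" by (rule summable_in_conv_radius)
    qed (use that K in auto)
    then show "summable (\<lambda>k. real k * w k * t ^ k)"
      using mean_iff(1)[OF that(1) s] by simp
  qed
  define h where "h k = (real k - 1) * w k" for k
  have h_radius: "ereal t < conv_radius w \<Longrightarrow> 0 < t \<Longrightarrow> summable (\<lambda>k. h k * t ^ k)" for t
    using summable_diff[OF sm(2) sm(1), of t t] by (simp add: h_def algebra_simps)
  define H where "H t = (\<Sum>k. h k * t ^ k)" for t
  have H_eq: "H t = (\<Sum>k. real k * w k * t ^ k) - (\<Sum>k. w k * t ^ k)"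
    if "0 < t" "ereal t < conv_radius w" for t
    using suminf_diff[OF sm(2)[OF that] sm(1)[OF that]] by (simp add: H_def h_def algebra_simps)
  have neg: "H t < 0" if t: "0 < t" "ereal t < conv_radius w" for t
  proof (rule ccontr)
    assume "\<not> H t < 0"
    obtain t' where t': "ereal t < ereal t'" "ereal t' < conv_radius w"
      using ereal_dense2[OF t(2)] by blast
    have "isCont H u" if "u \<in> {0..t}" for u
      unfolding H_def using that t' t h_radius[of t'] by (intro isCont_powser[of h t']) auto
    moreover have H0: "H 0 = - w 0"
      by (simp add: H_def h_def powser_zero)
    ultimately have "\<exists>u\<ge>0. u \<le> t \<and> H u = 0"
      using \<open>\<not> H t < 0\<close> t w_0 by (intro IVT) auto
    then obtain u where u: "0 \<le> u" "u \<le> t" "H u = 0" by auto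
    have "u \<noteq> 0" using u w_0 H0 by auto
    then have u0: "0 < u" using u by simp
    have uR: "ereal u < conv_radius w" using u t by (metis ereal_less_eq(3) le_less_trans)
    have "(\<Sum>k. real k * w k * u ^ k) = (\<Sum>k. w k * u ^ k)"
      using H_eq[OF u0 uR] u by simp
    then have "type_I_at w u"
      unfolding type_I_at_def
      using u0 uR sm[OF u0 uR] mean_iff[OF u0 sm(1)[OF u0 uR]] gen_fun_pos[OF u0 sm(1)[OF u0 uR]]
      by (auto simp: gen_fun_def)
    then show False using nI by blast
  qed
  have bound: "(\<Sum>k<n. real k * w (Suc k) * t ^ Suc k) \<le> w 0"
    if t: "0 < t" "ereal t < conv_radius w" for t n
  proof -
    have "(\<lambda>k. h k * t ^ k) sums H t" unfolding H_def by (intro summable_sums h_radius t)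
    then have "(\<lambda>k. h (Suc k) * t ^ Suc k) sums (H t - h 0 * t ^ 0)"
      using sums_Suc_iff[of "\<lambda>k. h k * t ^ k" "H t - h 0 * t ^ 0"] by simp
    then have s: "(\<lambda>k. real k * w (Suc k) * t ^ Suc k) sums (H t + w 0)"
      by (simp add: h_def)
    have "(\<Sum>k<n. real k * w (Suc k) * t ^ Suc k) \<le> (\<Sum>k. real k * w (Suc k) * t ^ Suc k)"
      using s t by (intro sum_le_suminf) (auto simp: sums_iff)
    then show ?thesis using s neg[OF t] by (simp add: sums_iff)
  qed
  show False
  proof (cases "conv_radius w")
    case PInf
    obtain k where k: "k \<ge> 2" "0 < w k"
      using w by (auto simp: weight_sequence_def)
    \<comment> \<open>Chosen such that \<open>w k * t = w 0 + w k\<close> exceeds the bound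
      \<open>w 0\<close>.\<close>
    define t where "t = w 0 / w k + 1"
    have t: "1 \<le> t" using k by (simp add: t_def)
    obtain j where j: "k = Suc j" "1 \<le> j" using k by (cases k) auto
    have "w k * t \<le> real j * w (Suc j) * t ^ Suc j"
    proof -
      have "1 * w k * t ^ 1 \<le> real j * w k * t ^ Suc j"
        using j t by (intro mult_mono power_increasing) auto
      then show ?thesis by (simp add: j)
    qed
    also have "\<dots> \<le> (\<Sum>i<Suc j. real i * w (Suc i) * t ^ Suc i)"
      using t by (intro member_le_sum) auto
    also have "\<dots> \<le> w 0" using t PInf by (intro bound) auto
    finally show False using k by (simp add: t_def algebra_simps)
  next
    case (real r)
    have r0: "0 < r" using R0 real by simp
    \<comment> \<open>Partial sums are continuous in \<open>t\<close>, so their bound extends to the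
      endpoint \<open>r\<close> before convergence there is known.\<close>
    have "(\<Sum>k<n. real k * w (Suc k) * r ^ Suc k) \<le> w 0" for n
    proof (rule tendsto_upperbound)
      show "((\<lambda>t. \<Sum>k<n. real k * w (Suc k) * t ^ Suc k) \<longlongrightarrow> (\<Sum>k<n. real k * w (Suc k) * r ^ Suc k)) (at_left r)"
        by (intro tendsto_intros)
      have "\<forall>\<^sub>F t in at_left r. t \<in> {0<..<r}"
        using r0 by (intro eventually_at_leftI[of 0]) auto
      then show "\<forall>\<^sub>F t in at_left r. (\<Sum>k<n. real k * w (Suc k) * t ^ Suc k) \<le> w 0"
      proof (rule eventually_mono)
        fix t assume "t \<in> {0<..<r}"
        then show "(\<Sum>k<n. real k * w (Suc k) * t ^ Suc k) \<le> w 0"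
          by (intro bound) (auto simp: real)
      qed
    qed simp
    note bd = this
    have sh: "summable (\<lambda>k. real k * w (Suc k) * r ^ Suc k)"
      using r0 bd by (intro summableI_nonneg_bounded[where x = "w 0"]) auto
    have "(\<Sum>k. real k * w (Suc k) * r ^ Suc k) \<le> w 0"
      using bd by (intro suminf_le_const sh)
    have "summable (\<lambda>k. w (Suc k) * r ^ Suc k)"
    proof (rule summable_comparison_test'[OF sh, of 1])
      fix k :: nat assume "1 \<le> k"
      then have "1 * (w (Suc k) * r ^ Suc k) \<le> real k * (w (Suc k) * r ^ Suc k)"
        using r0 by (intro mult_right_mono) auto
      then show "norm (w (Suc k) * r ^ Suc k) \<le> real k * w (Suc k) * r ^ Suc k"
        using r0 by simp
    qed
    then have s1: "summable (\<lambda>k. w k * r ^ k)" by (subst (asm) summable_Suc_iff)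
    have "summable (\<lambda>k. h (Suc k) * r ^ Suc k)" using sh by (simp add: h_def)
    then have sh0: "summable (\<lambda>k. h k * r ^ k)" by (subst (asm) summable_Suc_iff)
    then have s2: "summable (\<lambda>k. real k * w k * r ^ k)"
      using summable_add[OF sh0 s1] by (simp add: h_def algebra_simps)
    have "(\<Sum>k. h k * r ^ k) = (\<Sum>k. real k * w (Suc k) * r ^ Suc k) - w 0"
      using suminf_split_head[OF sh0] by (simp add: h_def)
    then have "(\<Sum>k. h k * r ^ k) \<le> 0"
      using \<open>(\<Sum>k. real k * w (Suc k) * r ^ Suc k) \<le> w 0\<close> by linarith
    moreover have "(\<Sum>k. h k * r ^ k) = (\<Sum>k. real k * w k * r ^ k) - (\<Sum>k. w k * r ^ k)"
      using suminf_diff[OF s2 s1] by (simp add: h_def algebra_simps)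
    ultimately have le: "(\<Sum>k. real k * w k * r ^ k) \<le> gen_fun w r" by (simp add: gen_fun_def)
    have pos: "0 < gen_fun w r" by (rule gen_fun_pos[OF r0 s1])
    have sd: "summable (\<lambda>k. diffs w k * r ^ k)" using mean_iff(1)[OF r0 s1] s2 by simp
    have "r * gen_fun_deriv w r / gen_fun w r \<le> 1"
      using mean_iff(2)[OF r0 s1 sd] le pos by (simp add: gen_fun_def)
    then have "type_I_at w r \<or> type_II_at w r"
      unfolding type_I_at_def type_II_at_def using r0 s1 sd real by auto
    then show False using nI nII by blast
  next
    case MInf
    then show False using R0 by simp
  qed
qed

lemma offspring_cases:
  obtains (tilted) t where "tilted_trees w T t" "offspring_pmf w = tilted_pmf w t"
  | (trivial) "conv_radius w = 0" "offspring_pmf w = return_pmf 0"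
proof (cases "\<exists>t. type_I_at w t")
  case True
  then have "type_I_at w (SOME t. type_I_at w t)" by (rule someI_ex)
  then show ?thesis
    using True by (intro tilted(1)[OF tilted_if_type_I]) (auto simp: offspring_pmf_def)
next
  case nI: False
  show ?thesis
  proof (cases "\<exists>t. type_II_at w t")
    case True
    then have "type_II_at w (SOME t. type_II_at w t)" by (rule someI_ex)
    then show ?thesis
      using nI True by (intro tilted(1)[OF tilted_if_type_II]) (auto simp: offspring_pmf_def)
  next
    case False
    then show ?thesis
      using nI by (intro trivial type_III_if_not_type_I_II) (auto simp: offspring_pmf_def)
  qed
qed

theorem pointed_tail_limit:
  "\<exists>\<epsilon>. weighted_trees_leaf w T \<epsilon> \<and>
    (\<forall>R. ((\<lambda>n. pointed R n / (T * C) $ n) \<longlongrightarrow> enn2real (limit_tail (offspring_pmf w) R)) (flt 1))"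
proof (cases rule: offspring_cases)
  case (tilted t)
  interpret tilted_trees w T t by fact
  obtain \<epsilon> where "weighted_trees_leaf w T \<epsilon>"
    using leaf_constant[OF leaf_fraction_limit p_0] by blast
  then interpret weighted_trees_leaf w T \<epsilon> .
  interpret tilted_trees_leaf w T t \<epsilon> ..
  show ?thesis
    using pointed_limit_tail \<open>weighted_trees_leaf w T \<epsilon>\<close> by (auto simp: tilted)
next
  case trivial
  obtain \<epsilon> where "weighted_trees_leaf w T \<epsilon>"
    using leaf_constant[OF leaf_fraction_limit_radius_0[OF trivial(1)]] by auto
  moreover have "((\<lambda>n. pointed R n / (T * C) $ n) \<longlongrightarrow> enn2real (limit_tail (offspring_pmf w) R)) (flt 1)" for R
  \<comment> \<open>The offspring law is concentrated at 0, so \<open>surv\<close> vanishes for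
    \<open>R > 0\<close>; for \<open>R = 0\<close> the ratio is constantly 1.\<close>
  proof (cases R)
    case 0
    have "\<forall>\<^sub>F n in flt 1. pointed R n / (T * C) $ n = enn2real (limit_tail (offspring_pmf w) R)"
      using eventually_flt_pos[of 1]
      by (rule eventually_mono) (simp add: 0 pointed_0 Z_1 limit_tail_def)
    then show ?thesis by (rule tendsto_eventually)
  next
    case (Suc k)
    then show ?thesis
      using pointed_limit_radius_0[OF trivial(1), of R] by (simp add: trivial(2) limit_tail_def)
  qed
  ultimately show ?thesis by blast
qed

lemma offspring_0: "0 < pmf (offspring_pmf w) 0"
proof (cases rule: offspring_cases)
  case (tilted t)
  interpret tilted_trees w T t by fact
  show ?thesis using p_0 by (simp add: tilted pmf_tilted)
qed simp

lemma offspring_mean: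
  "integrable (measure_pmf (offspring_pmf w)) real"
  "measure_pmf.expectation (offspring_pmf w) real \<le> 1"
proof -
  have *: "(\<integral>\<^sup>+ j. ennreal (real j) \<partial>measure_pmf (offspring_pmf w)) \<le> 1"
  proof (cases rule: offspring_cases)
    case (tilted t)
    interpret tilted_trees w T t by fact
    show ?thesis
      unfolding tilted nn_mean using mean_le_1 by (metis ennreal_1 ennreal_leI)
  qed simp
  then show i: "integrable (measure_pmf (offspring_pmf w)) real"
    by (intro integrableI_nonneg) (auto intro: le_less_trans)
  show "measure_pmf.expectation (offspring_pmf w) real \<le> 1"
    using * i by (simp add: nn_integral_eq_integral)
qed

end

section \<open>Distance to the leaves in a rooted tree\<close>

lemma relpow_converse: "((R :: ('a \<times> 'a) set)\<inverse>) ^^ n = (R ^^ n)\<inverse>"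
  by (induction n) (simp_all add: converse_relcomp[symmetric] relpow_commute)

lemma relpow_mono_subset: "(A :: ('a \<times> 'a) set) \<subseteq> B \<Longrightarrow> A ^^ n \<subseteq> B ^^ n"
  by (induction n) (simp_all add: relcomp_mono)

text \<open>As the parent is unique, a step down followed by a step up returns to its start and
  cancels. What remains of a walk goes up first and then down.\<close>

lemma up_down_walk:
  assumes "single_valued (R\<inverse>)" "(v, u) \<in> (R \<union> R\<inverse>) ^^ n"
  shows "\<exists>x j k. j + k \<le> n \<and> (x, v) \<in> R ^^ j \<and> (x, u) \<in> R ^^ k"
  using assms(2)
proof (induction n arbitrary: u)
  case 0
  then show ?case by auto
next
  case (Suc n)
  then obtain z where z: "(v, z) \<in> (R \<union> R\<inverse>) ^^ n" "(z, u) \<in> R \<union> R\<inverse>" by auto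
  obtain x j k where xjk: "j + k \<le> n" "(x, v) \<in> R ^^ j" "(x, z) \<in> R ^^ k"
    using Suc.IH[OF z(1)] by blast
  show ?case
  proof (cases "(z, u) \<in> R")
    case True
    then have "(x, u) \<in> R ^^ Suc k" using xjk by auto
    then show ?thesis using xjk by (intro exI[of _ x] exI[of _ j] exI[of _ "Suc k"]) auto
  next
    case False
    then have uz: "(u, z) \<in> R" using z by auto
    show ?thesis
    proof (cases k)
      case 0
      have "(u, v) \<in> R ^^ Suc j"
        by (rule relpow_Suc_I2[OF uz]) (use xjk 0 in simp)
      then show ?thesis using xjk 0 by (intro exI[of _ u] exI[of _ "Suc j"] exI[of _ 0]) auto
    next
      case (Suc k')
      then obtain y where y: "(x, y) \<in> R ^^ k'" "(y, z) \<in> R" using xjk by auto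
      then have "y = u" using uz assms(1) by (auto simp: single_valued_def)
      then show ?thesis using xjk y Suc by (intro exI[of _ x] exI[of _ j] exI[of _ k']) auto
    qed
  qed
qed

lemma walk_up_down:
  assumes "(x, v) \<in> R ^^ j" "(x, u) \<in> R ^^ k"
  shows "(v, u) \<in> (R \<union> R\<inverse>) ^^ (j + k)"
proof -
  have "(v, x) \<in> (R\<inverse>) ^^ j" using assms(1) by (simp add: relpow_converse)
  then have "(v, x) \<in> (R \<union> R\<inverse>) ^^ j" using relpow_mono_subset[of "R\<inverse>" "R \<union> R\<inverse>" j] by auto
  moreover have "(x, u) \<in> (R \<union> R\<inverse>) ^^ k"
    using assms(2) relpow_mono_subset[of R "R \<union> R\<inverse>" k] by auto
  ultimately show ?thesis by (auto simp: relpow_add)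
qed

text \<open>Reduces the distance to ancestors \<open>x\<close> of \<open>v\<close> and their
  descendants \<open>u\<close>; it serves both the finite trees and the infinite limit tree.\<close>

lemma border_dist_ge_iff:
  assumes "single_valued (R\<inverse>)"
  shows "enat r \<le> border_dist V R v \<longleftrightarrow>
    (\<forall>x j k u. (x, v) \<in> R ^^ j \<longrightarrow> (x, u) \<in> R ^^ k \<longrightarrow> j + k < r \<longrightarrow> u \<notin> leaves V R)"
proof -
  have "enat r \<le> border_dist V R v \<longleftrightarrow>
      (\<forall>u\<in>leaves V R. \<forall>n. (v, u) \<in> (R \<union> R\<inverse>) ^^ n \<longrightarrow> r \<le> n)"
    unfolding border_dist_def graph_dist_def by (force simp: le_INF_iff le_Inf_iff)
  also have "\<dots> \<longleftrightarrow> (\<forall>x j k u. (x, v) \<in> R ^^ j \<longrightarrow> (x, u) \<in> R ^^ k \<longrightarrow> j + k < r \<longrightarrow> u \<notin> leaves V R)"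
  proof (intro iffI allI ballI impI)
    fix x j k u
    assume "\<forall>u\<in>leaves V R. \<forall>n. (v, u) \<in> (R \<union> R\<inverse>) ^^ n \<longrightarrow> r \<le> n"
      and "(x, v) \<in> R ^^ j" "(x, u) \<in> R ^^ k" "j + k < r"
    then show "u \<notin> leaves V R" using walk_up_down[of x v j R u k] by fastforce
  next
    fix u n
    assume *: "\<forall>x j k u. (x, v) \<in> R ^^ j \<longrightarrow> (x, u) \<in> R ^^ k \<longrightarrow> j + k < r \<longrightarrow> u \<notin> leaves V R"
      and u: "u \<in> leaves V R" "(v, u) \<in> (R \<union> R\<inverse>) ^^ n"
    obtain x j k where "j + k \<le> n" "(x, v) \<in> R ^^ j" "(x, u) \<in> R ^^ k"
      using up_down_walk[OF assms u(2)] by blast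
    then show "r \<le> n" using * u(1) by (meson le_trans not_le_imp_less)
  qed
  finally show ?thesis .
qed

section \<open>Plane trees\<close>

definition node :: "nat list set list \<Rightarrow> nat list set" where
  "node ts = insert [] {i # v | i v. i < length ts \<and> v \<in> ts ! i}"

lemma Nil_in_node [simp]: "[] \<in> node ts"
  by (simp add: node_def)

lemma Cons_in_node [simp]: "i # v \<in> node ts \<longleftrightarrow> i < length ts \<and> v \<in> ts ! i"
  by (auto simp: node_def)

lemma plane_tree_Nil: "plane_tree T \<Longrightarrow> [] \<in> T"
  by (simp add: plane_tree_def)

lemma plane_tree_finite: "plane_tree T \<Longrightarrow> finite T"
  by (simp add: plane_tree_def)

lemma plane_tree_prefix: "plane_tree T \<Longrightarrow> u @ v \<in> T \<Longrightarrow> u \<in> T"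
proof (induction v rule: rev_induct)
  case (snoc x xs)
  then have "(u @ xs) @ [x] \<in> T" by simp
  then have "u @ xs \<in> T" using snoc.prems(1) unfolding plane_tree_def by blast
  then show ?case using snoc by blast
qed simp

lemma node_eq: "node ts = insert [] (\<Union>i<length ts. (#) i ` (ts ! i))"
  by (auto simp: node_def)

lemma plane_tree_node:
  assumes "\<And>t. t \<in> set ts \<Longrightarrow> plane_tree t"
  shows "plane_tree (node ts)"
  unfolding plane_tree_def
proof (intro conjI allI impI)
  have pt: "plane_tree (ts ! i)" if "i < length ts" for i using assms that by simp
  show "finite (node ts)"
    unfolding node_eq using pt by (auto dest: plane_tree_finite)
  show "[] \<in> node ts" by simp
  fix u i assume ui: "u @ [i] \<in> node ts"
  show "u \<in> node ts"
  proof (cases u)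
    case (Cons a v)
    then show ?thesis using ui pt[of a] by (auto dest: plane_tree_prefix)
  qed simp
  fix j assume "j < i"
  show "u @ [j] \<in> node ts"
  proof (cases u)
    case Nil
    then show ?thesis using ui \<open>j < i\<close> pt[of j] by (auto dest: plane_tree_Nil)
  next
    case (Cons a v)
    then show ?thesis using ui \<open>j < i\<close> pt[of a] unfolding plane_tree_def by auto
  qed
qed

lemma plane_tree_cases:
  assumes "plane_tree T"
  obtains ts where "T = node ts" "\<And>t. t \<in> set ts \<Longrightarrow> plane_tree t"
proof -
  define I where "I = {i. [i] \<in> T}"
  have "finite ((\<lambda>i. [i]) ` I)"
    using plane_tree_finite[OF assms] by (rule rev_finite_subset) (auto simp: I_def)
  then have fin: "finite I" by (rule finite_imageD) (auto intro: inj_onI)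
  have down: "j \<in> I" if "i \<in> I" "j < i" for i j
    using assms that unfolding plane_tree_def I_def by (metis append_Nil mem_Collect_eq)
  obtain k where k: "I = {..<k}"
  proof (cases "I = {}")
    case True
    then show ?thesis using that[of 0] by simp
  next
    case False
    have "I = {..<Suc (Max I)}"
    proof (intro equalityI subsetI)
      fix x assume "x \<in> {..<Suc (Max I)}"
      then show "x \<in> I" using down[OF Max_in[OF fin False], of x] Max_in[OF fin False]
        by (cases "x = Max I") auto
    qed (use fin in \<open>auto simp: less_Suc_eq_le\<close>)
    then show ?thesis by (rule that)
  qed
  have I_iff: "[i] \<in> T \<longleftrightarrow> i < k" for i using k by (auto simp: I_def)
  define ts where "ts = map (\<lambda>i. {v. i # v \<in> T}) [0..<k]"
  have sub: "plane_tree {v. i # v \<in> T}" if "i < k" for i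
    unfolding plane_tree_def
  proof (intro conjI allI impI)
    have "finite ((#) i ` {v. i # v \<in> T})"
      using plane_tree_finite[OF assms] by (rule rev_finite_subset) auto
    then show "finite {v. i # v \<in> T}" by (rule finite_imageD) (auto intro: inj_onI)
    show "[] \<in> {v. i # v \<in> T}" using that I_iff by simp
    fix u l assume "u @ [l] \<in> {v. i # v \<in> T}"
    then have "(i # u) @ [l] \<in> T" by simp
    then have *: "i # u \<in> T \<and> (\<forall>j<l. (i # u) @ [j] \<in> T)"
      using assms unfolding plane_tree_def by blast
    then show "u \<in> {v. i # v \<in> T}" by simp
    fix j assume "j < l"
    then show "u @ [j] \<in> {v. i # v \<in> T}" using * by simp
  qed
  show ?thesis
  proof (rule that)
    show "T = node ts"
    proof (intro set_eqI iffI)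
      fix v assume v: "v \<in> T"
      show "v \<in> node ts"
      proof (cases v)
        case (Cons i u)
        then have "[i] \<in> T" using v plane_tree_prefix[OF assms, of "[i]" u] by simp
        then show ?thesis using v Cons I_iff by (simp add: ts_def)
      qed simp
    next
      fix v assume "v \<in> node ts"
      then show "v \<in> T"
        by (cases v) (auto simp: ts_def plane_tree_Nil[OF assms])
    qed
    show "plane_tree t" if "t \<in> set ts" for t
      using that sub by (auto simp: ts_def)
  qed
qed

lemma node_inject:
  assumes "\<And>t. t \<in> set ts \<Longrightarrow> plane_tree t" "\<And>t. t \<in> set ts' \<Longrightarrow> plane_tree t"
  shows "node ts = node ts' \<longleftrightarrow> ts = ts'"
proof
  assume eq: "node ts = node ts'"
  have root: "[i] \<in> node us \<longleftrightarrow> i < length us" if "\<And>t. t \<in> set us \<Longrightarrow> plane_tree t" for us i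
    using that by (auto dest: plane_tree_Nil nth_mem)
  have "i < length ts \<longleftrightarrow> i < length ts'" for i
    using root[of ts i, OF assms(1)] root[of ts' i, OF assms(2)] unfolding eq by blast
  then have len: "length ts = length ts'" by (metis linorder_neqE_nat less_irrefl)
  show "ts = ts'"
  proof (rule nth_equalityI[OF len])
    fix i assume i: "i < length ts"
    show "ts ! i = ts' ! i"
    proof (rule set_eqI)
      fix v
      have "i # v \<in> node ts \<longleftrightarrow> i # v \<in> node ts'" using eq by simp
      then show "v \<in> ts ! i \<longleftrightarrow> v \<in> ts' ! i" using i len by simp
    qed
  qed
qed simp

lemma card_node:
  assumes "\<And>t. t \<in> set ts \<Longrightarrow> plane_tree t"
  shows "card (node ts) = Suc (\<Sum>t\<leftarrow>ts. card t)"
proof -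
  have fin: "finite (ts ! i)" if "i < length ts" for i
    using assms that by (simp add: plane_tree_finite)
  have "card (\<Union>i<length ts. (#) i ` (ts ! i)) = (\<Sum>i<length ts. card ((#) i ` (ts ! i)))"
    using fin by (intro card_UN_disjoint) auto
  also have "\<dots> = (\<Sum>i<length ts. card (ts ! i))"
    by (intro sum.cong refl card_image) (auto intro: inj_onI)
  also have "\<dots> = (\<Sum>t\<leftarrow>ts. card t)"
    by (simp add: sum_list_sum_nth atLeast0LessThan)
  finally show ?thesis
    unfolding node_eq using fin by (subst card_insert_disjoint) auto
qed

lemma children_node_Nil:
  assumes "\<And>t. t \<in> set ts \<Longrightarrow> plane_tree t"
  shows "child_rel (node ts) `` {[]} = (\<lambda>i. [i]) ` {..<length ts}"
proof -
  have "[] \<in> ts ! i" if "i < length ts" for i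
    using assms[OF nth_mem[OF that]] by (rule plane_tree_Nil)
  then show ?thesis by (auto simp: child_rel_def)
qed

lemma children_node_Cons:
  assumes "i < length ts"
  shows "child_rel (node ts) `` {i # v} = (#) i ` (child_rel (ts ! i) `` {v})"
  using assms by (auto simp: child_rel_def)

lemma outdeg_node_Nil:
  "(\<And>t. t \<in> set ts \<Longrightarrow> plane_tree t) \<Longrightarrow> outdeg (node ts) [] = length ts"
  by (simp add: outdeg_def children_node_Nil card_image inj_on_def)

lemma outdeg_node_Cons: "i < length ts \<Longrightarrow> outdeg (node ts) (i # v) = outdeg (ts ! i) v"
  unfolding outdeg_def children_node_Cons by (rule card_image) (auto intro: inj_onI)

lemma tree_weight_node:
  assumes "\<And>t. t \<in> set ts \<Longrightarrow> plane_tree t"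
  shows "tree_weight w (node ts) = w (length ts) * (\<Prod>t\<leftarrow>ts. tree_weight w t)"
proof -
  have fin: "finite (ts ! i)" if "i < length ts" for i
    using assms that by (simp add: plane_tree_finite)
  let ?f = "\<lambda>v. w (outdeg (node ts) v)"
  have "prod ?f (\<Union>i<length ts. (#) i ` (ts ! i)) = (\<Prod>i<length ts. prod ?f ((#) i ` (ts ! i)))"
    using fin by (intro prod.UNION_disjoint) auto
  also have "\<dots> = (\<Prod>i<length ts. tree_weight w (ts ! i))"
  proof (intro prod.cong refl)
    fix i assume "i \<in> {..<length ts}"
    then have i: "i < length ts" by simp
    show "prod ?f ((#) i ` (ts ! i)) = tree_weight w (ts ! i)"
      unfolding tree_weight_def
      by (subst prod.reindex) (auto simp: outdeg_node_Cons[OF i] intro: inj_onI)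
  qed
  also have "\<dots> = (\<Prod>t\<leftarrow>ts. tree_weight w t)"
    by (simp add: prod.list_conv_set_nth atLeast0LessThan)
  finally have "prod ?f (\<Union>i<length ts. (#) i ` (ts ! i)) = (\<Prod>t\<leftarrow>ts. tree_weight w t)" .
  then show ?thesis
    unfolding tree_weight_def[of w "node ts"]
    unfolding node_eq[of ts] using fin
    by (subst prod.insert) (auto simp: outdeg_node_Nil[OF assms] simp flip: node_eq)
qed

lemma card_plane_tree_pos: "plane_tree T \<Longrightarrow> 0 < card T"
  by (auto simp: card_gt_0_iff plane_tree_finite dest: plane_tree_Nil)

lemma length_le_sum_card:
  "(\<And>t. t \<in> set ts \<Longrightarrow> plane_tree t) \<Longrightarrow> length ts \<le> (\<Sum>t\<leftarrow>ts. card t)"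
proof (induction ts)
  case (Cons t ts)
  then show ?case using card_plane_tree_pos[of t] by fastforce
qed simp

lemma finite_plane_trees: "finite (plane_trees n)"
proof (induction n rule: less_induct)
  case (less n)
  let ?S = "\<Union>m<n. plane_trees m"
  have "plane_trees n \<subseteq> node ` {ts. set ts \<subseteq> ?S \<and> length ts \<le> n}"
  proof
    fix T assume T: "T \<in> plane_trees n"
    then obtain ts where ts: "T = node ts" "\<And>t. t \<in> set ts \<Longrightarrow> plane_tree t"
      unfolding plane_trees_def by (auto elim: plane_tree_cases)
    have n: "n = Suc (\<Sum>t\<leftarrow>ts. card t)"
      using T card_node[OF ts(2)] ts(1) by (simp add: plane_trees_def)
    have "card t < n" if "t \<in> set ts" for t
      using member_le_sum_list[of "card t" "map card ts"] that n by simp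
    then have "set ts \<subseteq> ?S" using ts(2) by (auto simp: plane_trees_def)
    moreover have "length ts \<le> (\<Sum>t\<leftarrow>ts. card t)"
      by (rule length_le_sum_card) (rule ts(2))
    then have "length ts \<le> n" using n by simp
    ultimately show "T \<in> node ` {ts. set ts \<subseteq> ?S \<and> length ts \<le> n}" using ts(1) by blast
  qed
  moreover have "finite {ts. set ts \<subseteq> ?S \<and> length ts \<le> n}"
    using less by (intro finite_lists_length_le) auto
  ultimately show ?case by (meson finite_imageI finite_subset)
qed

definition noleaf :: "nat \<Rightarrow> nat list set \<Rightarrow> bool" where
  "noleaf k T \<longleftrightarrow> (\<forall>u\<in>T. length u < k \<longrightarrow> child_rel T `` {u} \<noteq> {})"

text \<open>The walk goes up \<open>length y\<close> steps to the ancestor \<open>x\<close> and down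
  \<open>length u\<close> steps. That \<open>u\<close> may retrace \<open>y\<close> is harmless,
  since such a walk is only longer than necessary.\<close>

definition far :: "nat \<Rightarrow> nat list set \<Rightarrow> nat list \<Rightarrow> bool" where
  "far R T v \<longleftrightarrow> (\<forall>x y u. v = x @ y \<longrightarrow> x @ u \<in> T \<longrightarrow> length y + length u < R \<longrightarrow>
     child_rel T `` {x @ u} \<noteq> {})"

lemma noleaf_0 [simp]: "noleaf 0 T"
  by (simp add: noleaf_def)

lemma noleaf_node:
  assumes "\<And>t. t \<in> set ts \<Longrightarrow> plane_tree t"
  shows "noleaf (Suc k) (node ts) \<longleftrightarrow> ts \<noteq> [] \<and> (\<forall>t\<in>set ts. noleaf k t)"
proof -
  have "noleaf (Suc k) (node ts) \<longleftrightarrow> ts \<noteq> [] \<and>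
      (\<forall>i<length ts. \<forall>v\<in>ts ! i. length v < k \<longrightarrow> child_rel (ts ! i) `` {v} \<noteq> {})"
    unfolding noleaf_def[of "Suc k"]
  proof (intro iffI conjI allI ballI impI)
    assume *: "\<forall>u\<in>node ts. length u < Suc k \<longrightarrow> child_rel (node ts) `` {u} \<noteq> {}"
    from bspec[OF * Nil_in_node] show "ts \<noteq> []" using children_node_Nil[OF assms] by auto
    fix i v assume "i < length ts" "v \<in> ts ! i" "length v < k"
    then show "child_rel (ts ! i) `` {v} \<noteq> {}"
      using bspec[OF *, of "i # v"] children_node_Cons[of i ts v] by auto
  next
    fix u assume *: "ts \<noteq> [] \<and>
      (\<forall>i<length ts. \<forall>v\<in>ts ! i. length v < k \<longrightarrow> child_rel (ts ! i) `` {v} \<noteq> {})"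
      and u: "u \<in> node ts" "length u < Suc k"
    show "child_rel (node ts) `` {u} \<noteq> {}"
    proof (cases u)
      case Nil
      then show ?thesis using * children_node_Nil[OF assms] by auto
    next
      case (Cons i v)
      then show ?thesis using * u children_node_Cons[of i ts v] by auto
    qed
  qed
  then show ?thesis by (auto simp: noleaf_def all_set_conv_all_nth)
qed

lemma far_Nil: "far R T [] \<longleftrightarrow> noleaf R T"
  by (auto simp: far_def noleaf_def)

text \<open>From \<open>i # v\<close> the root is at distance \<open>length v + 1\<close> and the
  roots of the sibling subtrees at distance \<open>length v + 2\<close>; the root itself is not a
  leaf.\<close>

lemma far_node_Cons:
  assumes pt: "\<And>t. t \<in> set ts \<Longrightarrow> plane_tree t" and i: "i < length ts"
  shows "far R (node ts) (i # v) \<longleftrightarrow>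
    far R (ts ! i) v \<and> (\<forall>l<length ts. l \<noteq> i \<longrightarrow> noleaf (R - length v - 2) (ts ! l))"
proof (intro iffI conjI allI impI)
  assume f: "far R (node ts) (i # v)"
  show "far R (ts ! i) v"
    unfolding far_def
  proof (intro allI impI)
    fix x y u assume *: "v = x @ y" "x @ u \<in> ts ! i" "length y + length u < R"
    then have "child_rel (node ts) `` {(i # x) @ u} \<noteq> {}"
      using f i unfolding far_def by (metis Cons_in_node append_Cons)
    then show "child_rel (ts ! i) `` {x @ u} \<noteq> {}"
      using children_node_Cons[OF i, of "x @ u"] by auto
  qed
  fix l assume l: "l < length ts" "l \<noteq> i"
  show "noleaf (R - length v - 2) (ts ! l)"
    unfolding noleaf_def
  proof (intro ballI impI)
    fix u assume u: "u \<in> ts ! l" "length u < R - length v - 2"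
    have "child_rel (node ts) `` {[] @ (l # u)} \<noteq> {}"
    proof (rule f[unfolded far_def, rule_format])
      show "i # v = [] @ (i # v)" by simp
    qed (use u l in auto)
    then show "child_rel (ts ! l) `` {u} \<noteq> {}"
      using children_node_Cons[OF l(1), of u] by auto
  qed
next
  assume *: "far R (ts ! i) v \<and> (\<forall>l<length ts. l \<noteq> i \<longrightarrow> noleaf (R - length v - 2) (ts ! l))"
  show "far R (node ts) (i # v)"
    unfolding far_def
  proof (intro allI impI)
    fix x y u assume xyu: "i # v = x @ y" "x @ u \<in> node ts" "length y + length u < R"
    show "child_rel (node ts) `` {x @ u} \<noteq> {}"
    proof (cases x)
      case Nil
      show ?thesis
      proof (cases u)
        case Nil
        then show ?thesis using \<open>x = []\<close> i children_node_Nil[OF pt] by auto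
      next
        case (Cons l u')
        then have l: "l < length ts" "u' \<in> ts ! l" using xyu \<open>x = []\<close> by auto
        have len: "length v + length u' + 2 < R" using xyu Cons \<open>x = []\<close> by auto
        have "child_rel (ts ! l) `` {u'} \<noteq> {}"
        proof (cases "l = i")
          case True
          have "child_rel (ts ! i) `` {[] @ u'} \<noteq> {}"
            using * l len True unfolding far_def by (metis add_lessD1 append_Nil)
          then show ?thesis using True by simp
        next
          case False
          then show ?thesis using * l len by (auto simp: noleaf_def)
        qed
        then show ?thesis using children_node_Cons[OF l(1), of u'] Cons \<open>x = []\<close> by auto
      qed
    next
      case (Cons a x')
      then have a: "a = i" "v = x' @ y" "x' @ u \<in> ts ! i" using xyu by auto
      then have "child_rel (ts ! i) `` {x' @ u} \<noteq> {}"
        using * xyu unfolding far_def by blast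
      then show ?thesis using children_node_Cons[OF i, of "x' @ u"] Cons a by auto
    qed
  qed
qed

lemma relpow_child_rel:
  assumes "plane_tree T" "x \<in> T"
  shows "(x, u) \<in> child_rel T ^^ k \<longleftrightarrow> (\<exists>y. length y = k \<and> u = x @ y \<and> u \<in> T)"
proof (induction k arbitrary: u)
  case (Suc k)
  show ?case
  proof
    assume "(x, u) \<in> child_rel T ^^ Suc k"
    then obtain z where z: "(x, z) \<in> child_rel T ^^ k" "(z, u) \<in> child_rel T" by auto
    then obtain y where "length y = k" "z = x @ y" using Suc by blast
    moreover obtain i where "u = z @ [i]" "u \<in> T" using z by (auto simp: child_rel_def)
    ultimately show "\<exists>y. length y = Suc k \<and> u = x @ y \<and> u \<in> T"
      by (intro exI[of _ "y @ [i]"]) auto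
  next
    assume "\<exists>y. length y = Suc k \<and> u = x @ y \<and> u \<in> T"
    then obtain y where y: "length y = Suc k" "u = x @ y" "u \<in> T" by blast
    then obtain y' i where y': "y = y' @ [i]" by (metis length_Suc_conv_rev)
    then have "x @ y' \<in> T" using y plane_tree_prefix[OF assms(1), of "x @ y'" "[i]"] by simp
    then have "(x, x @ y') \<in> child_rel T ^^ k" using Suc y y' by auto
    moreover have "(x @ y', u) \<in> child_rel T"
      using \<open>x @ y' \<in> T\<close> y y' by (auto simp: child_rel_def)
    ultimately show "(x, u) \<in> child_rel T ^^ Suc k" by auto
  qed
qed (use assms in auto)

lemma tree_border_dist_ge_iff:
  assumes T: "plane_tree T" "v \<in> T"
  shows "enat R \<le> tree_border_dist (T, v) \<longleftrightarrow> far R T v"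
proof -
  have "single_valued ((child_rel T)\<inverse>)"
    by (auto simp: single_valued_def child_rel_def)
  then have "enat R \<le> tree_border_dist (T, v) \<longleftrightarrow>
      (\<forall>x j k u. (x, v) \<in> child_rel T ^^ j \<longrightarrow> (x, u) \<in> child_rel T ^^ k \<longrightarrow> j + k < R \<longrightarrow>
        u \<notin> leaves T (child_rel T))"
    by (simp add: tree_border_dist_def border_dist_ge_iff)
  also have "\<dots> \<longleftrightarrow> far R T v"
  proof
    assume *: "\<forall>x j k u. (x, v) \<in> child_rel T ^^ j \<longrightarrow> (x, u) \<in> child_rel T ^^ k \<longrightarrow> j + k < R \<longrightarrow>
        u \<notin> leaves T (child_rel T)"
    show "far R T v"
      unfolding far_def
    proof (intro allI impI)
      fix x y u assume xyu: "v = x @ y" "x @ u \<in> T" "length y + length u < R"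
      have x: "x \<in> T" using T xyu plane_tree_prefix by blast
      have "(x, v) \<in> child_rel T ^^ length y" "(x, x @ u) \<in> child_rel T ^^ length u"
        using relpow_child_rel[OF T(1) x] xyu T by auto
      then have "x @ u \<notin> leaves T (child_rel T)" using * xyu by blast
      then show "child_rel T `` {x @ u} \<noteq> {}" using xyu by (simp add: leaves_def)
    qed
  next
    assume f: "far R T v"
    show "\<forall>x j k u. (x, v) \<in> child_rel T ^^ j \<longrightarrow> (x, u) \<in> child_rel T ^^ k \<longrightarrow> j + k < R \<longrightarrow>
        u \<notin> leaves T (child_rel T)"
    proof (intro allI impI)
      fix x j k u assume *: "(x, v) \<in> child_rel T ^^ j" "(x, u) \<in> child_rel T ^^ k" "j + k < R"
      have x: "x \<in> T"
      proof (cases j)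
        case 0
        then show ?thesis using * T by simp
      next
        case (Suc j')
        then obtain z where "(x, z) \<in> child_rel T"
          using *(1) relpow_Suc_D2[of x v j' "child_rel T"] by auto
        then show ?thesis by (simp add: child_rel_def)
      qed
      obtain y where y: "length y = j" "v = x @ y" using *(1) relpow_child_rel[OF T(1) x] by blast
      obtain u' where u': "length u' = k" "u = x @ u'" "u \<in> T" using *(2) relpow_child_rel[OF T(1) x] by blast
      have "child_rel T `` {u} \<noteq> {}" using f *(3) y u' unfolding far_def by blast
      then show "u \<notin> leaves T (child_rel T)" by (simp add: leaves_def)
    qed
  qed
  finally show ?thesis .
qed

lemma length_less_card:
  assumes "plane_tree T" "v \<in> T"
  shows "length v < card T"
proof -
  have "(\<lambda>j. take j v) ` {..length v} \<subseteq> T"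
  proof
    fix u assume "u \<in> (\<lambda>j. take j v) ` {..length v}"
    then obtain j where "u = take j v" by auto
    then show "u \<in> T" using assms plane_tree_prefix[OF assms(1), of u "drop j v"] by simp
  qed
  then have "card ((\<lambda>j. take j v) ` {..length v}) \<le> card T"
    by (intro card_mono plane_tree_finite assms)
  moreover have "inj_on (\<lambda>j. take j v) {..length v}"
    by (auto intro!: inj_onI dest: arg_cong[of _ _ length])
  ultimately show ?thesis by (simp add: card_image)
qed

section \<open>Generating functions of plane trees\<close>

definition gf :: "('a \<Rightarrow> nat) \<Rightarrow> ('a \<Rightarrow> real) \<Rightarrow> 'a set \<Rightarrow> real fps" where
  "gf sz wt A = Abs_fps (\<lambda>n. sum wt {a \<in> A. sz a = n})"

text \<open>Over an infinite fibre \<open>sum\<close> would take its default value 0, and the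
  product rule would break down.\<close>

definition fin_fibers :: "('a \<Rightarrow> nat) \<Rightarrow> 'a set \<Rightarrow> bool" where
  "fin_fibers sz A \<longleftrightarrow> (\<forall>n. finite {a \<in> A. sz a = n})"

lemma gf_nth: "gf sz wt A $ n = sum wt {a \<in> A. sz a = n}"
  by (simp add: gf_def)

lemma fin_fibersD: "fin_fibers sz A \<Longrightarrow> finite {a \<in> A. sz a = n}"
  by (simp add: fin_fibers_def)

lemma fin_fibers_subset: "fin_fibers sz B \<Longrightarrow> A \<subseteq> B \<Longrightarrow> fin_fibers sz A"
  unfolding fin_fibers_def
proof
  fix n assume "\<forall>n. finite {a \<in> B. sz a = n}" "A \<subseteq> B"
  then show "finite {a \<in> A. sz a = n}"
    by (intro finite_subset[of "{a \<in> A. sz a = n}" "{a \<in> B. sz a = n}"]) auto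
qed

lemma times_fiber:
  "{ab \<in> A \<times> B. (\<lambda>(a, b). sz a + sz' b) ab = n} =
    (\<Union>i\<in>{0..n}. {a \<in> A. sz a = i} \<times> {b \<in> B. sz' b = n - i})"
  for n :: nat
  by auto

lemma gf_times:
  assumes "fin_fibers sz A" "fin_fibers sz' B"
  shows "gf (\<lambda>(a, b). sz a + sz' b) (\<lambda>(a, b). wt a * wt' b) (A \<times> B) = gf sz wt A * gf sz' wt' B"
    and "fin_fibers (\<lambda>(a, b). sz a + sz' b) (A \<times> B)"
proof -
  have fin: "finite ({a \<in> A. sz a = i} \<times> {b \<in> B. sz' b = j})" for i j
    using assms by (intro finite_cartesian_product fin_fibersD)
  then show "fin_fibers (\<lambda>(a, b). sz a + sz' b) (A \<times> B)"
    unfolding fin_fibers_def times_fiber by blast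
  show "gf (\<lambda>(a, b). sz a + sz' b) (\<lambda>(a, b). wt a * wt' b) (A \<times> B) = gf sz wt A * gf sz' wt' B"
  proof (rule fps_ext)
    fix n
    have "gf (\<lambda>(a, b). sz a + sz' b) (\<lambda>(a, b). wt a * wt' b) (A \<times> B) $ n =
        (\<Sum>i=0..n. \<Sum>ab\<in>{a \<in> A. sz a = i} \<times> {b \<in> B. sz' b = n - i}. (\<lambda>(a, b). wt a * wt' b) ab)"
      unfolding gf_nth times_fiber using fin by (intro sum.UNION_disjoint) auto
    also have "\<dots> = (\<Sum>i=0..n. gf sz wt A $ i * gf sz' wt' B $ (n - i))"
      by (simp add: gf_nth sum_product sum.cartesian_product)
    finally show "gf (\<lambda>(a, b). sz a + sz' b) (\<lambda>(a, b). wt a * wt' b) (A \<times> B) $ n =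
        (gf sz wt A * gf sz' wt' B) $ n"
      by (simp add: fps_mult_nth)
  qed
qed

lemma gf_image:
  assumes "inj_on f A" "\<And>a. a \<in> A \<Longrightarrow> sz' (f a) = sz a" "\<And>a. a \<in> A \<Longrightarrow> wt' (f a) = wt a"
  shows "gf sz' wt' (f ` A) = gf sz wt A"
    and "fin_fibers sz A \<Longrightarrow> fin_fibers sz' (f ` A)"
proof -
  have eq: "{b \<in> f ` A. sz' b = n} = f ` {a \<in> A. sz a = n}" for n
    using assms(2) by auto
  show "gf sz' wt' (f ` A) = gf sz wt A"
  proof (rule fps_ext)
    fix n
    show "gf sz' wt' (f ` A) $ n = gf sz wt A $ n"
      unfolding gf_nth eq using assms(3)
      by (subst sum.reindex) (auto intro: inj_on_subset[OF assms(1)])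
  qed
  show "fin_fibers sz A \<Longrightarrow> fin_fibers sz' (f ` A)"
    unfolding fin_fibers_def eq by blast
qed

definition lists_of :: "'a set \<Rightarrow> nat \<Rightarrow> 'a list set" where
  "lists_of A k = {ts. set ts \<subseteq> A \<and> length ts = k}"

lemma gf_lists:
  assumes "fin_fibers sz A"
  shows "gf (\<lambda>ts. \<Sum>t\<leftarrow>ts. sz t) (\<lambda>ts. \<Prod>t\<leftarrow>ts. wt t) (lists_of A k) = gf sz wt A ^ k"
    and "fin_fibers (\<lambda>ts. \<Sum>t\<leftarrow>ts. sz t) (lists_of A k)"
proof (induction k)
  case 0
  have [simp]: "lists_of A 0 = {[]}" by (auto simp: lists_of_def)
  have [simp]: "{a. a = [] \<and> sum_list (map sz a) = n} = (if n = 0 then {[]} else {})" for n by auto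
  case 1 show ?case by (rule fps_ext) (simp add: gf_nth)
  case 2 show ?case by (simp add: fin_fibers_def)
next
  case (Suc k)
  let ?f = "\<lambda>(a, ts). a # ts"
  have img: "lists_of A (Suc k) = ?f ` (A \<times> lists_of A k)"
  proof (intro equalityI subsetI)
    fix ts assume "ts \<in> lists_of A (Suc k)"
    then show "ts \<in> ?f ` (A \<times> lists_of A k)"
      by (cases ts) (auto simp: lists_of_def intro!: image_eqI[of _ _ "(hd ts, tl ts)"])
  qed (auto simp: lists_of_def)
  have inj: "inj_on ?f (A \<times> lists_of A k)" by (auto intro!: inj_onI)
  case 1
  have "gf (\<lambda>ts. \<Sum>t\<leftarrow>ts. sz t) (\<lambda>ts. \<Prod>t\<leftarrow>ts. wt t) (lists_of A (Suc k)) =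
      gf (\<lambda>(a, ts). sz a + (\<Sum>t\<leftarrow>ts. sz t)) (\<lambda>(a, ts). wt a * (\<Prod>t\<leftarrow>ts. wt t)) (A \<times> lists_of A k)"
    unfolding img by (rule gf_image(1)[OF inj]) auto
  then show ?case using Suc assms by (simp add: gf_times)
  case 2
  show ?case
    unfolding img
    by (rule gf_image(2)[OF inj _ _ gf_times(2)[OF assms Suc(2)], where wt = "\<lambda>_. 0" and wt' = "\<lambda>_. 0"]) auto
qed

lemma fin_fibers_plane_trees: "A \<subseteq> Collect plane_tree \<Longrightarrow> fin_fibers card A"
  using finite_plane_trees
  by (intro fin_fibers_subset[of card "Collect plane_tree" A]) (auto simp: fin_fibers_def plane_trees_def)

lemma finite_tree_lists:
  assumes "A \<subseteq> Collect plane_tree"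
  shows "finite {ts. set ts \<subseteq> A \<and> (\<Sum>t\<leftarrow>ts. card t) = m}"
proof (rule finite_subset)
  show "{ts. set ts \<subseteq> A \<and> (\<Sum>t\<leftarrow>ts. card t) = m} \<subseteq> (\<Union>j\<le>m. {ts \<in> lists_of A j. (\<Sum>t\<leftarrow>ts. card t) = m})"
    using length_le_sum_card assms by (auto simp: lists_of_def)
  show "finite (\<Union>j\<le>m. {ts \<in> lists_of A j. (\<Sum>t\<leftarrow>ts. card t) = m})"
    using fin_fibersD[OF gf_lists(2)[OF fin_fibers_plane_trees[OF assms]]] by auto
qed

text \<open>The predicate \<open>Q\<close> on the root degree covers both all trees and the trees
  whose root is not a leaf.\<close>

lemma gf_node:
  assumes A: "A \<subseteq> Collect plane_tree"
  shows "gf card (tree_weight w) {node ts | ts. set ts \<subseteq> A \<and> Q (length ts)} =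
    fps_X * (Abs_fps (\<lambda>j. if Q j then w j else 0) oo gf card (tree_weight w) A)"
    (is "gf _ _ ?N = fps_X * (?a oo ?F)")
proof (rule fps_ext)
  fix n
  have pt: "t \<in> set ts \<Longrightarrow> plane_tree t" if "set ts \<subseteq> A" for t ts using that A by auto
  show "gf card (tree_weight w) ?N $ n = (fps_X * (?a oo ?F)) $ n"
  proof (cases n)
    case 0
    have empty: "{T \<in> ?N. card T = 0} = {}"
      using card_node[OF pt] by auto
    show ?thesis unfolding 0 gf_nth empty by simp
  next
    case (Suc m)
    define S where "S = {ts. set ts \<subseteq> A \<and> Q (length ts) \<and> (\<Sum>t\<leftarrow>ts. card t) = m}"
    have fin: "finite S"
      unfolding S_def by (rule finite_subset[OF _ finite_tree_lists[OF A, of m]]) auto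
    have "{T \<in> ?N. card T = Suc m} = node ` S"
      unfolding S_def using card_node[OF pt] by auto
    then have "gf card (tree_weight w) ?N $ n = sum (tree_weight w) (node ` S)"
      by (simp add: gf_nth Suc)
    also have "\<dots> = (\<Sum>ts\<in>S. tree_weight w (node ts))"
    proof (rule sum.reindex_cong[OF _ refl refl])
      show "inj_on node S"
        unfolding S_def by (rule inj_onI) (metis (mono_tags, lifting) mem_Collect_eq node_inject pt)
    qed
    also have "\<dots> = (\<Sum>ts\<in>S. w (length ts) * (\<Prod>t\<leftarrow>ts. tree_weight w t))"
      by (intro sum.cong refl tree_weight_node pt) (auto simp: S_def)
    also have "\<dots> = (\<Sum>j\<in>{0..m}. \<Sum>ts\<in>{ts \<in> S. length ts = j}. w (length ts) * (\<Prod>t\<leftarrow>ts. tree_weight w t))"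
    proof (rule sum.group[symmetric, OF fin])
      show "length ` S \<subseteq> {0..m}"
        using length_le_sum_card[OF pt] by (auto simp: S_def)
    qed simp
    also have "\<dots> = (\<Sum>j\<in>{0..m}. ?a $ j * (?F ^ j) $ m)"
    proof (intro sum.cong refl)
      fix j
      have "{ts \<in> S. length ts = j} = (if Q j then {ts \<in> lists_of A j. (\<Sum>t\<leftarrow>ts. card t) = m} else {})"
        by (auto simp: S_def lists_of_def)
      moreover have "(?F ^ j) $ m = (\<Sum>ts\<in>{ts \<in> lists_of A j. (\<Sum>t\<leftarrow>ts. card t) = m}. \<Prod>t\<leftarrow>ts. tree_weight w t)"
        by (simp add: gf_lists(1)[OF fin_fibers_plane_trees[OF A], symmetric] gf_nth)
      ultimately show "(\<Sum>ts\<in>{ts \<in> S. length ts = j}. w (length ts) * (\<Prod>t\<leftarrow>ts. tree_weight w t)) =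
          ?a $ j * (?F ^ j) $ m"
        by (auto simp: sum_distrib_left lists_of_def intro!: sum.cong)
    qed
    also have "\<dots> = (fps_X * (?a oo ?F)) $ n"
      by (simp add: Suc fps_compose_nth)
    finally show ?thesis .
  qed
qed

definition trees_gf :: "(nat \<Rightarrow> real) \<Rightarrow> real fps" where
  "trees_gf w = gf card (tree_weight w) (Collect plane_tree)"

lemma tree_weight_nonneg: "weight_sequence w \<Longrightarrow> 0 \<le> tree_weight w T"
  unfolding tree_weight_def weight_sequence_def by (intro prod_nonneg) auto

locale sgt =
  fixes w :: "nat \<Rightarrow> real"
  assumes weights: "weight_sequence w"

sublocale sgt \<subseteq> weighted_trees w "trees_gf w"
proof
  show "0 \<preceq> trees_gf w"
    unfolding trees_gf_def fps_le_def using tree_weight_nonneg[OF weights]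
    by (auto simp: gf_nth intro: sum_nonneg)
  have "Collect plane_tree = {node ts | ts. set ts \<subseteq> Collect plane_tree \<and> True}"
    by (auto elim!: plane_tree_cases intro!: plane_tree_node)
  from arg_cong[OF this, of "gf card (tree_weight w)"]
  show "trees_gf w = fps_X * (Abs_fps w oo trees_gf w)"
    unfolding trees_gf_def by (subst (asm) gf_node) auto
qed (rule weights)

context sgt
begin

lemma D_gf: "D k = gf card (tree_weight w) {T. plane_tree T \<and> noleaf k T}"
proof (induction k)
  case 0
  show ?case unfolding D.simps(1) by (simp add: trees_gf_def)
next
  case (Suc k)
  let ?A = "{T. plane_tree T \<and> noleaf k T}"
  have eq: "{T. plane_tree T \<and> noleaf (Suc k) T} = {node ts | ts. set ts \<subseteq> ?A \<and> length ts \<noteq> 0}"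
    (is "?L = ?R")
  proof (intro equalityI subsetI)
    fix T assume T: "T \<in> ?L"
    then obtain ts where ts: "T = node ts" "\<And>t. t \<in> set ts \<Longrightarrow> plane_tree t"
      by (auto elim: plane_tree_cases)
    then show "T \<in> ?R" using T noleaf_node[OF ts(2)] by auto
  next
    fix T assume "T \<in> ?R"
    then obtain ts where ts: "T = node ts" "set ts \<subseteq> ?A" "ts \<noteq> []" by auto
    have pt: "t \<in> set ts \<Longrightarrow> plane_tree t" for t using ts by auto
    show "T \<in> ?L" using ts noleaf_node[OF pt] plane_tree_node[OF pt] by auto
  qed
  have "gf card (tree_weight w) {T. plane_tree T \<and> noleaf (Suc k) T} =
      fps_X * (Abs_fps (\<lambda>j. if j \<noteq> 0 then w j else 0) oo D k)"
    unfolding eq by (subst gf_node[where Q = "\<lambda>j. j \<noteq> 0"]) (auto simp: Suc)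
  also have "Abs_fps (\<lambda>j. if j \<noteq> 0 then w j else 0) = \<Phi> - fps_const (w 0)"
    by (rule fps_ext) simp
  finally show ?case by (simp add: D.simps)
qed

definition pointed_trees :: "nat \<Rightarrow> nat \<Rightarrow> (nat list set \<times> nat list) set" where
  "pointed_trees R h = {(T, v). plane_tree T \<and> v \<in> T \<and> length v = h \<and> far R T v}"

abbreviation "pgf R h \<equiv> gf (\<lambda>(T, v). card T) (\<lambda>(T, v). tree_weight w T) (pointed_trees R h)"

lemma fin_fibers_pointed: "fin_fibers (\<lambda>(T, v). card T) (pointed_trees R h)"
  unfolding fin_fibers_def
proof
  fix n
  have "{Tv \<in> pointed_trees R h. (\<lambda>(T, v). card T) Tv = n} \<subseteq> (SIGMA T:plane_trees n. T)"
    by (auto simp: pointed_trees_def plane_trees_def)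
  moreover have "finite (SIGMA T:plane_trees n. T)"
    using finite_plane_trees by (intro finite_SigmaI) (auto simp: plane_trees_def plane_tree_finite)
  ultimately show "finite {Tv \<in> pointed_trees R h. (\<lambda>(T, v). card T) Tv = n}"
    by (rule finite_subset)
qed

lemma pgf_0: "pgf R 0 = D R"
proof -
  have eq: "pointed_trees R 0 = (\<lambda>T. (T, [])) ` {T. plane_tree T \<and> noleaf R T}"
    by (auto simp: pointed_trees_def far_Nil plane_tree_Nil)
  show ?thesis
    unfolding eq D_gf by (rule gf_image(1)) (auto intro: inj_onI)
qed

text \<open>Cutting at the root leaves the subtrees left of the path, a tree with a marked vertex of
  height \<open>h\<close>, and the subtrees right of the path. With \<open>k\<close> siblings there
  are \<open>k + 1\<close> splittings into left and right, which produces the coefficient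
  \<open>(k + 1) * w (k + 1)\<close> of \<open>fps_deriv \<Phi>\<close>.\<close>

lemma pgf_Suc: "pgf R (Suc h) = pgf R h * A (R - h - 2)"
proof (rule fps_ext)
  fix n
  define S where "S = {T. plane_tree T \<and> noleaf (R - h - 2) T}"
  define F where "F = D (R - h - 2)"
  define P where "P = pointed_trees R h"
  define glue :: "nat list set list \<times> (nat list set \<times> nat list) \<times> nat list set list \<Rightarrow> nat list set \<times> nat list"
    where "glue = (\<lambda>(ls, (U, v), rs). (node (ls @ U # rs), length ls # v))"
  \<comment> \<open>The nesting of \<open>size3\<close> and \<open>weight3\<close> is that of two
    applications of \<open>gf_times\<close>.\<close>
  define size3 :: "nat list set list \<times> (nat list set \<times> nat list) \<times> nat list set list \<Rightarrow> nat"
    where "size3 = (\<lambda>(ls, q). (\<Sum>t\<leftarrow>ls. card t) + (\<lambda>(Uv, rs). (\<lambda>(U, v). card U) Uv + (\<Sum>t\<leftarrow>rs. card t)) q)"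
  define weight3 :: "nat list set list \<times> (nat list set \<times> nat list) \<times> nat list set list \<Rightarrow> real"
    where "weight3 = (\<lambda>(ls, q). (\<Prod>t\<leftarrow>ls. tree_weight w t) *
      (\<lambda>(Uv, rs). (\<lambda>(U, v). tree_weight w U) Uv * (\<Prod>t\<leftarrow>rs. tree_weight w t)) q)"
  define X where "X = {(ls, Uv, rs). set ls \<subseteq> S \<and> Uv \<in> P \<and> set rs \<subseteq> S}"
  have pt: "\<And>t. t \<in> set (ls @ U # rs) \<Longrightarrow> plane_tree t" if "(ls, (U, v), rs) \<in> X" for ls U v rs
    using that by (auto simp: X_def S_def P_def pointed_trees_def)
  have SP: "S \<subseteq> Collect plane_tree" by (auto simp: S_def)
  have glue_in: "glue q \<in> pointed_trees R (Suc h)" if "q \<in> X" for q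
  proof -
    obtain ls U v rs where q: "q = (ls, (U, v), rs)" by (metis prod.exhaust)
    note pt' = pt[OF that[unfolded q]]
    have Uv: "v \<in> U" "length v = h" "far R U v" "set ls \<subseteq> S" "set rs \<subseteq> S"
      using that q by (auto simp: X_def P_def pointed_trees_def)
    have "far R (node (ls @ U # rs)) (length ls # v)"
    proof (subst far_node_Cons[OF pt'], goal_cases)
      case 3
      have "noleaf (R - h - 2) ((ls @ U # rs) ! l)"
        if "l < length (ls @ U # rs)" "l \<noteq> length ls" for l
      proof -
        have "(ls @ U # rs) ! l \<in> set ls \<union> set rs"
          using that by (auto simp: nth_append nth_Cons split: nat.splits)
        then show ?thesis using Uv by (auto simp: S_def)
      qed
      then show ?case using Uv by simp
    qed auto
    moreover have "plane_tree (node (ls @ U # rs))" by (rule plane_tree_node[OF pt'])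
    ultimately show ?thesis
      unfolding q glue_def pointed_trees_def using Uv by simp
  qed
  have glue_surj: "\<exists>q\<in>X. Tv = glue q" if Tv_in: "Tv \<in> pointed_trees R (Suc h)" for Tv
  proof -
    obtain T v' where Tv: "Tv = (T, v')" by (cases Tv)
    then have T: "plane_tree T" "v' \<in> T" "length v' = Suc h" "far R T v'"
      using Tv_in by (auto simp: pointed_trees_def)
    obtain ts where ts: "T = node ts" "\<And>t. t \<in> set ts \<Longrightarrow> plane_tree t"
      using T(1) by (auto elim: plane_tree_cases)
    obtain i v where v: "v' = i # v" "length v = h" using T(3) by (cases v') auto
    have i: "i < length ts" "v \<in> ts ! i" using T ts v by auto
    have split: "ts = take i ts @ ts ! i # drop (Suc i) ts" using i by (simp add: id_take_nth_drop)
    have f: "far R (ts ! i) v" "\<And>l. l < length ts \<Longrightarrow> l \<noteq> i \<Longrightarrow> noleaf (R - h - 2) (ts ! l)"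
      using T(4) far_node_Cons[OF ts(2) i(1), of R v] unfolding ts v by auto
    have "set (take i ts) \<subseteq> S"
    proof
      fix t assume "t \<in> set (take i ts)"
      then obtain l where "l < i" "t = ts ! l"
        using i by (auto simp: in_set_conv_nth)
      then show "t \<in> S" using f(2)[of l] ts(2)[of t] i by (auto simp: S_def)
    qed
    moreover have "set (drop (Suc i) ts) \<subseteq> S"
    proof
      fix t assume "t \<in> set (drop (Suc i) ts)"
      then obtain l where "l < length ts - Suc i" "t = ts ! (Suc i + l)"
        by (auto simp: in_set_conv_nth)
      then show "t \<in> S" using f(2)[of "Suc i + l"] ts(2)[of t] by (auto simp: S_def)
    qed
    ultimately have "(take i ts, (ts ! i, v), drop (Suc i) ts) \<in> X"
      using i f(1) v ts(2)[of "ts ! i"] by (auto simp: X_def P_def pointed_trees_def)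
    moreover have "Tv = glue (take i ts, (ts ! i, v), drop (Suc i) ts)"
      using split i by (simp add: glue_def Tv ts v)
    ultimately show ?thesis by blast
  qed
  have img: "pointed_trees R (Suc h) = glue ` X"
    using glue_in glue_surj by blast
  have inj: "inj_on glue X"
  proof (rule inj_onI)
    fix q q' assume qX: "q \<in> X" "q' \<in> X" and eq: "glue q = glue q'"
    obtain ls U v rs where q: "q = (ls, (U, v), rs)" by (metis prod.exhaust)
    obtain ls' U' v' rs' where q': "q' = (ls', (U', v'), rs')" by (metis prod.exhaust)
    have "node (ls @ U # rs) = node (ls' @ U' # rs')" "length ls = length ls'" "v = v'"
      using eq by (auto simp: glue_def q q')
    moreover from this(1) have "ls @ U # rs = ls' @ U' # rs'"
      by (rule node_inject[THEN iffD1, rotated 2])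
        (use pt[OF qX(1)[unfolded q]] pt[OF qX(2)[unfolded q']] in auto)
    ultimately show "q = q'" by (simp add: q q')
  qed
  have card_glue: "(\<lambda>(T, v). card T) (glue q) = Suc (size3 q)" if "q \<in> X" for q
  proof -
    obtain ls U v rs where q: "q = (ls, (U, v), rs)" by (metis prod.exhaust)
    have "card (node (ls @ U # rs)) = Suc (\<Sum>t\<leftarrow>ls @ U # rs. card t)"
      by (rule card_node) (rule pt[OF that[unfolded q]])
    then show ?thesis by (simp add: q glue_def size3_def)
  qed
  have weight_glue: "(\<lambda>(T, v). tree_weight w T) (glue q) =
      w (Suc (length (fst q) + length (snd (snd q)))) * weight3 q" if "q \<in> X" for q
  proof -
    obtain ls U v rs where q: "q = (ls, (U, v), rs)" by (metis prod.exhaust)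
    have "tree_weight w (node (ls @ U # rs)) =
        w (length (ls @ U # rs)) * (\<Prod>t\<leftarrow>ls @ U # rs. tree_weight w t)"
      by (rule tree_weight_node) (rule pt[OF that[unfolded q]])
    then show ?thesis by (simp add: q glue_def weight3_def)
  qed
  show "pgf R (Suc h) $ n = (pgf R h * A (R - h - 2)) $ n"
  proof (cases n)
    case 0
    have empty: "{Tv \<in> pointed_trees R (Suc h). (\<lambda>(T, v). card T) Tv = 0} = {}"
      using card_plane_tree_pos by (fastforce simp: pointed_trees_def)
    show ?thesis unfolding 0 gf_nth empty by (simp add: A_def)
  next
    case (Suc m)
    define Xm where "Xm = {q \<in> X. size3 q = m}"
    have fin_lists: "fin_fibers (\<lambda>ts. \<Sum>t\<leftarrow>ts. card t) (lists_of S a)" for a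
      by (rule gf_lists(2)[OF fin_fibers_plane_trees[OF SP]])
    have gf3: "gf size3 weight3 (lists_of S a \<times> P \<times> lists_of S b) = F ^ (a + b) * pgf R h"
      and fin3: "fin_fibers size3 (lists_of S a \<times> P \<times> lists_of S b)" for a b
    proof -
      have FS: "F = gf card (tree_weight w) S" by (simp add: F_def S_def D_gf)
      have FP: "fin_fibers (\<lambda>(T, v). card T) P" unfolding P_def by (rule fin_fibers_pointed)
      note inner2 = gf_times(2)[OF FP fin_lists[of b]]
      note inner1 = gf_times(1)[OF FP fin_lists[of b], where wt = "\<lambda>(T, v). tree_weight w T"
          and wt' = "\<lambda>ts. \<Prod>t\<leftarrow>ts. tree_weight w t"]
      note outer2 = gf_times(2)[OF fin_lists[of a] inner2]
      note outer1 = gf_times(1)[OF fin_lists[of a] inner2, where wt = "\<lambda>ts. \<Prod>t\<leftarrow>ts. tree_weight w t"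
          and wt' = "\<lambda>(Uv, rs). (\<lambda>(U, v). tree_weight w U) Uv * (\<Prod>t\<leftarrow>rs. tree_weight w t)"]
      show "fin_fibers size3 (lists_of S a \<times> P \<times> lists_of S b)"
        unfolding size3_def by (rule outer2)
      have "gf size3 weight3 (lists_of S a \<times> P \<times> lists_of S b) = F ^ a * (pgf R h * F ^ b)"
        unfolding size3_def weight3_def outer1 inner1
        by (simp add: gf_lists(1)[OF fin_fibers_plane_trees[OF SP]] FS P_def)
      then show "gf size3 weight3 (lists_of S a \<times> P \<times> lists_of S b) = F ^ (a + b) * pgf R h"
        by (simp add: power_add ac_simps)
    qed
    have len: "length (fst q) + length (snd (snd q)) \<le> m" if "q \<in> Xm" for q
    proof -
      obtain ls U v rs where q: "q = (ls, (U, v), rs)" by (metis prod.exhaust)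
      have qX: "(ls, (U, v), rs) \<in> X" using that by (simp add: Xm_def q)
      have "length ls \<le> (\<Sum>t\<leftarrow>ls. card t)" "length rs \<le> (\<Sum>t\<leftarrow>rs. card t)"
        using pt[OF qX] by (auto intro!: length_le_sum_card)
      then show ?thesis using that by (simp add: Xm_def q size3_def)
    qed
    have fib: "{q \<in> Xm. (length (fst q), length (snd (snd q))) = (a, b)} =
        {q \<in> lists_of S a \<times> P \<times> lists_of S b. size3 q = m}" for a b
      by (auto simp: Xm_def X_def lists_of_def)
    have fin: "finite Xm"
    proof (rule finite_subset)
      show "Xm \<subseteq> (\<Union>a\<le>m. \<Union>b\<le>m. {q \<in> lists_of S a \<times> P \<times> lists_of S b. size3 q = m})"
      proof
        fix q assume q: "q \<in> Xm"
        have "q \<in> {q \<in> lists_of S (length (fst q)) \<times> P \<times> lists_of S (length (snd (snd q))). size3 q = m}"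
          using q by (auto simp: Xm_def X_def lists_of_def)
        then show "q \<in> (\<Union>a\<le>m. \<Union>b\<le>m. {q \<in> lists_of S a \<times> P \<times> lists_of S b. size3 q = m})"
          using len[OF q] by (intro UN_I[of "length (fst q)"] UN_I[of "length (snd (snd q))"]) auto
      qed
      show "finite (\<Union>a\<le>m. \<Union>b\<le>m. {q \<in> lists_of S a \<times> P \<times> lists_of S b. size3 q = m})"
        using fin_fibersD[OF fin3] by auto
    qed
    have "pgf R (Suc h) $ n = (\<Sum>q\<in>Xm. (\<lambda>(T, v). tree_weight w T) (glue q))"
    proof -
      have "{Tv \<in> pointed_trees R (Suc h). (\<lambda>(T, v). card T) Tv = n} = glue ` Xm"
      proof (intro equalityI subsetI)
        fix Tv assume "Tv \<in> {Tv \<in> pointed_trees R (Suc h). (\<lambda>(T, v). card T) Tv = n}"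
        then obtain q where q: "q \<in> X" "Tv = glue q" "(\<lambda>(T, v). card T) (glue q) = n"
          unfolding img by blast
        then have "size3 q = m" using card_glue[OF q(1)] Suc by simp
        then show "Tv \<in> glue ` Xm" using q by (simp add: Xm_def)
      next
        fix Tv assume "Tv \<in> glue ` Xm"
        then obtain q where q: "q \<in> X" "Tv = glue q" "size3 q = m" by (auto simp: Xm_def)
        then have "(\<lambda>(T, v). card T) (glue q) = n" using card_glue[OF q(1)] Suc by simp
        then show "Tv \<in> {Tv \<in> pointed_trees R (Suc h). (\<lambda>(T, v). card T) Tv = n}"
          using q glue_in by simp
      qed
      then show ?thesis
        unfolding gf_nth
        by (simp only:) (rule sum.reindex_cong[OF inj_on_subset[OF inj] refl refl], auto simp: Xm_def)
    qed
    also have "\<dots> = (\<Sum>q\<in>Xm. w (Suc (length (fst q) + length (snd (snd q)))) * weight3 q)"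
      by (intro sum.cong refl weight_glue) (simp add: Xm_def)
    also have "\<dots> = (\<Sum>ab\<in>{(i, j). i + j \<le> m}. \<Sum>q\<in>{q \<in> Xm. (length (fst q), length (snd (snd q))) = ab}.
        w (Suc (length (fst q) + length (snd (snd q)))) * weight3 q)"
    proof (rule sum.group[symmetric, OF fin])
      have "{(i, j). i + j \<le> m} \<subseteq> {..m} \<times> {..m}" by auto
      then show "finite {(i, j). i + j \<le> m}" by (rule finite_subset) auto
      show "(\<lambda>q. (length (fst q), length (snd (snd q)))) ` Xm \<subseteq> {(i, j). i + j \<le> m}"
        using len by auto
    qed
    also have "\<dots> = (\<Sum>(a, b)\<in>{(i, j). i + j \<le> m}. w (Suc (a + b)) * (F ^ (a + b) * pgf R h) $ m)"
    proof (intro sum.cong refl, clarify)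
      fix a b
      have "(\<Sum>q\<in>{q \<in> Xm. (length (fst q), length (snd (snd q))) = (a, b)}.
          w (Suc (length (fst q) + length (snd (snd q)))) * weight3 q) =
          (\<Sum>q\<in>{q \<in> lists_of S a \<times> P \<times> lists_of S b. size3 q = m}. w (Suc (a + b)) * weight3 q)"
        unfolding fib by (intro sum.cong refl) (auto simp: lists_of_def)
      also have "\<dots> = w (Suc (a + b)) * gf size3 weight3 (lists_of S a \<times> P \<times> lists_of S b) $ m"
        by (simp add: gf_nth sum_distrib_left)
      finally show "(\<Sum>q\<in>{q \<in> Xm. (length (fst q), length (snd (snd q))) = (a, b)}.
          w (Suc (length (fst q) + length (snd (snd q)))) * weight3 q) =
          w (Suc (a + b)) * (F ^ (a + b) * pgf R h) $ m"
        unfolding gf3 .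
    qed
    also have "\<dots> = (\<Sum>k\<le>m. \<Sum>i\<le>k. w (Suc (i + (k - i))) * (F ^ (i + (k - i)) * pgf R h) $ m)"
      by (rule sum.triangle_reindex_eq)
    also have "\<dots> = (\<Sum>k\<le>m. fps_deriv \<Phi> $ k * (F ^ k * pgf R h) $ m)"
      by (intro sum.cong refl) simp
    also have "\<dots> = ((fps_deriv \<Phi> oo F) * pgf R h) $ m"
      by (rule fps_compose_mult_nth[symmetric]) (simp_all add: F_def)
    also have "\<dots> = (pgf R h * A (R - h - 2)) $ n"
    proof -
      have "pgf R h * A (R - h - 2) = fps_X * ((fps_deriv \<Phi> oo F) * pgf R h)"
        by (simp add: A_def F_def ac_simps)
      then have "(pgf R h * A (R - h - 2)) $ n = (fps_X * ((fps_deriv \<Phi> oo F) * pgf R h)) $ Suc m"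
        unfolding Suc by (rule arg_cong[of _ _ "\<lambda>F. F $ Suc m"])
      then show ?thesis by (simp only: fps_X_mult_nth nat.distinct if_False diff_Suc_1)
    qed
    finally show ?thesis .
  qed
qed

lemma pgf_eq: "pgf R h = B R h"
proof (induction h)
  case (Suc h)
  have "R - 1 - Suc h = R - h - 2" by simp
  then show ?case by (simp only: pgf_Suc B_Suc Suc)
qed (simp add: pgf_0 B_0)

lemma sum_far_eq_pointed: "(\<Sum>T\<in>plane_trees n. tree_weight w T * real (card {v \<in> T. far R T v})) = pointed R n"
proof -
  define X where "X = (SIGMA T:plane_trees n. {v \<in> T. far R T v})"
  have fin: "finite X"
    unfolding X_def using finite_plane_trees
    by (intro finite_SigmaI) (auto simp: plane_trees_def plane_tree_finite)
  have "(\<Sum>T\<in>plane_trees n. tree_weight w T * real (card {v \<in> T. far R T v})) =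
      (\<Sum>T\<in>plane_trees n. \<Sum>v\<in>{v \<in> T. far R T v}. tree_weight w T)"
    by (simp add: mult.commute)
  also have "\<dots> = (\<Sum>(T, v)\<in>X. tree_weight w T)"
    unfolding X_def using finite_plane_trees
    by (intro sum.Sigma) (auto simp: plane_trees_def plane_tree_finite)
  also have "\<dots> = (\<Sum>h\<in>{..n}. \<Sum>(T, v)\<in>{Tv \<in> X. length (snd Tv) = h}. tree_weight w T)"
  proof (rule sum.group[symmetric, OF fin])
    show "(\<lambda>Tv. length (snd Tv)) ` X \<subseteq> {..n}"
      using length_less_card by (force simp: X_def plane_trees_def)
  qed simp
  also have "\<dots> = (\<Sum>h\<le>n. pgf R h $ n)"
  proof (intro sum.cong refl)
    fix h
    have "{Tv \<in> X. length (snd Tv) = h} = {Tv \<in> pointed_trees R h. (\<lambda>(T, v). card T) Tv = n}"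
      by (auto simp: X_def pointed_trees_def plane_trees_def)
    then show "(\<Sum>(T, v)\<in>{Tv \<in> X. length (snd Tv) = h}. tree_weight w T) = pgf R h $ n"
      by (simp add: gf_nth)
  qed
  finally show ?thesis by (simp add: pgf_eq pointed_def)
qed

end

section \<open>The pointed limit tree\<close>

lemma indep_vars_PiM_coordinates:
  fixes M :: "'i \<Rightarrow> 'a measure"
  assumes "\<And>i. prob_space (M i)"
  shows "prob_space.indep_vars (PiM UNIV M) M (\<lambda>i x. x i) UNIV"
proof -
  interpret prob_space "PiM UNIV M" by (rule prob_space_PiM) (rule assms)
  have "(\<Pi>\<^sub>M i\<in>UNIV. distr (PiM UNIV M) (M i) (\<lambda>x. x i)) = PiM UNIV M"
    by (intro PiM_cong refl distr_PiM_component assms) auto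
  moreover have "distr (PiM UNIV M) (PiM UNIV M) (\<lambda>x. \<lambda>i\<in>UNIV. x i) = PiM UNIV M"
    by (simp add: restrict_UNIV distr_id2)
  ultimately show ?thesis
    by (subst indep_vars_iff_distr_eq_PiM') auto
qed

text \<open>Whole blocks of coordinates are required, because each subtree of the root reads an
  infinite set of words.\<close>

lemma prob_PiM_blocks:
  fixes M :: "'i \<Rightarrow> 'a measure" and L :: "'j set"
  assumes M: "\<And>i. prob_space (M i)" and K: "disjoint_family_on K L" and L: "finite L" "L \<noteq> {}"
    and A: "\<And>j. j \<in> L \<Longrightarrow> A j \<in> sets (PiM (K j) M)"
  shows "measure (PiM UNIV M) {x \<in> space (PiM UNIV M). \<forall>j\<in>L. restrict x (K j) \<in> A j} =
    (\<Prod>j\<in>L. measure (PiM UNIV M) {x \<in> space (PiM UNIV M). restrict x (K j) \<in> A j})"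
proof -
  interpret prob_space "PiM UNIV M" by (rule prob_space_PiM) (rule M)
  have "indep_vars (\<lambda>j. PiM (K j) M) (\<lambda>j x. restrict (\<lambda>i. x i) (K j)) L"
    by (rule indep_vars_restrict[OF indep_vars_PiM_coordinates]) (use M K in auto)
  from indep_varsD[OF this L(2,1) order_refl A]
  have "prob (\<Inter>j\<in>L. (\<lambda>x. restrict x (K j)) -` A j \<inter> space (PiM UNIV M)) =
      (\<Prod>j\<in>L. prob ((\<lambda>x. restrict x (K j)) -` A j \<inter> space (PiM UNIV M)))"
    by simp
  moreover have "(\<Inter>j\<in>L. (\<lambda>x. restrict x (K j)) -` A j \<inter> space (PiM UNIV M)) =
      {x \<in> space (PiM UNIV M). \<forall>j\<in>L. restrict x (K j) \<in> A j}"
    using L by auto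
  moreover have "(\<lambda>x. restrict x (K j)) -` A j \<inter> space (PiM UNIV M) =
      {x \<in> space (PiM UNIV M). restrict x (K j) \<in> A j}" for j
    by auto
  ultimately show ?thesis by simp
qed

text \<open>Recursive form of the absence of leaves at depth less than \<open>k\<close>, parallel to
  the recursion of \<open>surv\<close>.\<close>

fun bgw_noleaf :: "nat \<Rightarrow> (nat list \<Rightarrow> nat) \<Rightarrow> bool" where
  "bgw_noleaf 0 x = True"
| "bgw_noleaf (Suc k) x = (x [] \<noteq> 0 \<and> (\<forall>i. i < x [] \<longrightarrow> bgw_noleaf k (\<lambda>u. x (i # u))))"

lemma Nil_in_bgw_tree [simp]: "[] \<in> bgw_tree x"
  by (simp add: bgw_tree_def)

lemma Cons_in_bgw_tree: "i # u \<in> bgw_tree x \<longleftrightarrow> i < x [] \<and> u \<in> bgw_tree (\<lambda>v. x (i # v))"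
  unfolding bgw_tree_def by (simp add: All_less_Suc2)

lemma snoc_in_bgw_tree: "u @ [i] \<in> bgw_tree x \<longleftrightarrow> u \<in> bgw_tree x \<and> i < x u"
  unfolding bgw_tree_def by (auto simp: nth_append less_Suc_eq)

lemma bgw_noleaf_iff: "bgw_noleaf k x \<longleftrightarrow> (\<forall>u\<in>bgw_tree x. length u < k \<longrightarrow> x u \<noteq> 0)"
proof (induction k arbitrary: x)
  case (Suc k)
  show ?case
  proof
    assume *: "bgw_noleaf (Suc k) x"
    show "\<forall>u\<in>bgw_tree x. length u < Suc k \<longrightarrow> x u \<noteq> 0"
    proof (intro ballI impI)
      fix u assume "u \<in> bgw_tree x" "length u < Suc k"
      then show "x u \<noteq> 0" using * Suc by (cases u) (auto simp: Cons_in_bgw_tree)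
    qed
  next
    assume *: "\<forall>u\<in>bgw_tree x. length u < Suc k \<longrightarrow> x u \<noteq> 0"
    then have "x [] \<noteq> 0" using Nil_in_bgw_tree by (metis length_0_conv zero_less_Suc)
    moreover have "bgw_noleaf k (\<lambda>u. x (i # u))" if "i < x []" for i
      unfolding Suc using * that Cons_in_bgw_tree by (metis Suc_mono length_Cons)
    ultimately show "bgw_noleaf (Suc k) x" by simp
  qed
qed simp

lemma space_bgw [simp]: "space (bgw_space \<xi>) = UNIV"
  by (simp add: bgw_space_def space_PiM PiE_UNIV_domain)

lemma prob_space_bgw: "prob_space (bgw_space \<xi>)"
  unfolding bgw_space_def by (intro prob_space_PiM measure_pmf.prob_space_axioms)

lemma measurable_bgw_subtree [measurable]: "(\<lambda>x u. x (i # u)) \<in> measurable (bgw_space \<xi>) (bgw_space \<xi>)"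
  unfolding bgw_space_def by (intro measurable_abs_UNIV measurable_component_singleton) auto

lemma measurable_pred_component:
  assumes "i \<in> I"
  shows "Measurable.pred (PiM I (\<lambda>_. measure_pmf \<xi>)) (\<lambda>x. P (x i))"
  using measurable_compose[OF measurable_component_singleton[OF assms, of "\<lambda>_. measure_pmf \<xi>"], of P "count_space UNIV"]
  by simp

lemma measurable_bgw_noleaf [measurable]: "Measurable.pred (bgw_space \<xi>) (bgw_noleaf k)"
proof (induction k)
  case (Suc k)
  have "Measurable.pred (bgw_space \<xi>) (\<lambda>x. x [] \<noteq> 0 \<and> (\<forall>i. i < x [] \<longrightarrow> bgw_noleaf k (\<lambda>u. x (i # u))))"
    by (intro pred_intros_logic pred_intros_countable
        measurable_compose[OF measurable_bgw_subtree Suc])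
       (auto simp: bgw_space_def intro!: measurable_pred_component)
  then show ?case by (simp cong: measurable_cong)
qed simp

lemma sets_bgw_noleaf: "Collect (bgw_noleaf k) \<in> sets (bgw_space \<xi>)"
  using measurable_bgw_noleaf[where \<xi> = \<xi> and k = k] by (simp add: pred_def)

lemma emeasure_bgw_noleaf: "emeasure (bgw_space \<xi>) {x. bgw_noleaf k x} = surv \<xi> k"
proof (induction k)
  case 0
  then show ?case using prob_space.emeasure_space_1[OF prob_space_bgw[of \<xi>]] by simp
next
  case (Suc k)
  interpret B: prob_space "bgw_space \<xi>" by (rule prob_space_bgw)
  have subtree: "B.prob {x. bgw_noleaf k (\<lambda>u. x (i # u))} = enn2real (surv \<xi> k)" for i
  proof -
    have "distr (bgw_space \<xi>) (bgw_space \<xi>) (\<lambda>x u. x (i # u)) = bgw_space \<xi>"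
      using distr_PiM_reindex[of UNIV "\<lambda>_. measure_pmf \<xi>" "(#) i" UNIV]
      by (simp add: bgw_space_def measure_pmf.prob_space_axioms restrict_UNIV)
    then have "surv \<xi> k = emeasure (distr (bgw_space \<xi>) (bgw_space \<xi>) (\<lambda>x u. x (i # u))) {x. bgw_noleaf k x}"
      using Suc by simp
    also have "\<dots> = emeasure (bgw_space \<xi>) {x. bgw_noleaf k (\<lambda>u. x (i # u))}"
      by (subst emeasure_distr) (simp_all add: sets_bgw_noleaf vimage_def)
    finally show ?thesis by (simp add: measure_def)
  qed
  have fin: "surv \<xi> k < top" using surv_le_1 by (rule le_less_trans) simp
  have block: "B.prob {x. x [] = j \<and> (\<forall>i. i < j \<longrightarrow> bgw_noleaf k (\<lambda>u. x (i # u)))} =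
      pmf \<xi> j * enn2real (surv \<xi> k) ^ j" for j
  proof -
    \<comment> \<open>Block 0 holds the degree of the root and block \<open>i + 1\<close> the words
      below child \<open>i\<close>. They are disjoint, which gives the branching property.\<close>
    define K :: "nat \<Rightarrow> nat list set" where "K = (\<lambda>a. case a of 0 \<Rightarrow> {[]} | Suc i \<Rightarrow> range ((#) i))"
    define E where "E = (\<lambda>a. case a of 0 \<Rightarrow> {f \<in> space (PiM (K 0) (\<lambda>_. measure_pmf \<xi>)). f [] = j}
      | Suc i \<Rightarrow> {f \<in> space (PiM (K (Suc i)) (\<lambda>_. measure_pmf \<xi>)). bgw_noleaf k (\<lambda>u. f (i # u))})"
    have E: "E a \<in> sets (PiM (K a) (\<lambda>_. measure_pmf \<xi>))" for a
    proof (cases a)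
      case 0
      have "Measurable.pred (PiM (K 0) (\<lambda>_. measure_pmf \<xi>)) (\<lambda>f. f [] = j)"
        by (rule measurable_pred_component) (simp add: K_def)
      then show ?thesis by (simp add: 0 E_def)
    next
      case (Suc i)
      have "(\<lambda>f u. f (i # u)) \<in> measurable (PiM (K (Suc i)) (\<lambda>_. measure_pmf \<xi>)) (bgw_space \<xi>)"
        unfolding bgw_space_def K_def
        by (intro measurable_abs_UNIV measurable_component_singleton) auto
      then have "Measurable.pred (PiM (K (Suc i)) (\<lambda>_. measure_pmf \<xi>)) (\<lambda>f. bgw_noleaf k (\<lambda>u. f (i # u)))"
        by (rule measurable_compose[OF _ measurable_bgw_noleaf])
      then show ?thesis by (simp add: Suc E_def)
    qed
    have dis: "disjoint_family_on K {..j}"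
      by (auto simp: disjoint_family_on_def K_def split: nat.splits)
    have E_0: "restrict x (K 0) \<in> E 0 \<longleftrightarrow> x [] = j" for x
      by (auto simp: E_def K_def space_PiM)
    have E_Suc: "restrict x (K (Suc i)) \<in> E (Suc i) \<longleftrightarrow> bgw_noleaf k (\<lambda>u. x (i # u))" for x i
      by (auto simp: E_def K_def space_PiM)
    have "B.prob {x. \<forall>a\<in>{..j}. restrict x (K a) \<in> E a} = (\<Prod>a\<in>{..j}. B.prob {x. restrict x (K a) \<in> E a})"
      using prob_PiM_blocks[of "\<lambda>_. measure_pmf \<xi>" K "{..j}" E, OF measure_pmf.prob_space_axioms dis _ _ E]
        space_bgw[of \<xi>] by (simp add: bgw_space_def)
    also have "(\<Prod>a\<in>{..j}. B.prob {x. restrict x (K a) \<in> E a}) =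
        B.prob {x. x [] = j} * (\<Prod>i<j. B.prob {x. bgw_noleaf k (\<lambda>u. x (i # u))})"
    proof -
      have "(\<Prod>a\<in>{..j}. B.prob {x. restrict x (K a) \<in> E a}) =
          B.prob {x. restrict x (K 0) \<in> E 0} * (\<Prod>i<j. B.prob {x. restrict x (K (Suc i)) \<in> E (Suc i)})"
        by (rule prod.atMost_shift)
      then show ?thesis by (simp only: E_0 E_Suc)
    qed
    also have "{x. \<forall>a\<in>{..j}. restrict x (K a) \<in> E a} =
        {x. x [] = j \<and> (\<forall>i. i < j \<longrightarrow> bgw_noleaf k (\<lambda>u. x (i # u)))}"
    proof -
      have "(\<forall>a\<in>{..j}. P a) \<longleftrightarrow> P 0 \<and> (\<forall>i<j. P (Suc i))" for P
        by (metis Suc_le_eq atMost_iff le0 not0_implies_Suc)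
      then show ?thesis by (simp only: E_0 E_Suc)
    qed
    also have "B.prob {x. x [] = j} = pmf \<xi> j"
    proof -
      have "distr (bgw_space \<xi>) (measure_pmf \<xi>) (\<lambda>x. x []) = measure_pmf \<xi>"
        unfolding bgw_space_def by (rule distr_PiM_component) (auto intro: measure_pmf.prob_space_axioms)
      then have "pmf \<xi> j = measure (distr (bgw_space \<xi>) (measure_pmf \<xi>) (\<lambda>x. x [])) {j}"
        by (simp add: measure_pmf_single)
      also have "\<dots> = B.prob {x. x [] = j}"
        by (subst measure_distr) (auto simp: bgw_space_def vimage_def space_PiM PiE_UNIV_domain)
      finally show ?thesis ..
    qed
    finally show ?thesis by (simp add: subtree)
  qed
  have meas: "{x. x [] = j \<and> (\<forall>i. i < j \<longrightarrow> bgw_noleaf k (\<lambda>u. x (i # u)))} \<in> sets (bgw_space \<xi>)" for j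
  proof -
    have "Measurable.pred (bgw_space \<xi>) (\<lambda>x. x [] = j \<and> (\<forall>i. i < j \<longrightarrow> bgw_noleaf k (\<lambda>u. x (i # u))))"
      by (intro pred_intros_logic pred_intros_countable
          measurable_compose[OF measurable_bgw_subtree measurable_bgw_noleaf])
         (auto simp: bgw_space_def intro!: measurable_pred_component)
    then show ?thesis by (simp add: pred_def)
  qed
  have "{x. bgw_noleaf (Suc k) x} =
      (\<Union>j. {x. x [] = Suc j \<and> (\<forall>i. i < Suc j \<longrightarrow> bgw_noleaf k (\<lambda>u. x (i # u)))})"
  proof (rule set_eqI)
    fix x
    show "x \<in> {x. bgw_noleaf (Suc k) x} \<longleftrightarrow>
        x \<in> (\<Union>j. {x. x [] = Suc j \<and> (\<forall>i. i < Suc j \<longrightarrow> bgw_noleaf k (\<lambda>u. x (i # u)))})"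
      by (cases "x []") auto
  qed
  then have "emeasure (bgw_space \<xi>) {x. bgw_noleaf (Suc k) x} =
      (\<Sum>j. emeasure (bgw_space \<xi>) {x. x [] = Suc j \<and> (\<forall>i. i < Suc j \<longrightarrow> bgw_noleaf k (\<lambda>u. x (i # u)))})"
    using meas by (simp only:) (rule suminf_emeasure[symmetric], auto simp: disjoint_family_on_def)
  also have "\<dots> = (\<Sum>j. ennreal (pmf \<xi> (Suc j)) * surv \<xi> k ^ Suc j)"
    unfolding B.emeasure_eq_measure block using fin
    by (simp add: ennreal_mult ennreal_power[symmetric])
  also have "\<dots> = (\<Sum>j. ennreal (pmf \<xi> j) * (if j = 0 then 0 else surv \<xi> k ^ j))"
  proof -
    have "(\<lambda>j. ennreal (pmf \<xi> (Suc j)) * (if Suc j = 0 then 0 else surv \<xi> k ^ Suc j)) sums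
        (\<Sum>j. ennreal (pmf \<xi> (Suc j)) * surv \<xi> k ^ Suc j)"
      by (simp only: nat.distinct if_False) (rule summable_sums, simp)
    from sums_Suc[OF this] show ?thesis by (simp add: sums_iff)
  qed
  also have "\<dots> = surv \<xi> (Suc k)"
    by (simp add: nn_integral_measure_pmf nn_integral_count_space_nat)
  finally show ?case .
qed

lemma prob_space_bgw_family: "prob_space (PiM UNIV (\<lambda>_ :: 'i. bgw_space \<xi>))"
  by (intro prob_space_PiM prob_space_bgw)

lemma measurable_pred_bgw_component:
  "Measurable.pred (PiM UNIV (\<lambda>_ :: 'i. bgw_space \<xi>)) (\<lambda>y. bgw_noleaf k (y a))"
  by (rule measurable_compose[OF measurable_component_singleton[of a UNIV "\<lambda>_. bgw_space \<xi>"] measurable_bgw_noleaf]) simp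

lemma space_bgw_family [simp]: "space (PiM UNIV (\<lambda>_ :: 'i. bgw_space \<xi>)) = UNIV"
  by (simp add: space_PiM PiE_UNIV_domain)

lemma emeasure_bgw_family:
  assumes "finite I"
  shows "emeasure (PiM UNIV (\<lambda>_ :: 'i. bgw_space \<xi>)) {y. \<forall>a\<in>I. bgw_noleaf (\<kappa> a) (y a)} =
    (\<Prod>a\<in>I. surv \<xi> (\<kappa> a))"
proof -
  have "{y. \<forall>a\<in>I. bgw_noleaf (\<kappa> a) (y a)} =
      prod_emb UNIV (\<lambda>_ :: 'i. bgw_space \<xi>) I (Pi\<^sub>E I (\<lambda>a. {x. bgw_noleaf (\<kappa> a) x}))"
    by (auto simp: prod_emb_def PiE_iff extensional_def)
  then show ?thesis
    using assms emeasure_bgw_noleaf[of \<xi>]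
    by (simp add: emeasure_PiM_emb prob_space_bgw sets_bgw_noleaf)
qed

text \<open>Any \<open>n\<close> of the independent trees already bound the probability by
  \<open>surv \<xi> k ^ n\<close>. Hence an ancestor with infinitely many children almost surely has
  a leaf within reach.\<close>

lemma emeasure_bgw_family_infinite:
  assumes I: "infinite I" "\<And>a. a \<in> I \<Longrightarrow> \<kappa> a = k" and q: "surv \<xi> k < 1"
  shows "emeasure (PiM UNIV (\<lambda>_ :: 'i. bgw_space \<xi>)) {y. \<forall>a\<in>I. bgw_noleaf (\<kappa> a) (y a)} = 0"
proof -
  let ?M = "PiM UNIV (\<lambda>_ :: 'i. bgw_space \<xi>)"
  have "emeasure ?M {y. \<forall>a\<in>I. bgw_noleaf (\<kappa> a) (y a)} \<le> surv \<xi> k ^ n" for n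
  proof -
    obtain J where J: "J \<subseteq> I" "finite J" "card J = n"
      using infinite_arbitrarily_large[OF I(1)] by blast
    have "Measurable.pred ?M (\<lambda>y. \<forall>a\<in>J. bgw_noleaf (\<kappa> a) (y a))"
      using J(2) by (intro pred_intros_finite measurable_pred_bgw_component)
    then have "{y. \<forall>a\<in>J. bgw_noleaf (\<kappa> a) (y a)} \<in> sets ?M" by (simp add: pred_def)
    then have "emeasure ?M {y. \<forall>a\<in>I. bgw_noleaf (\<kappa> a) (y a)} \<le>
        emeasure ?M {y. \<forall>a\<in>J. bgw_noleaf (\<kappa> a) (y a)}"
      using J by (intro emeasure_mono) auto
    also have "\<dots> = surv \<xi> k ^ n"
      using J I by (subst emeasure_bgw_family) (auto simp: subset_iff)
    finally show ?thesis .
  qed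
  moreover have "(\<lambda>n. surv \<xi> k ^ n) \<longlonglongrightarrow> 0"
  proof -
    define r where "r = enn2real (surv \<xi> k)"
    have r: "surv \<xi> k = ennreal r" "0 \<le> r"
      using q by (auto simp: r_def less_top[symmetric] dest: less_trans[OF _ ennreal_one_less_top])
    have "r < 1" using q r by (metis ennreal_1 ennreal_less_iff)
    then have "(\<lambda>n. ennreal (r ^ n)) \<longlonglongrightarrow> ennreal 0"
      using r by (intro tendsto_ennrealI LIMSEQ_power_zero) simp
    then show ?thesis using r by (simp add: ennreal_power)
  qed
  ultimately show ?thesis
    by (metis (no_types, lifting) LIMSEQ_le_const le_zero_eq)
qed

lemma nn_integral_count_space_enat:
  "(\<integral>\<^sup>+ h. f h \<partial>count_space (UNIV :: enat set)) = f \<infinity> + (\<Sum>k. f (enat k))"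
proof -
  have "f h = f h * indicator {\<infinity>} h + f h * indicator (range enat) h" for h
    by (cases h) (auto split: split_indicator)
  then have "(\<integral>\<^sup>+ h. f h \<partial>count_space UNIV) =
      (\<integral>\<^sup>+ h. f h * indicator {\<infinity>} h + f h * indicator (range enat) h \<partial>count_space UNIV)"
    by (intro nn_integral_cong)
  also have "\<dots> = (\<integral>\<^sup>+ h. f h * indicator {\<infinity>} h \<partial>count_space UNIV) +
      (\<integral>\<^sup>+ h. f h * indicator (range enat) h \<partial>count_space UNIV)"
    by (rule nn_integral_add) auto
  also have "(\<integral>\<^sup>+ h. f h * indicator {\<infinity>} h \<partial>count_space UNIV) = f \<infinity>"
    by (subst nn_integral_count_space_indicator[symmetric]) (simp_all add: nn_integral_count_space_finite)
  also have "(\<integral>\<^sup>+ h. f h * indicator (range enat) h \<partial>count_space UNIV) = (\<Sum>k. f (enat k))"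
  proof -
    have "bij_betw enat UNIV (range enat)" by (simp add: bij_betw_def inj_on_def)
    from nn_integral_bij_count_space[OF this, of f] show ?thesis
      by (subst nn_integral_count_space_indicator[symmetric]) (simp_all add: nn_integral_count_space_nat)
  qed
  finally show ?thesis .
qed

lemma pmf_size_biased:
  assumes "integrable (measure_pmf \<xi>) real" "measure_pmf.expectation \<xi> real \<le> 1"
  shows "pmf (size_biased_pmf \<xi>) h =
    (case h of enat k \<Rightarrow> real k * pmf \<xi> k | \<infinity> \<Rightarrow> 1 - measure_pmf.expectation \<xi> real)"
  unfolding size_biased_pmf_def
proof (rule pmf_embed_pmf)
  show "0 \<le> (case h of enat k \<Rightarrow> real k * pmf \<xi> k | \<infinity> \<Rightarrow> 1 - measure_pmf.expectation \<xi> real)" for h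
    using assms by (cases h) auto
  let ?m = "measure_pmf.expectation \<xi> real"
  have "(\<Sum>k. ennreal (real k * pmf \<xi> k)) = (\<integral>\<^sup>+ k. ennreal (real k) \<partial>measure_pmf \<xi>)"
    by (simp add: nn_integral_measure_pmf nn_integral_count_space_nat ennreal_mult mult.commute)
  also have "\<dots> = ennreal ?m"
    using assms by (intro nn_integral_eq_integral) auto
  finally have "(\<integral>\<^sup>+ h. ennreal (case h of enat k \<Rightarrow> real k * pmf \<xi> k | \<infinity> \<Rightarrow> 1 - ?m) \<partial>count_space UNIV) =
      ennreal (1 - ?m) + ennreal ?m"
    by (simp add: nn_integral_count_space_enat)
  also have "\<dots> = 1"
    using assms by (subst ennreal_plus[symmetric]) auto
  finally show "(\<integral>\<^sup>+ h. ennreal (case h of enat k \<Rightarrow> real k * pmf \<xi> k | \<infinity> \<Rightarrow> 1 - ?m) \<partial>count_space UNIV) = 1" .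
qed

definition siblings :: "enat \<times> nat \<Rightarrow> nat set" where
  "siblings z = {i. enat i < fst z \<and> i \<noteq> snd z}"

definition sibling_weight :: "ennreal \<Rightarrow> enat \<times> nat \<Rightarrow> ennreal" where
  "sibling_weight y z = (if fst z = \<infinity> then 0 else y ^ card (siblings z))"

text \<open>Whatever position is selected among \<open>k\<close> children, \<open>k - 1\<close>
  siblings remain, so the size-biased mass \<open>k * pmf \<xi> k\<close> is multiplied by
  \<open>y ^ (k - 1)\<close>; infinite degree contributes 0.\<close>

lemma nn_integral_spine:
  assumes "integrable (measure_pmf \<xi>) real" "measure_pmf.expectation \<xi> real \<le> 1"
  shows "(\<integral>\<^sup>+ z. sibling_weight y z \<partial>measure_pmf (spine_pmf \<xi>)) = side \<xi> y"
proof -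
  define F where "F h = (\<integral>\<^sup>+ i. sibling_weight y (h, i)
      \<partial>measure_pmf (case h of enat k \<Rightarrow> pmf_of_set {..<k} | \<infinity> \<Rightarrow> return_pmf 0))" for h
  have F_enat: "F (enat k) = y ^ (k - 1)" if "0 < k" for k
  proof -
    have "F (enat k) = (\<integral>\<^sup>+ i. y ^ (k - 1) \<partial>measure_pmf (pmf_of_set {..<k}))"
      unfolding F_def enat.case
    proof (rule nn_integral_cong_AE, rule AE_pmfI)
      fix i assume "i \<in> set_pmf (pmf_of_set {..<k})"
      then have "i < k" using that by (subst (asm) set_pmf_of_set) auto
      moreover have "siblings (enat k, i) = {..<k} - {i}" by (auto simp: siblings_def)
      ultimately show "sibling_weight y (enat k, i) = y ^ (k - 1)"
        by (simp add: sibling_weight_def)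
    qed
    then show ?thesis by simp
  qed
  have "(\<integral>\<^sup>+ z. sibling_weight y z \<partial>measure_pmf (spine_pmf \<xi>)) = (\<integral>\<^sup>+ h. F h \<partial>measure_pmf (size_biased_pmf \<xi>))"
    unfolding spine_pmf_def F_def by simp
  also have "\<dots> = ennreal (pmf (size_biased_pmf \<xi>) \<infinity>) * F \<infinity> + (\<Sum>k. ennreal (pmf (size_biased_pmf \<xi>) (enat k)) * F (enat k))"
    by (simp add: nn_integral_measure_pmf nn_integral_count_space_enat)
  also have "F \<infinity> = 0" by (simp add: F_def sibling_weight_def)
  also have "(\<Sum>k. ennreal (pmf (size_biased_pmf \<xi>) (enat k)) * F (enat k)) =
      (\<Sum>k. ennreal (pmf \<xi> k) * (of_nat k * y ^ (k - 1)))"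
  proof (rule suminf_cong)
    fix k
    \<comment> \<open>For \<open>k = 0\<close> the uniform law is taken on the empty set and is
      unspecified, but the size-biased mass is 0.\<close>
    show "ennreal (pmf (size_biased_pmf \<xi>) (enat k)) * F (enat k) = ennreal (pmf \<xi> k) * (of_nat k * y ^ (k - 1))"
      by (cases "k = 0")
         (simp_all add: pmf_size_biased[OF assms] F_enat ennreal_mult ennreal_of_nat_eq_real_of_nat ac_simps)
  qed
  finally show ?thesis
    by (simp add: side_def nn_integral_measure_pmf nn_integral_count_space_nat)
qed

section \<open>Walks and leaves in the limit tree\<close>

lemma ancestor_exists_mono: "ancestor_exists s j \<Longrightarrow> i \<le> j \<Longrightarrow> ancestor_exists s i"
  by (auto simp: ancestor_exists_def)

lemma ancestor_exists_0: "ancestor_exists s 0"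
  by (simp add: ancestor_exists_def)

lemma limit_vertices_iff:
  "(j, v) \<in> limit_vertices (x, s, y) \<longleftrightarrow>
    (if j = 0 then v \<in> bgw_tree x
     else ancestor_exists s j \<and> (case v of [] \<Rightarrow> True | i # u \<Rightarrow> i \<in> siblings (s j) \<and> u \<in> bgw_tree (y (j, i))))"
  by (auto simp: limit_vertices_def siblings_def split: list.splits)

lemma limit_spine_vertex: "ancestor_exists s j \<Longrightarrow> (j, []) \<in> limit_vertices (x, s, y)"
  by (simp add: limit_vertices_iff)

lemma limit_child_iff:
  "(a, b) \<in> limit_child_rel \<omega> \<longleftrightarrow> a \<in> limit_vertices \<omega> \<and> b \<in> limit_vertices \<omega> \<and>
    ((\<exists>i. b = (fst a, snd a @ [i])) \<or> (a = (Suc (fst b), []) \<and> snd b = []))"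
  by (cases a; cases b) (auto simp: limit_child_rel_def)

lemma single_valued_limit_parent: "single_valued ((limit_child_rel \<omega>)\<inverse>)"
  by (auto simp: single_valued_def limit_child_iff)

lemma relpow_limit_spine:
  assumes "ancestor_exists s j"
  shows "((j, []), (0, [])) \<in> limit_child_rel (x, s, y) ^^ j"
  using assms
proof (induction j)
  case (Suc j)
  have "((Suc j, []), (j, [])) \<in> limit_child_rel (x, s, y)"
    using Suc.prems ancestor_exists_mono[OF Suc.prems, of j]
    by (simp add: limit_child_iff limit_spine_vertex)
  moreover have "((j, []), (0, [])) \<in> limit_child_rel (x, s, y) ^^ j"
    using Suc ancestor_exists_mono by auto
  ultimately show ?case by (rule relpow_Suc_I2)
qed simp

lemma limit_ancestor:
  assumes "(z, (0, [])) \<in> limit_child_rel (x, s, y) ^^ j"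
  shows "z = (j, []) \<and> ancestor_exists s j"
  using assms
proof (induction j arbitrary: z)
  case (Suc j)
  obtain a where a: "(z, a) \<in> limit_child_rel (x, s, y)" "(a, (0, [])) \<in> limit_child_rel (x, s, y) ^^ j"
    using relpow_Suc_D2[OF Suc.prems] by blast
  from Suc.IH[OF a(2)] have "a = (j, [])" by simp
  then have "z = (Suc j, [])" "z \<in> limit_vertices (x, s, y)" using a(1) by (auto simp: limit_child_iff)
  then show ?case by (simp add: limit_vertices_iff)
qed (simp add: ancestor_exists_0)

lemma limit_descendant:
  assumes "((j, []), u) \<in> limit_child_rel \<omega> ^^ k"
  shows "fst u \<le> j \<and> k = (j - fst u) + length (snd u)"
  using assms
proof (induction k arbitrary: u)
  case (Suc k)
  obtain a where a: "((j, []), a) \<in> limit_child_rel \<omega> ^^ k" "(a, u) \<in> limit_child_rel \<omega>"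
    using Suc.prems by auto
  then show ?case using Suc.IH[OF a(1)] by (cases a; cases u) (auto simp: limit_child_iff)
qed auto

lemma relpow_limit_root:
  "v \<in> bgw_tree x \<Longrightarrow> ((0, []), (0, v)) \<in> limit_child_rel (x, s, y) ^^ length v"
proof (induction v rule: rev_induct)
  case (snoc i v)
  then have "v \<in> bgw_tree x" by (simp add: snoc_in_bgw_tree)
  moreover have "((0, v), (0, v @ [i])) \<in> limit_child_rel (x, s, y)"
    using snoc.prems \<open>v \<in> bgw_tree x\<close> by (simp add: limit_child_iff limit_vertices_iff)
  ultimately show ?case using snoc.IH by auto
qed simp

lemma relpow_limit_side:
  assumes "0 < j" "ancestor_exists s j" "i \<in> siblings (s j)"
  shows "v \<in> bgw_tree (y (j, i)) \<Longrightarrow>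
    ((j, []), (j, i # v)) \<in> limit_child_rel (x, s, y) ^^ Suc (length v)"
proof (induction v rule: rev_induct)
  case Nil
  have "((j, []), (j, [i])) \<in> limit_child_rel (x, s, y)"
    using assms by (simp add: limit_child_iff limit_vertices_iff)
  then show ?case by auto
next
  case (snoc l v)
  then have v: "v \<in> bgw_tree (y (j, i))" by (simp add: snoc_in_bgw_tree)
  have "((j, i # v), (j, i # v @ [l])) \<in> limit_child_rel (x, s, y)"
    using snoc.prems v assms by (simp add: limit_child_iff limit_vertices_iff)
  then show ?case using snoc.IH[OF v] by (auto simp: relcomp.relcompI)
qed

lemma limit_leaves_root:
  assumes "v \<in> bgw_tree x"
  shows "(0, v) \<in> leaves (limit_vertices (x, s, y)) (limit_child_rel (x, s, y)) \<longleftrightarrow> x v = 0"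
proof -
  have "limit_child_rel (x, s, y) `` {(0, v)} = (\<lambda>i. (0, v @ [i])) ` {..<x v}"
    using assms by (auto simp: limit_child_iff limit_vertices_iff snoc_in_bgw_tree)
  then show ?thesis using assms by (auto simp: leaves_def limit_vertices_iff)
qed

lemma limit_leaves_side:
  assumes "0 < j" "ancestor_exists s j" "i \<in> siblings (s j)" "v \<in> bgw_tree (y (j, i))"
  shows "(j, i # v) \<in> leaves (limit_vertices (x, s, y)) (limit_child_rel (x, s, y)) \<longleftrightarrow> y (j, i) v = 0"
proof -
  have "limit_child_rel (x, s, y) `` {(j, i # v)} = (\<lambda>l. (j, i # v @ [l])) ` {..<y (j, i) v}"
    using assms by (auto simp: limit_child_iff limit_vertices_iff snoc_in_bgw_tree)
  then show ?thesis using assms by (auto simp: leaves_def limit_vertices_iff)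
qed

lemma limit_leaves_spine:
  assumes "0 < j"
  shows "(j, []) \<notin> leaves (limit_vertices (x, s, y)) (limit_child_rel (x, s, y))"
proof
  assume leaf: "(j, []) \<in> leaves (limit_vertices (x, s, y)) (limit_child_rel (x, s, y))"
  then have "ancestor_exists s j" using assms by (simp add: leaves_def limit_vertices_iff)
  then have "((j, []), (j - 1, [])) \<in> limit_child_rel (x, s, y)"
    using assms ancestor_exists_mono[of s j "j - 1"] by (simp add: limit_child_iff limit_spine_vertex)
  then show False using leaf by (auto simp: leaves_def)
qed

text \<open>By truncated subtraction the condition is void for \<open>j \<ge> R - 1\<close>.\<close>

definition side_far :: "nat \<Rightarrow> (nat \<Rightarrow> enat \<times> nat) \<Rightarrow> (nat \<times> nat \<Rightarrow> nat list \<Rightarrow> nat) \<Rightarrow> bool" where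
  "side_far R s y \<longleftrightarrow> (\<forall>j. 0 < j \<longrightarrow> ancestor_exists s j \<longrightarrow>
     (\<forall>i. i \<in> siblings (s j) \<longrightarrow> bgw_noleaf (R - 1 - j) (y (j, i))))"

lemma limit_border_dist_ge_iff:
  "enat R \<le> limit_border_dist (x, s, y) \<longleftrightarrow> bgw_noleaf R x \<and> side_far R s y"
proof -
  let ?C = "limit_child_rel (x, s, y)" and ?V = "limit_vertices (x, s, y)"
  have "enat R \<le> limit_border_dist (x, s, y) \<longleftrightarrow>
      (\<forall>z j k u. (z, (0, [])) \<in> ?C ^^ j \<longrightarrow> (z, u) \<in> ?C ^^ k \<longrightarrow> j + k < R \<longrightarrow> u \<notin> leaves ?V ?C)"
    unfolding limit_border_dist_def by (rule border_dist_ge_iff[OF single_valued_limit_parent])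
  also have "\<dots> \<longleftrightarrow> bgw_noleaf R x \<and> side_far R s y"
  proof
    assume *: "\<forall>z j k u. (z, (0, [])) \<in> ?C ^^ j \<longrightarrow> (z, u) \<in> ?C ^^ k \<longrightarrow> j + k < R \<longrightarrow> u \<notin> leaves ?V ?C"
    have "bgw_noleaf R x"
      unfolding bgw_noleaf_iff
    proof (intro ballI impI)
      fix v assume v: "v \<in> bgw_tree x" "length v < R"
      have "(0, v) \<notin> leaves ?V ?C"
        using *[rule_format, of "(0, [])" 0 "(0, v)" "length v"] relpow_limit_root[OF v(1)] v(2) by simp
      then show "x v \<noteq> 0" using limit_leaves_root[OF v(1)] by simp
    qed
    moreover have "side_far R s y"
      unfolding side_far_def bgw_noleaf_iff
    proof (intro allI impI ballI)
      fix j i v assume j: "0 < j" "ancestor_exists s j" "i \<in> siblings (s j)"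
        and v: "v \<in> bgw_tree (y (j, i))" "length v < R - 1 - j"
      have "(j, i # v) \<notin> leaves ?V ?C"
        using *[rule_format, OF relpow_limit_spine[OF j(2)]
            relpow_limit_side[where s = s and y = y and x = x and i = i and v = v, OF j v(1)]] v(2) by simp
      then show "y (j, i) v \<noteq> 0" using limit_leaves_side[where s = s and y = y and x = x and i = i and v = v, OF j v(1)] by simp
    qed
    ultimately show "bgw_noleaf R x \<and> side_far R s y" ..
  next
    assume *: "bgw_noleaf R x \<and> side_far R s y"
    show "\<forall>z j k u. (z, (0, [])) \<in> ?C ^^ j \<longrightarrow> (z, u) \<in> ?C ^^ k \<longrightarrow> j + k < R \<longrightarrow> u \<notin> leaves ?V ?C"
    proof (intro allI impI notI)
      fix z j k u assume zj: "(z, (0, [])) \<in> ?C ^^ j" and zu: "(z, u) \<in> ?C ^^ k" and R: "j + k < R"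
        and leaf: "u \<in> leaves ?V ?C"
      have z: "z = (j, [])" using limit_ancestor[OF zj] by simp
      obtain j' v where u: "u = (j', v)" by (cases u)
      have d: "j' \<le> j" "k = (j - j') + length v"
        using limit_descendant[OF zu[unfolded z]] by (auto simp: u)
      have uV: "(j', v) \<in> ?V" using leaf by (simp add: leaves_def u)
      show False
      proof (cases "j' = 0")
        case True
        then have v: "v \<in> bgw_tree x" using uV by (simp add: limit_vertices_iff)
        then have "x v \<noteq> 0" using * R d by (simp add: bgw_noleaf_iff)
        then show False using leaf True limit_leaves_root[OF v] by (simp add: u)
      next
        case False
        show False
        proof (cases v)
          case Nil
          then show False using leaf False limit_leaves_spine[of j'] by (simp add: u)
        next
          case (Cons i v')
          then have v: "ancestor_exists s j'" "i \<in> siblings (s j')" "v' \<in> bgw_tree (y (j', i))"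
            using uV False by (auto simp: limit_vertices_iff)
          have len: "length v' < R - 1 - j'" using R d Cons by simp
          have "bgw_noleaf (R - 1 - j') (y (j', i))"
            using * False v unfolding side_far_def by blast
          then have "y (j', i) v' \<noteq> 0" using v(3) len unfolding bgw_noleaf_iff by blast
          then show False using leaf False Cons limit_leaves_side[where s = s and y = y and x = x and i = i and v = v' and j = j', OF _ v]
            by (simp add: u)
        qed
      qed
    qed
  qed
  finally show ?thesis .
qed

section \<open>The law of the distance in the limit tree\<close>

definition spine_space :: "nat pmf \<Rightarrow> (nat \<Rightarrow> enat \<times> nat) measure" where
  "spine_space \<xi> = PiM UNIV (\<lambda>_. measure_pmf (spine_pmf \<xi>))"

definition side_space :: "nat pmf \<Rightarrow> (nat \<times> nat \<Rightarrow> nat list \<Rightarrow> nat) measure" where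
  "side_space \<xi> = PiM UNIV (\<lambda>_. bgw_space \<xi>)"

lemma limit_space_eq: "limit_space \<xi> = bgw_space \<xi> \<Otimes>\<^sub>M (spine_space \<xi> \<Otimes>\<^sub>M side_space \<xi>)"
  by (simp add: limit_space_def spine_space_def side_space_def)

lemma prob_space_spine: "prob_space (spine_space \<xi>)"
  unfolding spine_space_def by (intro prob_space_PiM measure_pmf.prob_space_axioms)

lemma prob_space_side: "prob_space (side_space \<xi>)"
  unfolding side_space_def by (rule prob_space_bgw_family)

lemma space_spine [simp]: "space (spine_space \<xi>) = UNIV"
  by (simp add: spine_space_def space_PiM PiE_UNIV_domain)

lemma space_side [simp]: "space (side_space \<xi>) = UNIV"
  by (simp add: side_space_def)

lemma prob_space_spine_side: "prob_space (spine_space \<xi> \<Otimes>\<^sub>M side_space \<xi>)"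
proof -
  interpret S: prob_space "spine_space \<xi>" by (rule prob_space_spine)
  interpret Y: prob_space "side_space \<xi>" by (rule prob_space_side)
  interpret pair_prob_space "spine_space \<xi>" "side_space \<xi>" ..
  show ?thesis by (rule P.prob_space_axioms)
qed

lemma prob_space_limit: "prob_space (limit_space \<xi>)"
proof -
  interpret B: prob_space "bgw_space \<xi>" by (rule prob_space_bgw)
  interpret W: prob_space "spine_space \<xi> \<Otimes>\<^sub>M side_space \<xi>" by (rule prob_space_spine_side)
  interpret pair_prob_space "bgw_space \<xi>" "spine_space \<xi> \<Otimes>\<^sub>M side_space \<xi>" ..
  show ?thesis unfolding limit_space_eq by (rule P.prob_space_axioms)
qed

lemma space_limit [simp]: "space (limit_space \<xi>) = UNIV"
  by (simp add: limit_space_eq space_pair_measure)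

lemma measurable_side_far:
  "Measurable.pred (spine_space \<xi> \<Otimes>\<^sub>M side_space \<xi>) (\<lambda>(s, y). side_far R s y)"
proof -
  have s: "Measurable.pred (spine_space \<xi> \<Otimes>\<^sub>M side_space \<xi>) (\<lambda>p. P (fst p j))" for P :: "enat \<times> nat \<Rightarrow> bool" and j
    unfolding spine_space_def
    by (rule measurable_compose[OF measurable_fst measurable_pred_component[where i = j and P = P]]) simp
  have y: "Measurable.pred (spine_space \<xi> \<Otimes>\<^sub>M side_space \<xi>) (\<lambda>p. bgw_noleaf k (snd p a))" for k a
    unfolding side_space_def
    by (rule measurable_compose[OF measurable_snd measurable_pred_bgw_component])
  have sib: "Measurable.pred (spine_space \<xi> \<Otimes>\<^sub>M side_space \<xi>) (\<lambda>p. i \<in> siblings (fst p j))" for i j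
    by (rule s[where P = "\<lambda>z. i \<in> siblings z"])
  have anc: "Measurable.pred (spine_space \<xi> \<Otimes>\<^sub>M side_space \<xi>) (\<lambda>p. ancestor_exists (fst p) j)" for j
    unfolding ancestor_exists_def
    by (intro pred_intros_finite finite_atLeastLessThan s[where P = "\<lambda>z. fst z \<noteq> \<infinity>"])
  have "Measurable.pred (spine_space \<xi> \<Otimes>\<^sub>M side_space \<xi>) (\<lambda>p. side_far R (fst p) (snd p))"
    unfolding side_far_def
    by (intro pred_intros_countable pred_intros_logic anc sib y) simp_all
  then show ?thesis by (simp add: case_prod_beta')
qed

text \<open>The probability given the spine. If an infinite degree occurs up to
  \<open>R - 2\<close>, both sides are 0, so it is harmless that the product also runs over
  ancestors above the stopping point. Otherwise all these ancestors exist and have finitely many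
  independent siblings.\<close>

lemma emeasure_side_far_section:
  assumes "0 < pmf \<xi> 0"
  shows "emeasure (side_space \<xi>) {y. side_far R s y} =
    (\<Prod>j=1..R - 2. sibling_weight (surv \<xi> (R - 1 - j)) (s j))"
proof (cases "\<exists>j\<in>{1..R - 2}. fst (s j) = \<infinity>")
  case True
  \<comment> \<open>The first infinite ancestor does belong to the tree, whereas a later one would
    not.\<close>
  define J where "J = (LEAST j. 0 < j \<and> fst (s j) = \<infinity>)"
  obtain j where j: "1 \<le> j" "j \<le> R - 2" "fst (s j) = \<infinity>" using True by auto
  then have j': "0 < j \<and> fst (s j) = \<infinity>" by simp
  have "0 < J \<and> fst (s J) = \<infinity>" unfolding J_def using j' by (rule LeastI)
  then have J: "0 < J" "fst (s J) = \<infinity>" by blast+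
  have min: "fst (s i) \<noteq> \<infinity>" if "0 < i" "i < J" for i
    using not_less_Least[of i "\<lambda>j. 0 < j \<and> fst (s j) = \<infinity>"] that by (simp add: J_def)
  have "J \<le> j" unfolding J_def using j' by (rule Least_le)
  then have J_le: "J \<le> R - 2" using j by simp
  have anc: "ancestor_exists s J"
    unfolding ancestor_exists_def using min by (simp add: Suc_le_eq)
  have "emeasure (side_space \<xi>) {y. side_far R s y} \<le>
      emeasure (side_space \<xi>) {y. \<forall>a\<in>Pair J ` siblings (s J). bgw_noleaf (R - 1 - J) (y a)}"
  proof (rule emeasure_mono)
    show "{y. side_far R s y} \<subseteq> {y. \<forall>a\<in>Pair J ` siblings (s J). bgw_noleaf (R - 1 - J) (y a)}"
      using J anc by (auto simp: side_far_def)
    have "Measurable.pred (side_space \<xi>) (\<lambda>y. \<forall>i. i \<in> siblings (s J) \<longrightarrow> bgw_noleaf (R - 1 - J) (y (J, i)))"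
      unfolding side_space_def
      by (intro pred_intros_logic pred_intros_countable measurable_pred_bgw_component) auto
    moreover have "{y. \<forall>a\<in>Pair J ` siblings (s J). bgw_noleaf (R - 1 - J) (y a)} =
        {y. \<forall>i. i \<in> siblings (s J) \<longrightarrow> bgw_noleaf (R - 1 - J) (y (J, i))}"
      by auto
    ultimately show "{y. \<forall>a\<in>Pair J ` siblings (s J). bgw_noleaf (R - 1 - J) (y a)} \<in> sets (side_space \<xi>)"
      by (simp add: pred_def)
  qed
  also have "\<dots> = 0"
    unfolding side_space_def
  proof (rule emeasure_bgw_family_infinite[where \<kappa> = "\<lambda>_. R - 1 - J"])
    have "siblings (s J) = UNIV - {snd (s J)}" using J by (auto simp: siblings_def)
    then have "infinite (siblings (s J))" by simp
    then show "infinite (Pair J ` siblings (s J))" by (subst finite_image_iff) (auto intro: inj_onI)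
    show "surv \<xi> (R - 1 - J) < 1" using assms J J_le by (intro surv_less_1) auto
  qed simp
  finally have "emeasure (side_space \<xi>) {y. side_far R s y} = 0" by simp
  moreover have "(\<Prod>j=1..R - 2. sibling_weight (surv \<xi> (R - 1 - j)) (s j)) = 0"
    using j by (intro prod_zero bexI[of _ j]) (simp_all add: sibling_weight_def)
  ultimately show ?thesis by simp
next
  case False
  define I where "I = (SIGMA j:{1..R - 2}. siblings (s j))"
  have fin: "finite (siblings (s j))" if "j \<in> {1..R - 2}" for j
  proof -
    have "fst (s j) \<noteq> \<infinity>" using False that by metis
    then obtain n where "fst (s j) = enat n" by auto
    then show ?thesis by (auto simp: siblings_def intro: finite_subset[of _ "{..<n}"])
  qed
  have anc: "ancestor_exists s j" if "j \<in> {1..R - 2}" for j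
    using False that by (force simp: ancestor_exists_def)
  have "side_far R s y \<longleftrightarrow> (\<forall>a\<in>I. bgw_noleaf (R - 1 - fst a) (y a))" for y
  proof
    assume "side_far R s y"
    then show "\<forall>a\<in>I. bgw_noleaf (R - 1 - fst a) (y a)"
      using anc by (force simp: side_far_def I_def)
  next
    assume *: "\<forall>a\<in>I. bgw_noleaf (R - 1 - fst a) (y a)"
    show "side_far R s y"
      unfolding side_far_def
    proof (intro allI impI)
      fix j i assume "0 < j" "i \<in> siblings (s j)"
      then show "bgw_noleaf (R - 1 - j) (y (j, i))"
        using bspec[OF *, of "(j, i)"] by (cases "j \<le> R - 2") (auto simp: I_def not_le)
    qed
  qed
  moreover have "finite I"
    unfolding I_def using fin by (intro finite_SigmaI) auto
  ultimately have "emeasure (side_space \<xi>) {y. side_far R s y} = (\<Prod>a\<in>I. surv \<xi> (R - 1 - fst a))"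
    unfolding side_space_def using emeasure_bgw_family[of I \<xi> "\<lambda>a. R - 1 - fst a"] by (simp only:)
  also have "\<dots> = (\<Prod>j=1..R - 2. \<Prod>i\<in>siblings (s j). surv \<xi> (R - 1 - j))"
    unfolding I_def using fin by (subst prod.Sigma) (auto simp: case_prod_beta')
  also have "\<dots> = (\<Prod>j=1..R - 2. sibling_weight (surv \<xi> (R - 1 - j)) (s j))"
  proof (intro prod.cong refl)
    fix j assume "j \<in> {1..R - 2}"
    then have "fst (s j) \<noteq> \<infinity>" using False by metis
    then obtain n where "fst (s j) = enat n" by auto
    then show "(\<Prod>i\<in>siblings (s j). surv \<xi> (R - 1 - j)) = sibling_weight (surv \<xi> (R - 1 - j)) (s j)"
      by (simp add: sibling_weight_def)
  qed
  finally show ?thesis .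
qed

lemma nn_integral_spine_prod:
  fixes J :: "nat set"
  assumes "finite J"
  shows "(\<integral>\<^sup>+ s. (\<Prod>j\<in>J. f j (s j)) \<partial>spine_space \<xi>) = (\<Prod>j\<in>J. \<integral>\<^sup>+ z. f j z \<partial>measure_pmf (spine_pmf \<xi>))"
proof -
  interpret S: prob_space "spine_space \<xi>" by (rule prob_space_spine)
  have "S.indep_vars (\<lambda>_. measure_pmf (spine_pmf \<xi>)) (\<lambda>i s. s i) UNIV"
    unfolding spine_space_def
    by (rule indep_vars_PiM_coordinates) (rule measure_pmf.prob_space_axioms)
  then have "S.indep_vars (\<lambda>_. measure_pmf (spine_pmf \<xi>)) (\<lambda>i s. s i) J"
    by (rule S.indep_vars_subset) simp
  then have "S.indep_vars (\<lambda>_. borel) (\<lambda>j s. f j (s j)) J"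
    by (rule S.indep_vars_compose2) simp
  from S.indep_vars_nn_integral[OF assms this]
  have "(\<integral>\<^sup>+ s. (\<Prod>j\<in>J. f j (s j)) \<partial>spine_space \<xi>) = (\<Prod>j\<in>J. \<integral>\<^sup>+ s. f j (s j) \<partial>spine_space \<xi>)"
    by simp
  also have "\<dots> = (\<Prod>j\<in>J. \<integral>\<^sup>+ z. f j z \<partial>measure_pmf (spine_pmf \<xi>))"
  proof (intro prod.cong refl)
    fix j
    have "distr (spine_space \<xi>) (measure_pmf (spine_pmf \<xi>)) (\<lambda>s. s j) = measure_pmf (spine_pmf \<xi>)"
      unfolding spine_space_def by (rule distr_PiM_component) (auto intro: measure_pmf.prob_space_axioms)
    then have "(\<integral>\<^sup>+ z. f j z \<partial>measure_pmf (spine_pmf \<xi>)) =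
        (\<integral>\<^sup>+ z. f j z \<partial>distr (spine_space \<xi>) (measure_pmf (spine_pmf \<xi>)) (\<lambda>s. s j))"
      by simp
    also have "\<dots> = (\<integral>\<^sup>+ s. f j (s j) \<partial>spine_space \<xi>)"
      by (rule nn_integral_distr) (auto simp: spine_space_def)
    finally show "(\<integral>\<^sup>+ s. f j (s j) \<partial>spine_space \<xi>) = (\<integral>\<^sup>+ z. f j z \<partial>measure_pmf (spine_pmf \<xi>))" ..
  qed
  finally show ?thesis .
qed

lemma limit_tail_event:
  "{\<omega>. enat R \<le> limit_border_dist \<omega>} = {x. bgw_noleaf R x} \<times> {(s, y). side_far R s y}"
  by (auto simp: limit_border_dist_ge_iff)

lemma sets_side_far: "{(s, y). side_far R s y} \<in> sets (spine_space \<xi> \<Otimes>\<^sub>M side_space \<xi>)"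
  using measurable_side_far[where \<xi> = \<xi> and R = R] by (simp add: pred_def space_pair_measure case_prod_beta')

lemma sets_limit_tail: "{\<omega>. enat R \<le> limit_border_dist \<omega>} \<in> sets (limit_space \<xi>)"
  unfolding limit_tail_event limit_space_eq by (intro pair_measureI sets_bgw_noleaf sets_side_far)

theorem emeasure_limit_tail:
  assumes "integrable (measure_pmf \<xi>) real" "measure_pmf.expectation \<xi> real \<le> 1" "0 < pmf \<xi> 0"
  shows "emeasure (limit_space \<xi>) {\<omega>. enat R \<le> limit_border_dist \<omega>} = limit_tail \<xi> R"
proof -
  interpret Y: prob_space "side_space \<xi>" by (rule prob_space_side)
  interpret W: prob_space "spine_space \<xi> \<Otimes>\<^sub>M side_space \<xi>" by (rule prob_space_spine_side)
  have "emeasure (limit_space \<xi>) {\<omega>. enat R \<le> limit_border_dist \<omega>} =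
      surv \<xi> R * emeasure (spine_space \<xi> \<Otimes>\<^sub>M side_space \<xi>) {(s, y). side_far R s y}"
    unfolding limit_tail_event limit_space_eq
    by (simp add: W.emeasure_pair_measure_Times sets_bgw_noleaf sets_side_far emeasure_bgw_noleaf)
  also have "emeasure (spine_space \<xi> \<Otimes>\<^sub>M side_space \<xi>) {(s, y). side_far R s y} =
      (\<integral>\<^sup>+ s. emeasure (side_space \<xi>) (Pair s -` {(s, y). side_far R s y}) \<partial>spine_space \<xi>)"
    by (rule Y.emeasure_pair_measure_alt[OF sets_side_far])
  also have "\<dots> = (\<integral>\<^sup>+ s. (\<Prod>j=1..R - 2. sibling_weight (surv \<xi> (R - 1 - j)) (s j)) \<partial>spine_space \<xi>)"
    using assms(3) by (simp add: vimage_def emeasure_side_far_section)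
  also have "\<dots> = (\<Prod>j=1..R - 2. side \<xi> (surv \<xi> (R - 1 - j)))"
    using nn_integral_spine_prod[of "{1..R - 2}", where \<xi> = \<xi> and f = "\<lambda>j. sibling_weight (surv \<xi> (R - 1 - j))"]
    by (simp add: nn_integral_spine[OF assms(1,2)])
  finally show ?thesis by (simp add: limit_tail_def)
qed

section \<open>Convergence from convergence of tails\<close>

lemma summable_powr_geometric:
  assumes "0 < r" "r < 1"
  shows "summable (\<lambda>k. real k powr a * r ^ k)"
proof (rule root_test_convergence)
  have "(\<lambda>n. root n (real n) powr a * r) \<longlonglongrightarrow> 1 powr a * r"
    by (intro tendsto_intros LIMSEQ_root) auto
  then have "(\<lambda>n. root n (real n) powr a * r) \<longlonglongrightarrow> r" by simp
  then show "(\<lambda>n. root n (norm (real n powr a * r ^ n))) \<longlonglongrightarrow> r"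
  proof (rule Lim_transform_eventually)
    show "\<forall>\<^sub>F n in sequentially. root n (real n) powr a * r = root n (norm (real n powr a * r ^ n))"
      using eventually_gt_at_top[of 0]
    proof (rule eventually_mono)
      fix n :: nat assume n: "0 < n"
      have "root n (real n powr a * r ^ n) = root n (real n powr a) * r"
        using n assms by (simp add: real_root_mult real_root_power_cancel)
      also have "root n (real n powr a) = root n (real n) powr a"
        using n by (simp add: root_powr_inverse powr_powr mult.commute)
      finally show "root n (real n) powr a * r = root n (norm (real n powr a * r ^ n))"
        using assms by simp
    qed
  qed
qed (use assms in simp)

text \<open>The common rate \<open>\<rho>\<close> of the finite and the limit laws gives finiteness
  almost surely and one summable majorant for each moment.\<close>

locale geometric_tail = prob_space M for M :: "'a measure" +
  fixes f :: "'a \<Rightarrow> enat" and \<rho> :: real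
  assumes sets_tail: "\<And>R. {x \<in> space M. enat R \<le> f x} \<in> sets M"
    and rho: "0 < \<rho>" "\<rho> < 1"
    and tail_le: "\<And>R. prob {x \<in> space M. enat R \<le> f x} \<le> \<rho> ^ R"
begin

definition tailp :: "nat \<Rightarrow> real" where "tailp R = prob {x \<in> space M. enat R \<le> f x}"

lemma fiber_eq:
  "{x \<in> space M. f x = enat k} = {x \<in> space M. enat k \<le> f x} - {x \<in> space M. enat (Suc k) \<le> f x}"
proof -
  have "a = enat k \<longleftrightarrow> enat k \<le> a \<and> \<not> enat (Suc k) \<le> a" for a
    by (cases a) auto
  then show ?thesis by blast
qed

lemma sets_fiber: "{x \<in> space M. f x = enat k} \<in> sets M"
  unfolding fiber_eq by (intro sets.Diff sets_tail)

lemma prob_fiber: "prob {x \<in> space M. f x = enat k} = tailp k - tailp (Suc k)"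
proof -
  have "enat (Suc k) \<le> a \<Longrightarrow> enat k \<le> a" for a by (cases a) auto
  then show ?thesis
    unfolding fiber_eq tailp_def by (intro finite_measure_Diff sets_tail) auto
qed

lemma tailp_antimono: "tailp (Suc k) \<le> tailp k"
  using prob_fiber[of k] measure_nonneg[of M "{x \<in> space M. f x = enat k}"] by simp

lemma AE_finite: "AE x in M. f x \<noteq> \<infinity>"
proof -
  have eq: "{x \<in> space M. f x = \<infinity>} = (\<Inter>R. {x \<in> space M. enat R \<le> f x})"
  proof -
    have "a = \<infinity> \<longleftrightarrow> (\<forall>R. enat R \<le> a)" for a
    proof (cases a)
      case (enat m)
      then have "\<not> enat (Suc m) \<le> a" by simp
      then show ?thesis using enat by blast
    qed simp
    then show ?thesis by blast
  qed
  have sets: "{x \<in> space M. f x = \<infinity>} \<in> sets M"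
    unfolding eq by (intro sets.countable_INT) (use sets_tail in auto)
  have "prob {x \<in> space M. f x = \<infinity>} \<le> \<rho> ^ R" for R
    using finite_measure_mono[OF _ sets_tail[of R], of "{x \<in> space M. f x = \<infinity>}"] tail_le[of R]
    by fastforce
  moreover have "(\<lambda>R. \<rho> ^ R) \<longlonglongrightarrow> 0"
    using rho by (intro LIMSEQ_power_zero) simp
  ultimately have "prob {x \<in> space M. f x = \<infinity>} \<le> 0"
    by (intro LIMSEQ_le_const) auto
  then have "emeasure M {x \<in> space M. f x = \<infinity>} = 0"
    by (simp add: emeasure_eq_measure measure_le_0_iff)
  then show ?thesis using sets by (intro AE_I'[of "{x \<in> space M. f x = \<infinity>}"]) auto
qed

lemma measurable_f: "f \<in> measurable M (count_space UNIV)"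
proof (subst measurable_count_space_eq2_countable, intro conjI ballI)
  fix a :: enat
  have eq: "f -` {a} \<inter> space M = {x \<in> space M. f x = a}" by auto
  show "f -` {a} \<inter> space M \<in> sets M"
  proof (cases a)
    case (enat k)
    then show ?thesis unfolding eq using sets_fiber by simp
  next
    case infinity
    have "{x \<in> space M. f x = a} = space M - (\<Union>k. {x \<in> space M. f x = enat k})"
      using infinity by (auto intro: enat.exhaust)
    then show ?thesis
      unfolding eq by (simp only:) (intro sets.Diff sets.top sets.countable_UN, use sets_fiber in auto)
  qed
qed auto

lemma measurable_real: "(\<lambda>x. real_of_enat (f x)) \<in> borel_measurable M"
  by (rule measurable_compose[OF measurable_f]) simp

text \<open>As \<open>real_of_enat\<close> sends \<open>\<infinity>\<close> to 0, the event is the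
  complement of a tail event only up to the null set where \<open>f\<close> is infinite.\<close>

lemma cdf_real: "cdf (distr M borel (\<lambda>x. real_of_enat (f x))) u = (if u < 0 then 0 else 1 - tailp (Suc (nat \<lfloor>u\<rfloor>)))"
proof -
  have "cdf (distr M borel (\<lambda>x. real_of_enat (f x))) u = prob {x \<in> space M. real_of_enat (f x) \<le> u}"
    unfolding cdf_def by (subst measure_distr[OF measurable_real]) (auto intro!: arg_cong[of _ _ prob])
  also have "\<dots> = (if u < 0 then 0 else 1 - tailp (Suc (nat \<lfloor>u\<rfloor>)))"
  proof (cases "u < 0")
    case True
    have "0 \<le> real_of_enat a" for a by (cases a) (auto simp: real_of_enat_def)
    then have empty: "{x \<in> space M. real_of_enat (f x) \<le> u} = {}"
      using True by (auto simp: not_le intro: less_le_trans)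
    show ?thesis unfolding empty using True by simp
  next
    case False
    let ?A = "{x \<in> space M. enat (Suc (nat \<lfloor>u\<rfloor>)) \<le> f x}"
    have iff: "real_of_enat (enat k) \<le> u \<longleftrightarrow> \<not> enat (Suc (nat \<lfloor>u\<rfloor>)) \<le> enat k" for k
      using False by (simp add: real_of_enat_def not_less_eq_eq le_nat_iff le_floor_iff)
    have "prob {x \<in> space M. real_of_enat (f x) \<le> u} = prob (space M - ?A)"
    proof (rule finite_measure_eq_AE)
      show "AE x in M. (x \<in> {x \<in> space M. real_of_enat (f x) \<le> u}) = (x \<in> space M - ?A)"
        using AE_finite
      proof (rule AE_mp, intro AE_I2 impI)
        fix x assume "x \<in> space M" "f x \<noteq> \<infinity>"
        then obtain k where "f x = enat k" by auto
        then show "(x \<in> {x \<in> space M. real_of_enat (f x) \<le> u}) = (x \<in> space M - ?A)"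
          using iff[of k] \<open>x \<in> space M\<close> by auto
      qed
      show "{x \<in> space M. real_of_enat (f x) \<le> u} \<in> events"
        using measurable_real by measurable
    qed (use sets_tail in auto)
    also have "\<dots> = 1 - tailp (Suc (nat \<lfloor>u\<rfloor>))"
      unfolding tailp_def by (rule prob_compl[OF sets_tail])
    finally show ?thesis using False by simp
  qed
  finally show ?thesis .
qed

lemma moment_term_le: "norm (real k powr a * (tailp k - tailp (Suc k))) \<le> real k powr a * \<rho> ^ k"
proof -
  have "0 \<le> tailp (Suc k)" "tailp k \<le> \<rho> ^ k"
    using tail_le[of k] by (simp_all add: tailp_def)
  then have "tailp k - tailp (Suc k) \<le> \<rho> ^ k" by linarith
  then show ?thesis using tailp_antimono[of k] by (simp add: abs_mult mult_left_mono)
qed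

lemma moment: "(\<integral>\<^sup>+ x. enat_powr (f x) a \<partial>M) = ennreal (\<Sum>k. real k powr a * (tailp k - tailp (Suc k)))"
proof -
  have sm: "summable (\<lambda>k. real k powr a * (tailp k - tailp (Suc k)))"
    by (rule summable_comparison_test'[OF summable_powr_geometric[OF rho], of 0]) (rule moment_term_le)
  have "(\<integral>\<^sup>+ x. enat_powr (f x) a \<partial>M) =
      (\<integral>\<^sup>+ x. (\<Sum>k. ennreal (real k powr a) * indicator {x \<in> space M. f x = enat k} x) \<partial>M)"
  proof (rule nn_integral_cong_AE, use AE_finite in \<open>rule AE_mp\<close>, intro AE_I2 impI)
    fix x assume x: "x \<in> space M" "f x \<noteq> \<infinity>"
    then obtain j where j: "f x = enat j" by auto
    have "(\<Sum>k. ennreal (real k powr a) * indicator {x \<in> space M. f x = enat k} x) =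
        (\<Sum>k\<in>{j}. ennreal (real k powr a) * indicator {x \<in> space M. f x = enat k} x)"
      using j by (intro suminf_finite) auto
    then show "enat_powr (f x) a = (\<Sum>k. ennreal (real k powr a) * indicator {x \<in> space M. f x = enat k} x)"
      using x j by (simp add: enat_powr_def)
  qed
  also have "\<dots> = (\<Sum>k. \<integral>\<^sup>+ x. ennreal (real k powr a) * indicator {x \<in> space M. f x = enat k} x \<partial>M)"
    using sets_fiber by (intro nn_integral_suminf) auto
  also have "\<dots> = (\<Sum>k. ennreal (real k powr a * (tailp k - tailp (Suc k))))"
  proof (rule suminf_cong)
    fix k
    show "(\<integral>\<^sup>+ x. ennreal (real k powr a) * indicator {x \<in> space M. f x = enat k} x \<partial>M) =
        ennreal (real k powr a * (tailp k - tailp (Suc k)))"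
      using tailp_antimono[of k]
      by (simp add: nn_integral_cmult_indicator sets_fiber emeasure_eq_measure prob_fiber ennreal_mult)
  qed
  also have "\<dots> = ennreal (\<Sum>k. real k powr a * (tailp k - tailp (Suc k)))"
    using tailp_antimono by (intro suminf_ennreal2 sm) simp
  finally show ?thesis .
qed

end

lemma geometric_tail_weak_conv:
  assumes P: "\<And>i. geometric_tail (P i) f \<rho>" and Q: "geometric_tail Q g \<rho>"
    and lim: "\<And>R. (\<lambda>i. measure (P i) {x \<in> space (P i). enat R \<le> f x}) \<longlonglongrightarrow>
      measure Q {x \<in> space Q. enat R \<le> g x}"
  shows "weak_conv_m (\<lambda>i. distr (P i) borel (\<lambda>x. real_of_enat (f x))) (distr Q borel (\<lambda>x. real_of_enat (g x)))"
  unfolding weak_conv_m_def weak_conv_def geometric_tail.cdf_real[OF P] geometric_tail.cdf_real[OF Q]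
    geometric_tail.tailp_def[OF P] geometric_tail.tailp_def[OF Q]
  by (auto intro!: tendsto_intros lim)

text \<open>Dominated convergence for series (Tannery), with majorant
  \<open>k powr a * \<rho> ^ k\<close>.\<close>

lemma geometric_tail_moments:
  assumes P: "\<And>i. geometric_tail (P i) f \<rho>" and Q: "geometric_tail Q g \<rho>"
    and lim: "\<And>R. (\<lambda>i. measure (P i) {x \<in> space (P i). enat R \<le> f x}) \<longlonglongrightarrow>
      measure Q {x \<in> space Q. enat R \<le> g x}"
  shows "(\<lambda>i. \<integral>\<^sup>+ x. enat_powr (f x) a \<partial>P i) \<longlonglongrightarrow> (\<integral>\<^sup>+ x. enat_powr (g x) a \<partial>Q)"
proof -
  let ?t = "\<lambda>i R. measure (P i) {x \<in> space (P i). enat R \<le> f x}"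
  let ?u = "\<lambda>R. measure Q {x \<in> space Q. enat R \<le> g x}"
  have "((\<lambda>i. \<Sum>k. real k powr a * (?t i k - ?t i (Suc k))) \<longlonglongrightarrow> (\<Sum>k. real k powr a * (?u k - ?u (Suc k))))"
  proof (rule tannerys_theorem[THEN conjunct2, THEN conjunct2])
    show "summable (\<lambda>k. real k powr a * \<rho> ^ k)"
      using geometric_tail.rho[OF Q] by (intro summable_powr_geometric)
    show "\<forall>\<^sub>F (k, i) in sequentially \<times>\<^sub>F sequentially.
        norm (real k powr a * (?t i k - ?t i (Suc k))) \<le> real k powr a * \<rho> ^ k"
      using geometric_tail.moment_term_le[OF P]
      by (intro always_eventually) (simp add: geometric_tail.tailp_def[OF P] split_beta)
  qed (auto intro!: tendsto_intros lim)
  then show ?thesis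
    unfolding geometric_tail.moment[OF P] geometric_tail.moment[OF Q]
      geometric_tail.tailp_def[OF P] geometric_tail.tailp_def[OF Q]
    by (rule tendsto_ennrealI)
qed

section \<open>Convergence of the distance to the border\<close>

context sgt
begin

lemma sum_tree_weight: "(\<Sum>T\<in>plane_trees n. tree_weight w T) = trees_gf w $ n"
  by (simp add: trees_gf_def gf_nth plane_trees_def)

lemma sgt_defined_iff: "sgt_defined w n \<longleftrightarrow> 0 < trees_gf w $ n"
proof -
  have "0 < (\<Sum>T\<in>plane_trees n. tree_weight w T) \<longleftrightarrow> (\<exists>T\<in>plane_trees n. 0 < tree_weight w T)"
  proof
    assume pos: "0 < (\<Sum>T\<in>plane_trees n. tree_weight w T)"
    show "\<exists>T\<in>plane_trees n. 0 < tree_weight w T"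
    proof (rule ccontr)
      assume "\<not> ?thesis"
      then have "(\<Sum>T\<in>plane_trees n. tree_weight w T) \<le> 0" by (intro sum_nonpos) (simp add: not_less)
      then show False using pos by simp
    qed
  next
    assume "\<exists>T\<in>plane_trees n. 0 < tree_weight w T"
    then show "0 < (\<Sum>T\<in>plane_trees n. tree_weight w T)"
      using finite_plane_trees tree_weight_nonneg[OF weights] by (auto intro: sum_pos2)
  qed
  then show ?thesis by (simp add: sgt_defined_def sum_tree_weight)
qed

lemma pmf_sgt:
  assumes "sgt_defined w n"
  shows "pmf (sgt_pmf w n) T = (if T \<in> plane_trees n then tree_weight w T / trees_gf w $ n else 0)"
  unfolding sgt_pmf_def sum_tree_weight
proof (rule pmf_embed_pmf)
  have pos: "0 < trees_gf w $ n" using assms by (simp add: sgt_defined_iff)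
  show "0 \<le> (if T \<in> plane_trees n then tree_weight w T / trees_gf w $ n else 0)" for T
    using pos tree_weight_nonneg[OF weights] by simp
  have "(\<integral>\<^sup>+ T. ennreal (if T \<in> plane_trees n then tree_weight w T / trees_gf w $ n else 0) \<partial>count_space UNIV) =
      (\<Sum>T\<in>plane_trees n. ennreal (if T \<in> plane_trees n then tree_weight w T / trees_gf w $ n else 0))"
    using finite_plane_trees by (intro nn_integral_count_space') auto
  also have "\<dots> = (\<Sum>T\<in>plane_trees n. ennreal (tree_weight w T / trees_gf w $ n))"
    by (intro sum.cong) auto
  also have "\<dots> = ennreal ((\<Sum>T\<in>plane_trees n. tree_weight w T) / trees_gf w $ n)"
    using pos tree_weight_nonneg[OF weights] by (simp add: sum_ennreal sum_divide_distrib)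
  also have "\<dots> = 1" using pos by (simp add: sum_tree_weight)
  finally show "(\<integral>\<^sup>+ T. ennreal (if T \<in> plane_trees n then tree_weight w T / trees_gf w $ n else 0) \<partial>count_space UNIV) = 1" .
qed

text \<open>Choosing a tree by weight and then a uniform vertex is choosing a marked tree by weight;
  the total weight of marked trees is \<open>n * T $ n\<close>, which is \<open>(T * C) $ n\<close>
  with \<open>T = trees_gf w\<close>.\<close>

lemma sgt_tail:
  assumes "sgt_defined w n"
  shows "measure (measure_pmf (pointed_sgt_pmf w n)) {Tv. enat R \<le> tree_border_dist Tv} =
    pointed R n / (trees_gf w * C) $ n"
proof -
  have pos: "0 < trees_gf w $ n" using assms by (simp add: sgt_defined_iff)
  then have n: "0 < n" by (cases n) auto
  let ?S = "{Tv. enat R \<le> tree_border_dist Tv}"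
  have vertex: "emeasure (measure_pmf (map_pmf (Pair T) (pmf_of_set T))) ?S =
      ennreal (real (card {v \<in> T. far R T v}) / real n)" if "T \<in> plane_trees n" for T
  proof -
    have T: "plane_tree T" "card T = n" using that by (auto simp: plane_trees_def)
    have "T \<inter> {v. enat R \<le> tree_border_dist (T, v)} = {v \<in> T. far R T v}"
      using tree_border_dist_ge_iff[OF T(1)] by auto
    moreover have "T \<noteq> {}" using plane_tree_Nil[OF T(1)] by blast
    ultimately show ?thesis
      using T emeasure_pmf_of_set[OF _ plane_tree_finite[OF T(1)]]
      by (simp add: vimage_def)
  qed
  have "emeasure (measure_pmf (pointed_sgt_pmf w n)) ?S =
      (\<integral>\<^sup>+ T. emeasure (measure_pmf (map_pmf (Pair T) (pmf_of_set T))) ?S \<partial>measure_pmf (sgt_pmf w n))"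
    unfolding pointed_sgt_pmf_def by (rule emeasure_bind_pmf)
  also have "\<dots> = (\<Sum>T\<in>plane_trees n. emeasure (measure_pmf (map_pmf (Pair T) (pmf_of_set T))) ?S * pmf (sgt_pmf w n) T)"
  proof (rule nn_integral_measure_pmf_support[OF finite_plane_trees])
    fix T assume "T \<in> set_pmf (sgt_pmf w n)" "T \<notin> plane_trees n"
    then show "emeasure (measure_pmf (map_pmf (Pair T) (pmf_of_set T))) ?S = 0"
      by (simp add: set_pmf_iff pmf_sgt[OF assms])
  qed simp
  also have "\<dots> = (\<Sum>T\<in>plane_trees n. ennreal (tree_weight w T * real (card {v \<in> T. far R T v}) / (real n * trees_gf w $ n)))"
  proof (intro sum.cong refl)
    fix T assume T: "T \<in> plane_trees n"
    show "emeasure (measure_pmf (map_pmf (Pair T) (pmf_of_set T))) ?S * ennreal (pmf (sgt_pmf w n) T) =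
        ennreal (tree_weight w T * real (card {v \<in> T. far R T v}) / (real n * trees_gf w $ n))"
      unfolding vertex[OF T] pmf_sgt[OF assms] using T tree_weight_nonneg[OF weights] pos
      by (simp add: ennreal_mult''[symmetric] mult.commute)
  qed
  also have "\<dots> = ennreal (pointed R n / (trees_gf w * C) $ n)"
    using tree_weight_nonneg[OF weights] pos
    by (subst sum_ennreal) (auto simp: sum_divide_distrib[symmetric] sum_far_eq_pointed T_C_nth)
  finally show ?thesis
    using pos pointed_nonneg[of R n] by (simp add: measure_def T_C_nth)
qed

lemma filterlim_flt:
  assumes "strict_mono s" "\<And>i. sgt_defined w (s i)"
  shows "filterlim s (flt 1) sequentially"
  unfolding flt_def filterlim_inf filterlim_principal
proof
  show "filterlim s sequentially sequentially"
    using assms(1) by (rule filterlim_subseq)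
  show "\<forall>\<^sub>F i in sequentially. s i \<in> {n. 0 < Z n 1}"
  proof (intro always_eventually allI)
    fix i
    have pos: "0 < trees_gf w $ s i" using assms(2) by (simp add: sgt_defined_iff)
    then have "0 < s i" by (cases "s i") auto
    then show "s i \<in> {n. 0 < Z n 1}" using pos by (simp add: Z_1 T_C_nth)
  qed
qed

end

text \<open>Almost sure finiteness is part of the conclusion because \<open>real_of_enat\<close>
  sends \<open>\<infinity>\<close> to 0: convergence in law of the real images alone would not
  exclude mass of the limit at \<open>\<infinity>\<close>.\<close>

theorem theorem1:
  fixes w :: "nat \<Rightarrow> real" and s :: "nat \<Rightarrow> nat"
  assumes "weight_sequence w"
    and "strict_mono s" and "\<And>i. sgt_defined w (s i)"
  shows "(AE \<omega> in limit_space (offspring_pmf w). limit_border_dist \<omega> \<noteq> \<infinity>) \<and>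
    weak_conv_m
      (\<lambda>i. distr (measure_pmf (pointed_sgt_pmf w (s i))) borel (\<lambda>Tv. real_of_enat (tree_border_dist Tv)))
      (distr (limit_space (offspring_pmf w)) borel (\<lambda>\<omega>. real_of_enat (limit_border_dist \<omega>))) \<and>
    (\<forall>p::real. p \<ge> 1 \<longrightarrow>
      (\<lambda>i. \<integral>\<^sup>+ Tv. enat_powr (tree_border_dist Tv) p \<partial>measure_pmf (pointed_sgt_pmf w (s i)))
        \<longlonglongrightarrow> (\<integral>\<^sup>+ \<omega>. enat_powr (limit_border_dist \<omega>) p \<partial>limit_space (offspring_pmf w)))"
proof -
  interpret sgt w by standard (rule assms)
  obtain \<epsilon> where \<epsilon>: "weighted_trees_leaf w (trees_gf w) \<epsilon>"
    and lim: "\<And>R. ((\<lambda>n. pointed R n / (trees_gf w * C) $ n) \<longlongrightarrow> enn2real (limit_tail (offspring_pmf w) R)) (flt 1)"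
    using pointed_tail_limit by blast
  interpret weighted_trees_leaf w "trees_gf w" \<epsilon> by (rule \<epsilon>)
  \<comment> \<open>The value \<open>1 - \<epsilon>\<close> may be 0, while
    \<open>geometric_tail\<close> asks for a positive rate.\<close>
  define \<rho> where "\<rho> = max (1 - \<epsilon>) (1 / 2)"
  have \<rho>: "0 < \<rho>" "\<rho> < 1" "0 \<le> 1 - \<epsilon>" "1 - \<epsilon> \<le> \<rho>" using eps by (auto simp: \<rho>_def)
  let ?P = "\<lambda>i. measure_pmf (pointed_sgt_pmf w (s i))" and ?Q = "limit_space (offspring_pmf w)"
  interpret Q: prob_space ?Q by (rule prob_space_limit)
  have tail: "measure (?P i) {x \<in> space (?P i). enat R \<le> tree_border_dist x} =
      pointed R (s i) / (trees_gf w * C) $ s i" for i R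
    using sgt_tail[OF assms(3), of i R] by simp
  have tail_Q: "measure ?Q {x \<in> space ?Q. enat R \<le> limit_border_dist x} = enn2real (limit_tail (offspring_pmf w) R)" for R
    using emeasure_limit_tail[OF offspring_mean offspring_0, of R] by (simp add: measure_def)
  have le: "pointed R (s i) / (trees_gf w * C) $ s i \<le> \<rho> ^ R" for R i
  proof -
    have pos: "0 < trees_gf w $ s i" using assms(3) by (simp add: sgt_defined_iff)
    then have "0 < s i" by (cases "s i") auto
    then have pos': "0 < (trees_gf w * C) $ s i" using pos by (simp add: T_C_nth)
    then have "pointed R (s i) / (trees_gf w * C) $ s i \<le> (1 - \<epsilon>) ^ R"
      using pointed_exponential[of R "s i"] by (simp add: pos_divide_le_eq)
    also have "\<dots> \<le> \<rho> ^ R" using \<rho> by (intro power_mono) auto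
    finally show ?thesis .
  qed
  have conv: "(\<lambda>i. pointed R (s i) / (trees_gf w * C) $ s i) \<longlonglongrightarrow> enn2real (limit_tail (offspring_pmf w) R)" for R
    by (rule filterlim_compose[OF lim filterlim_flt[OF assms(2,3)]])
  have P: "geometric_tail (?P i) tree_border_dist \<rho>" for i
  proof (intro geometric_tail.intro geometric_tail_axioms.intro measure_pmf.prob_space_axioms)
    show "measure (?P i) {x \<in> space (?P i). enat R \<le> tree_border_dist x} \<le> \<rho> ^ R" for R
      unfolding tail by (rule le)
  qed (use \<rho> in auto)
  have Q: "geometric_tail ?Q limit_border_dist \<rho>"
  proof (intro geometric_tail.intro geometric_tail_axioms.intro Q.prob_space_axioms)
    show "{x \<in> space ?Q. enat R \<le> limit_border_dist x} \<in> sets ?Q" for R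
      using sets_limit_tail by simp
    \<comment> \<open>The limit inherits the geometric bound from the finite trees.\<close>
    show "measure ?Q {x \<in> space ?Q. enat R \<le> limit_border_dist x} \<le> \<rho> ^ R" for R
      unfolding tail_Q by (rule LIMSEQ_le_const2[OF conv]) (use le in blast)
  qed (use \<rho> in auto)
  have lim': "(\<lambda>i. measure (?P i) {x \<in> space (?P i). enat R \<le> tree_border_dist x}) \<longlonglongrightarrow>
      measure ?Q {x \<in> space ?Q. enat R \<le> limit_border_dist x}" for R
    unfolding tail tail_Q by (rule conv)
  show ?thesis
    using geometric_tail.AE_finite[OF Q] geometric_tail_weak_conv[OF P Q lim']
      geometric_tail_moments[OF P Q lim'] by blast
qed

end
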